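(* For every $n\geq 1$, the Lusternik-Schnirelmann category of the homogeneous space $U(2n)/Sp(n)$ satisfies $\mathrm{cat}\, \big(U(2n)/Sp(n)\big)=n$.
   Context: For a topological space $X$, an open set $U\subset X$ is called categorical when it is contractible in $X$ (the inclusion $U\hookrightarrow X$ is homotopic to a constant map). The LS category $\mathrm{cat}\, X$ is the minimum number, minus one, of categorical open sets needed to cover $X$. The symplectic group $Sp(n)$ is identified (via complexification) with the subgroup of matrices $U\in U(2n)$ such that $UJU^T=J$, where $J=\begin{pmatrix}0&-I_n\\ I_n&0\end{pmatrix}$. *)

theory Defs
  imports "HOL-Analysis.Analysis" "HOL-Algebra.Coset"
begin

definition categorical_in :: "'a topology \<Rightarrow> 'a set \<Rightarrow> bool" where
  "categorical_in X U \<longleftrightarrow>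
     openin X U \<and>
     (\<exists>c \<in> topspace X. homotopic_with (\<lambda>_. True) (subtopology X U) X (\<lambda>x. x) (\<lambda>_. c))"

text \<open>
  The value is \<open>\<infinity>\<close> if there is no finite categorical cover. Subtraction on \<^typ>\<open>enat\<close>
  truncates, which only affects the empty space: it gets the value 0 instead of -1.
\<close>

definition LS_cat :: "'a topology \<Rightarrow> enat" where
  "LS_cat X =
     (INF \<U> \<in> {\<U>. finite \<U> \<and> (\<forall>U\<in>\<U>. categorical_in X U) \<and> \<Union>\<U> = topspace X}.
        enat (card \<U>)) - 1"

definition quotient_topology :: "'a topology \<Rightarrow> ('a \<Rightarrow> 'b) \<Rightarrow> 'b topology" where
  "quotient_topology X q =
     topology (\<lambda>V. V \<subseteq> q ` topspace X \<and> openin X {x \<in> topspace X. q x \<in> V})"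

lemma openin_quotient_topology:
  "openin (quotient_topology X q) V \<longleftrightarrow>
     V \<subseteq> q ` topspace X \<and> openin X {x \<in> topspace X. q x \<in> V}"
proof -
  have "istopology (\<lambda>V. V \<subseteq> q ` topspace X \<and> openin X {x \<in> topspace X. q x \<in> V})"
    unfolding istopology_def
  proof (intro conjI allI impI)
    fix S T
    assume S: "S \<subseteq> q ` topspace X \<and> openin X {x \<in> topspace X. q x \<in> S}"
      and T: "T \<subseteq> q ` topspace X \<and> openin X {x \<in> topspace X. q x \<in> T}"
    then show "S \<inter> T \<subseteq> q ` topspace X" by blast
    have "{x \<in> topspace X. q x \<in> S \<inter> T} =
        {x \<in> topspace X. q x \<in> S} \<inter> {x \<in> topspace X. q x \<in> T}" by blast
    then show "openin X {x \<in> topspace X. q x \<in> S \<inter> T}"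
      using S T by (simp add: openin_Int)
  next
    fix K
    assume K: "\<forall>V\<in>K. V \<subseteq> q ` topspace X \<and> openin X {x \<in> topspace X. q x \<in> V}"
    then show "\<Union>K \<subseteq> q ` topspace X" by blast
    have "{x \<in> topspace X. q x \<in> \<Union>K} = (\<Union>V\<in>K. {x \<in> topspace X. q x \<in> V})" by blast
    then show "openin X {x \<in> topspace X. q x \<in> \<Union>K}"
      using K by (auto intro!: openin_Union)
  qed
  then show ?thesis
    by (simp add: quotient_topology_def topology_inverse')
qed

lemma topspace_quotient_topology: "topspace (quotient_topology X q) = q ` topspace X"
proof
  show "topspace (quotient_topology X q) \<subseteq> q ` topspace X"
    using openin_quotient_topology[of X q "topspace (quotient_topology X q)"] by auto
  have "{x \<in> topspace X. q x \<in> q ` topspace X} = topspace X" by blast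
  then show "q ` topspace X \<subseteq> topspace (quotient_topology X q)"
    by (intro openin_subset) (simp add: openin_quotient_topology)
qed

lemma quotient_map_quotient_topology: "quotient_map X (quotient_topology X q) q"
  by (auto simp: quotient_map_def topspace_quotient_topology openin_quotient_topology)

definition homogeneous_space ::
    "('a::topological_space, 'b) monoid_scheme \<Rightarrow> 'a set \<Rightarrow> 'a set topology" where
  "homogeneous_space G H =
     quotient_topology (top_of_set (carrier G)) (\<lambda>g. g <#\<^bsub>G\<^esub> H)"

definition adjoint_matrix :: "complex ^ 'n ^ 'm \<Rightarrow> complex ^ 'm ^ 'n" where
  "adjoint_matrix A = (\<chi> i j. cnj (A $ j $ i))"

definition unitary_group :: "(complex ^ 'm ^ 'm) monoid" where
  "unitary_group =
     \<lparr>carrier = {U. U ** adjoint_matrix U = mat 1 \<and> adjoint_matrix U ** U = mat 1},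
      mult = (**), one = mat 1\<rparr>"

text \<open>
  The index type \<^typ>\<open>'n + 'n\<close> has \<open>2n\<close> elements, where \<open>n\<close> is the cardinality of \<^typ>\<open>'n\<close>;
  \<^const>\<open>Inl\<close> is the first block and \<^const>\<open>Inr\<close> the second one.
\<close>

definition J_matrix :: "complex ^ ('n::finite + 'n) ^ ('n + 'n)" where
  "J_matrix = (\<chi> i j. case (i, j) of
       (Inl a, Inr b) \<Rightarrow> if a = b then - 1 else 0
     | (Inr a, Inl b) \<Rightarrow> if a = b then 1 else 0
     | _ \<Rightarrow> 0)"

definition symplectic_group :: "(complex ^ ('n::finite + 'n) ^ ('n + 'n)) set" where
  "symplectic_group =
     {U \<in> carrier unitary_group. U ** J_matrix ** transpose U = J_matrix}"

lemma adjoint_matrix_mult: "adjoint_matrix (A ** B) = adjoint_matrix B ** adjoint_matrix A"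
  by (simp add: adjoint_matrix_def matrix_matrix_mult_def vec_eq_iff mult.commute)

lemma adjoint_matrix_adjoint_matrix [simp]: "adjoint_matrix (adjoint_matrix A) = A"
  by (simp add: adjoint_matrix_def vec_eq_iff)

lemma adjoint_matrix_mat_1 [simp]: "adjoint_matrix (mat 1) = mat 1"
  by (auto simp: adjoint_matrix_def mat_def vec_eq_iff)

lemma group_unitary_group: "group (unitary_group :: (complex ^ 'm::finite ^ 'm) monoid)"
proof (rule groupI)
  fix A B :: "complex ^ 'm ^ 'm"
  assume A: "A \<in> carrier unitary_group" and B: "B \<in> carrier unitary_group"
  have "A ** B ** (adjoint_matrix B ** adjoint_matrix A) =
      A ** (B ** adjoint_matrix B) ** adjoint_matrix A"
    by (simp add: matrix_mul_assoc)
  moreover have "adjoint_matrix B ** adjoint_matrix A ** (A ** B) =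
      adjoint_matrix B ** (adjoint_matrix A ** A) ** B"
    by (simp add: matrix_mul_assoc)
  ultimately show "A \<otimes>\<^bsub>unitary_group\<^esub> B \<in> carrier unitary_group"
    using A B by (simp add: unitary_group_def adjoint_matrix_mult)
next
  fix A :: "complex ^ 'm ^ 'm"
  assume "A \<in> carrier unitary_group"
  then show "\<exists>B\<in>carrier unitary_group. B \<otimes>\<^bsub>unitary_group\<^esub> A = \<one>\<^bsub>unitary_group\<^esub>"
    by (intro bexI[of _ "adjoint_matrix A"]) (auto simp: unitary_group_def)
qed (auto simp: unitary_group_def matrix_mul_assoc)

lemma subgroup_symplectic_group:
  "subgroup (symplectic_group :: (complex ^ ('n::finite + 'n) ^ ('n + 'n)) set) unitary_group"
proof -
  interpret group "unitary_group :: (complex ^ ('n + 'n) ^ ('n + 'n)) monoid"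
    by (rule group_unitary_group)
  let ?G = "unitary_group :: (complex ^ ('n + 'n) ^ ('n + 'n)) monoid"
  let ?J = "J_matrix :: complex ^ ('n + 'n) ^ ('n + 'n)"
  have mult: "mult ?G = (**)" and one: "one ?G = mat 1"
    by (simp_all add: unitary_group_def)
  show ?thesis
  proof (rule subgroupI)
    show "symplectic_group \<subseteq> carrier ?G"
      by (auto simp: symplectic_group_def)
    have "mat 1 \<in> (symplectic_group :: (complex ^ ('n + 'n) ^ ('n + 'n)) set)"
      using one_closed by (simp add: symplectic_group_def one transpose_mat)
    then show "(symplectic_group :: (complex ^ ('n + 'n) ^ ('n + 'n)) set) \<noteq> {}" by blast
  next
    fix A :: "complex ^ ('n + 'n) ^ ('n + 'n)"
    assume "A \<in> symplectic_group"
    then have A: "A \<in> carrier ?G" and AJ: "A ** ?J ** transpose A = ?J"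
      by (auto simp: symplectic_group_def)
    define B where "B = inv\<^bsub>?G\<^esub> A"
    have BA: "B ** A = mat 1"
      using l_inv[OF A] by (simp add: B_def mult one)
    have "B ** ?J ** transpose B = B ** (A ** ?J ** transpose A) ** transpose B"
      by (simp add: AJ)
    also have "\<dots> = (B ** A) ** ?J ** transpose (B ** A)"
      by (simp add: matrix_transpose_mul matrix_mul_assoc)
    also have "\<dots> = ?J"
      by (simp add: BA transpose_mat)
    finally show "inv\<^bsub>?G\<^esub> A \<in> symplectic_group"
      using A by (simp add: symplectic_group_def flip: B_def) (simp add: B_def)
  next
    fix A B :: "complex ^ ('n + 'n) ^ ('n + 'n)"
    assume A: "A \<in> symplectic_group" and B: "B \<in> symplectic_group"
    have "(A ** B) ** ?J ** transpose (A ** B) = A ** (B ** ?J ** transpose B) ** transpose A"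
      by (simp add: matrix_transpose_mul matrix_mul_assoc)
    then show "A \<otimes>\<^bsub>?G\<^esub> B \<in> symplectic_group"
      using A B m_closed[of A B] by (simp add: symplectic_group_def mult)
  qed
qed

end

theory Submission
  imports Defs "HOL-Combinatorics.Cycles"
begin

text \<open>
  Write \<open>X\<close> for the orbit of \<open>J\<close> under \<open>U \<mapsto> U J U\<^sup>T\<close>; it is homeomorphic to \<open>U(2n)/Sp(n)\<close> and consists of
  the skew-symmetric unitary matrices \<open>A\<close>. Each such \<open>A\<close> gives a quaternionic structure
  \<open>v \<mapsto> A cnj(v)\<close>.

  Upper bound: the eigenspaces of \<open>A J\<inverse>\<close> are quaternionic, so \<open>A J\<inverse>\<close> has at most \<open>n\<close> eigenvalues. For
  \<open>n + 1\<close> points \<open>z\<close> of the circle, the open sets of those \<open>A\<close> for which \<open>z\<close> is not an eigenvalue of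
  \<open>A J\<inverse>\<close> therefore cover \<open>X\<close>, and a Cayley transform contracts each of them to \<open>-z J\<close>.

  Lower bound: the forms \<open>tr ((g\<inverse> dg) ^ (4k + 1))\<close>, \<open>k < n\<close>, are closed, and their product is a
  top-degree form on \<open>X\<close>. Given \<open>n\<close> categorical open sets that cover \<open>X\<close>, deform the \<open>k\<close>-th factor
  by a homotopy from the identity to a map that is constant on a smaller set. The integral of the
  product over a cycle does not change, but at the end of the deformation one of the factors vanishes
  at every point. The cycle is \<open>\<Phi> J \<Phi>\<^sup>T\<close>, where \<open>\<Phi>\<close> is a product of complex reflections
  \<open>1 + (z - 1) v v\<^sup>*\<close>, the \<open>k\<close>-th one with \<open>v\<close> supported on \<open>2k + 1\<close> coordinates, in polar
  coordinates. Rotating the factors into separate blocks turns \<open>\<Phi> J \<Phi>\<^sup>T\<close> into a direct sum and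
  shows that the integral is nonzero. To avoid differential forms on manifolds, everything is pulled
  back to a box.
\<close>

section \<open>Calculus in coordinates\<close>

text \<open>The forms are closed on all of GL(2n,C), not only on \<open>X\<close>, so perturbed maps
  may leave \<open>X\<close> as long as their values stay invertible. This gives room to replace
  continuous homotopies by polynomial ones. The exponents 4k + 1 come from the two halves of the
  cycle: for exponent 2m + 1 a reflection and its transpose contribute with relative sign (-1)^m, so
  they add up for m = 2k and would cancel for odd m. The degrees 1, 5, ..., 4n - 3 sum to n(2n - 1),
  the dimension of \<open>X\<close>.

  The parameter box has faces, and Stokes' theorem leaves one term for each. The two faces of a
  phase cancel by periodicity. On a face of an angle two partial derivatives of the cycle are
  proportional, so the form vanishes there; this relation has to survive the deformation, which is
  why the deformation is assembled from operations that transport such relations. It must moreover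
  be exact at its ends: the identity at time 0, and stationary near the collapsed points at time 1.

  The final integral is never evaluated. Its integrand is a nonzero constant times a density that is
  nonnegative on the box.\<close>

text \<open>Only finitely many coordinates matter. Indexing them by all natural numbers allows the
  number of parameters to vary.\<close>

type_synonym point = "nat \<Rightarrow> real"

definition pd :: "nat \<Rightarrow> (point \<Rightarrow> 'b::real_normed_vector) \<Rightarrow> point \<Rightarrow> 'b" where
  "pd j F t = vector_derivative (\<lambda>s. F (t(j := s))) (at (t j))"

definition C1 :: "(point \<Rightarrow> 'b::real_normed_vector) \<Rightarrow> bool" where
  "C1 F \<longleftrightarrow> continuous_on UNIV F \<and>
     (\<forall>j. (\<forall>t. (\<lambda>s. F (t(j := s))) differentiable at (t j)) \<and> continuous_on UNIV (pd j F))"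

text \<open>Symmetry of the mixed partials belongs to the notion and is passed on by every operation
  below. It is what cancels the second derivatives when the trace forms are shown to be
  closed.\<close>

definition C2 :: "(point \<Rightarrow> 'b::real_normed_vector) \<Rightarrow> bool" where
  "C2 F \<longleftrightarrow> C1 F \<and> (\<forall>j. C1 (pd j F)) \<and> (\<forall>i j. pd i (pd j F) = pd j (pd i F))"

lemma pd_eqI: "((\<lambda>s. F (t(j := s))) has_vector_derivative D) (at (t j)) \<Longrightarrow> pd j F t = D"
  by (simp add: pd_def vector_derivative_at)

lemma C1_continuous: "C1 F \<Longrightarrow> continuous_on UNIV F"
  and C1_continuous_pd: "C1 F \<Longrightarrow> continuous_on UNIV (pd j F)"
  by (simp_all add: C1_def)

lemma C1_has_pd:
  assumes "C1 F" shows "((\<lambda>s. F (t(j := s))) has_vector_derivative pd j F t) (at (t j))"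
  using assms unfolding C1_def pd_def by (simp add: vector_derivative_works[symmetric])

lemma C1_has_pd_upd:
  assumes "C1 F" shows "((\<lambda>s. F (t(j := s))) has_vector_derivative pd j F (t(j := x))) (at x)"
  using C1_has_pd[OF assms, of "t(j := x)" j] by simp

lemma C1I:
  assumes "continuous_on UNIV F"
    and "\<And>j t. ((\<lambda>s. F (t(j := s))) has_vector_derivative F' j t) (at (t j))"
    and "\<And>j. continuous_on UNIV (F' j)"
  shows "C1 F" "pd j F = F' j"
proof -
  have *: "pd i F = F' i" for i
    by (rule ext, rule pd_eqI, rule assms(2))
  then show "pd j F = F' j" .
  show "C1 F"
    unfolding C1_def * using assms differentiableI_vector by blast
qed

lemma C2_C1: "C2 F \<Longrightarrow> C1 F" and C2_pd: "C2 F \<Longrightarrow> C1 (pd j F)"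
  and C2_commute: "C2 F \<Longrightarrow> pd i (pd j F) = pd j (pd i F)"
  by (auto simp: C2_def)

lemma C2_continuous: "C2 F \<Longrightarrow> continuous_on UNIV F"
  by (simp add: C2_C1 C1_continuous)

lemma C2I:
  assumes "C1 F" "\<And>j. C1 (pd j F)" "\<And>i j. pd i (pd j F) = pd j (pd i F)" shows "C2 F"
  using assms by (simp add: C2_def)

lemma C1_const: "C1 (\<lambda>_. c)" and pd_const [simp]: "pd j (\<lambda>_. c) = (\<lambda>_. 0)"
  by (rule C1I[where F' = "\<lambda>_ _. 0"]; auto intro!: derivative_eq_intros)+

lemma C2_const: "C2 (\<lambda>_. c)"
  by (simp add: C2_def C1_const)

context bounded_linear
begin

lemma C1_comp:
  assumes "C1 F" shows "C1 (\<lambda>t. f (F t))" "pd j (\<lambda>t. f (F t)) = (\<lambda>t. f (pd j F t))"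
  by (rule C1I[where F' = "\<lambda>j t. f (pd j F t)"];
      rule continuous_on[OF C1_continuous[OF assms]] continuous_on[OF C1_continuous_pd[OF assms]]
        has_vector_derivative[OF C1_has_pd[OF assms]])+

lemma C2_comp:
  assumes "C2 F" shows "C2 (\<lambda>t. f (F t))"
proof (rule C2I)
  show "C1 (\<lambda>t. f (F t))" by (rule C1_comp(1)[OF C2_C1[OF assms]])
next
  fix j
  note 1 = C1_comp(2)[OF C2_C1[OF assms]] and 2 = C1_comp[OF C2_pd[OF assms]]
  show "C1 (pd j (\<lambda>t. f (F t)))" unfolding 1 by (rule 2)
  fix i show "pd i (pd j (\<lambda>t. f (F t))) = pd j (pd i (\<lambda>t. f (F t)))"
    unfolding 1 2(2) by (subst C2_commute[OF assms]) (rule refl)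
qed

end

lemma C1_add:
  assumes "C1 F" "C1 G"
  shows "C1 (\<lambda>t. F t + G t)" "pd j (\<lambda>t. F t + G t) = (\<lambda>t. pd j F t + pd j G t)"
  by (rule C1I[where F' = "\<lambda>j t. pd j F t + pd j G t"];
      rule continuous_on_add[OF C1_continuous[OF assms(1)] C1_continuous[OF assms(2)]]
        continuous_on_add[OF C1_continuous_pd[OF assms(1)] C1_continuous_pd[OF assms(2)]]
        has_vector_derivative_add[OF C1_has_pd[OF assms(1)] C1_has_pd[OF assms(2)]])+

lemma C2_add:
  assumes "C2 F" "C2 G" shows "C2 (\<lambda>t. F t + G t)"
proof (rule C2I)
  show "C1 (\<lambda>t. F t + G t)" by (rule C1_add(1)[OF C2_C1 C2_C1]; fact)
next
  fix j
  note 1 = C1_add(2)[OF C2_C1[OF assms(1)] C2_C1[OF assms(2)]]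
    and 2 = C1_add[OF C2_pd[OF assms(1)] C2_pd[OF assms(2)]]
  show "C1 (pd j (\<lambda>t. F t + G t))" unfolding 1 by (rule 2)
  fix i show "pd i (pd j (\<lambda>t. F t + G t)) = pd j (pd i (\<lambda>t. F t + G t))"
    unfolding 1 2(2) C2_commute[OF assms(1), of i j] C2_commute[OF assms(2), of i j] by (rule refl)
qed

lemmas C1_minus = bounded_linear.C1_comp(1)[OF bounded_linear_minus[OF bounded_linear_ident]]
  and pd_minus = bounded_linear.C1_comp(2)[OF bounded_linear_minus[OF bounded_linear_ident]]
  and C2_minus = bounded_linear.C2_comp[OF bounded_linear_minus[OF bounded_linear_ident]]

lemma C2_diff:
  assumes "C2 F" "C2 G" shows "C2 (\<lambda>t. F t - G t)"
proof -
  have "(\<lambda>t. F t - G t) = (\<lambda>t. F t + - G t)" by simp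
  then show ?thesis using C2_add[OF assms(1) C2_minus[OF assms(2)]] by metis
qed

lemma C1_diff:
  assumes "C1 F" "C1 G"
  shows "C1 (\<lambda>t. F t - G t)" "pd j (\<lambda>t. F t - G t) = (\<lambda>t. pd j F t - pd j G t)"
proof -
  have "(\<lambda>t. F t - G t) = (\<lambda>t. F t + - G t)" by simp
  then show "C1 (\<lambda>t. F t - G t)" "pd j (\<lambda>t. F t - G t) = (\<lambda>t. pd j F t - pd j G t)"
    using C1_add[OF assms(1) C1_minus[OF assms(2)]] pd_minus[OF assms(2)] by simp_all
qed

lemma C1_sum:
  assumes "\<And>i. i \<in> I \<Longrightarrow> C1 (F i)"
  shows "C1 (\<lambda>t. \<Sum>i\<in>I. F i t)" "pd j (\<lambda>t. \<Sum>i\<in>I. F i t) = (\<lambda>t. \<Sum>i\<in>I. pd j (F i) t)"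
proof -
  have "C1 (\<lambda>t. \<Sum>i\<in>I. F i t) \<and> pd j (\<lambda>t. \<Sum>i\<in>I. F i t) = (\<lambda>t. \<Sum>i\<in>I. pd j (F i) t)"
    using assms by (induction I rule: infinite_finite_induct) (simp_all add: C1_const C1_add)
  then show "C1 (\<lambda>t. \<Sum>i\<in>I. F i t)" "pd j (\<lambda>t. \<Sum>i\<in>I. F i t) = (\<lambda>t. \<Sum>i\<in>I. pd j (F i) t)"
    by blast+
qed

lemma C2_sum: "(\<And>i. i \<in> I \<Longrightarrow> C2 (F i)) \<Longrightarrow> C2 (\<lambda>t. \<Sum>i\<in>I. F i t)"
  by (induction I rule: infinite_finite_induct) (simp_all add: C2_const C2_add)

context bounded_bilinear
begin

lemma C1_prod:
  assumes "C1 F" "C1 G"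
  shows "C1 (\<lambda>t. prod (F t) (G t))"
    "pd j (\<lambda>t. prod (F t) (G t)) = (\<lambda>t. prod (F t) (pd j G t) + prod (pd j F t) (G t))"
proof -
  have "((\<lambda>s. prod (F (t(j := s))) (G (t(j := s)))) has_vector_derivative
      prod (F t) (pd j G t) + prod (pd j F t) (G t)) (at (t j))" for j t
    using has_vector_derivative[OF C1_has_pd[OF assms(1), of t j] C1_has_pd[OF assms(2), of t j]]
    by simp
  note 1 = this
  note c = C1_continuous[OF assms(1)] C1_continuous_pd[OF assms(1)]
    C1_continuous[OF assms(2)] C1_continuous_pd[OF assms(2)]
  note 2 = continuous_on_add[OF continuous_on[OF c(1,4)] continuous_on[OF c(2,3)]]
  show "C1 (\<lambda>t. prod (F t) (G t))"
    "pd j (\<lambda>t. prod (F t) (G t)) = (\<lambda>t. prod (F t) (pd j G t) + prod (pd j F t) (G t))"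
    by (rule C1I[where F' = "\<lambda>j t. prod (F t) (pd j G t) + prod (pd j F t) (G t)"];
        rule 1 2 continuous_on[OF c(1,3)])+
qed

lemma C2_prod:
  assumes "C2 F" "C2 G" shows "C2 (\<lambda>t. prod (F t) (G t))"
proof (rule C2I)
  show "C1 (\<lambda>t. prod (F t) (G t))" by (rule C1_prod(1)[OF C2_C1 C2_C1]; fact)
next
  fix j
  note F = C2_C1[OF assms(1)] C2_pd[OF assms(1)] and G = C2_C1[OF assms(2)] C2_pd[OF assms(2)]
  note 1 = C1_prod(2)[OF F(1) G(1)] and 2 = C1_prod[OF F(1) G(2)] and 3 = C1_prod[OF F(2) G(1)]
  note 4 = C1_add[OF 2(1) 3(1)]
  show "C1 (pd j (\<lambda>t. prod (F t) (G t)))" unfolding 1 by (rule 4)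
  fix i show "pd i (pd j (\<lambda>t. prod (F t) (G t))) = pd j (pd i (\<lambda>t. prod (F t) (G t)))"
    unfolding 1 4(2) 2(2) 3(2) C2_commute[OF assms(1), of i j] C2_commute[OF assms(2), of i j]
    by (simp add: add_ac)
qed

end

lemmas C2_mult = bounded_bilinear.C2_prod[OF bounded_bilinear_mult]
  and C1_mult = bounded_bilinear.C1_prod[OF bounded_bilinear_mult]

lemma C2_prod_set:
  fixes F :: "'i \<Rightarrow> point \<Rightarrow> 'b::real_normed_field"
  shows "(\<And>i. i \<in> I \<Longrightarrow> C2 (F i)) \<Longrightarrow> C2 (\<lambda>t. \<Prod>i\<in>I. F i t)"
  by (induction I rule: infinite_finite_induct) (simp_all add: C2_const C2_mult)

lemma C1_prod_set:
  fixes F :: "'i \<Rightarrow> point \<Rightarrow> 'b::real_normed_field"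
  assumes "finite I" "\<And>i. i \<in> I \<Longrightarrow> C1 (F i)"
  shows "C1 (\<lambda>t. \<Prod>i\<in>I. F i t)"
    "pd j (\<lambda>t. \<Prod>i\<in>I. F i t) = (\<lambda>t. \<Sum>i\<in>I. pd j (F i) t * (\<Prod>k\<in>I-{i}. F k t))"
proof -
  have "C1 (\<lambda>t. \<Prod>i\<in>I. F i t) \<and>
    pd j (\<lambda>t. \<Prod>i\<in>I. F i t) = (\<lambda>t. \<Sum>i\<in>I. pd j (F i) t * (\<Prod>k\<in>I-{i}. F k t))"
    using assms
  proof (induction I rule: finite_induct)
    case (insert x I)
    have "(\<Prod>k\<in>insert x I - {i}. F k t) = F x t * (\<Prod>k\<in>I - {i}. F k t)" if "i \<in> I" for i t
    proof -
      have "insert x I - {i} = insert x (I - {i})" using that insert.hyps by blast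
      then show ?thesis using insert.hyps by simp
    qed
    then show ?case
      using insert by (simp add: C1_mult fun_eq_iff sum_distrib_left mult_ac)
  qed (simp add: C1_const)
  then show "C1 (\<lambda>t. \<Prod>i\<in>I. F i t)"
    "pd j (\<lambda>t. \<Prod>i\<in>I. F i t) = (\<lambda>t. \<Sum>i\<in>I. pd j (F i) t * (\<Prod>k\<in>I-{i}. F k t))"
    by blast+
qed

section \<open>Functions of one coordinate, products, inverses and cutoffs\<close>

lemma continuous_on_fun_coord: "continuous_on UNIV (\<lambda>t::point. t i)"
  by (simp add: continuous_on_product_coordinates)

lemma C1_coord:
  fixes h :: "real \<Rightarrow> 'b::real_normed_vector"
  assumes "\<And>x. (h has_vector_derivative h' x) (at x)" "continuous_on UNIV h'"
  shows "C1 (\<lambda>t. h (t i))" "pd j (\<lambda>t. h (t i)) = (\<lambda>t. if j = i then h' (t i) else 0)"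
proof -
  have c: "continuous_on UNIV h"
    using assms(1) by (meson continuous_at_imp_continuous_on has_vector_derivative_continuous)
  have "continuous_on UNIV (\<lambda>t::point. h (t i))" "continuous_on UNIV (\<lambda>t::point. h' (t i))"
    by (rule continuous_on_compose2[OF c continuous_on_fun_coord]
        continuous_on_compose2[OF assms(2) continuous_on_fun_coord]; simp)+
  then have 1: "continuous_on UNIV (\<lambda>t::point. h (t i))"
      "continuous_on UNIV (\<lambda>t::point. if j = i then h' (t i) else 0)" for j
    by (cases "j = i"; simp)+
  have 2: "((\<lambda>s. h ((t(j := s)) i)) has_vector_derivative (if j = i then h' (t i) else 0)) (at (t j))"
    for j and t :: point
    using assms(1) by (cases "j = i") (auto simp: fun_upd_def)
  show "C1 (\<lambda>t. h (t i))" "pd j (\<lambda>t. h (t i)) = (\<lambda>t. if j = i then h' (t i) else 0)"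
    by (rule C1I[where F' = "\<lambda>j t. if j = i then h' (t i) else 0"]; rule 1 2)+
qed

lemma C2_coord:
  fixes h :: "real \<Rightarrow> 'b::real_normed_vector"
  assumes "\<And>x. (h has_vector_derivative h' x) (at x)" "\<And>x. (h' has_vector_derivative h'' x) (at x)"
    "continuous_on UNIV h''"
  shows "C2 (\<lambda>t. h (t i))"
proof -
  have c: "continuous_on UNIV h'"
    using assms(2) by (meson continuous_at_imp_continuous_on has_vector_derivative_continuous)
  note 1 = C1_coord[OF assms(1) c] and 2 = C1_coord[OF assms(2,3)]
  have "C1 (\<lambda>t. if j = i then h' (t i) else 0)" for j
    by (cases "j = i") (simp_all add: 2 C1_const)
  moreover have "pd k (\<lambda>t. if j = i then h' (t i) else 0) =
      (if j = i then (\<lambda>t. if k = i then h'' (t i) else 0) else (\<lambda>t. 0))" for j k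
    by (cases "j = i") (simp_all add: 2)
  ultimately show ?thesis
    unfolding C2_def 1(2) by (auto simp: 1)
qed

lemma C1_inverse:
  fixes F :: "point \<Rightarrow> real"
  assumes "C1 F" "\<And>t. F t \<noteq> 0"
  shows "C1 (\<lambda>t. inverse (F t))"
    "pd j (\<lambda>t. inverse (F t)) = (\<lambda>t. - (inverse (F t) * pd j F t * inverse (F t)))"
proof -
  have 1: "((\<lambda>s. inverse (F (t(j := s)))) has_vector_derivative
      - (inverse (F t) * pd j F t * inverse (F t))) (at (t j))" for j t
    using DERIV_inverse'[of "\<lambda>s. F (t(j := s))" "pd j F t" "t j" UNIV] C1_has_pd[OF assms(1), of t j] assms(2)
    by (simp add: has_real_derivative_iff_has_vector_derivative)
  have 2: "continuous_on UNIV (\<lambda>t. inverse (F t))"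
    using assms C1_continuous by (intro continuous_intros) auto
  have 3: "continuous_on UNIV (\<lambda>t. - (inverse (F t) * pd j F t * inverse (F t)))" for j
    by (intro continuous_on_minus continuous_on_mult 2 C1_continuous_pd assms)
  show "C1 (\<lambda>t. inverse (F t))"
    "pd j (\<lambda>t. inverse (F t)) = (\<lambda>t. - (inverse (F t) * pd j F t * inverse (F t)))"
    by (rule C1I[where F' = "\<lambda>j t. - (inverse (F t) * pd j F t * inverse (F t))"]; rule 1 2 3)+
qed

lemma C2_inverse:
  fixes F :: "point \<Rightarrow> real"
  assumes "C2 F" "\<And>t. F t \<noteq> 0" shows "C2 (\<lambda>t. inverse (F t))"
proof (rule C2I)
  note 1 = C1_inverse[OF C2_C1[OF assms(1)] assms(2)]
  show "C1 (\<lambda>t. inverse (F t))" by (rule 1)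
  fix j
  note 2 = C1_mult[OF C1_mult(1)[OF 1(1) C2_pd[OF assms(1)]] 1(1)]
  note 3 = C1_minus[OF 2(1)] pd_minus[OF 2(1)]
  show "C1 (pd j (\<lambda>t. inverse (F t)))" unfolding 1 by (rule 3)
  fix i show "pd i (pd j (\<lambda>t. inverse (F t))) = pd j (pd i (\<lambda>t. inverse (F t)))"
    unfolding 1 3(2) 2(2) C1_mult(2)[OF 1(1) C2_pd[OF assms(1)]]
    by (simp add: C2_commute[OF assms(1), of i j] algebra_simps)
qed

text \<open>The cube is the lowest power of the positive part that is twice continuously
  differentiable. The case \<open>k = 1\<close> yields its derivative, and \<open>k = 0\<close>
  differentiates once more.\<close>

lemma C1_pos_part_power:
  fixes F :: "point \<Rightarrow> real"
  assumes "C1 F"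
  shows "C1 (\<lambda>t. max 0 (F t) ^ Suc (Suc k))"
    "pd j (\<lambda>t. max 0 (F t) ^ Suc (Suc k)) = (\<lambda>t. real (Suc (Suc k)) * max 0 (F t) ^ Suc k * pd j F t)"
proof -
  have D: "((\<lambda>x. max 0 x ^ Suc (Suc k)) has_field_derivative (real (Suc (Suc k)) * max 0 x ^ Suc k)) (at x)"
    for x :: real
  proof (cases x "0::real" rule: linorder_cases)
    case less
    have "((\<lambda>x::real. 0) has_field_derivative 0) (at x)" by simp
    then have "((\<lambda>x::real. max 0 x ^ Suc (Suc k)) has_field_derivative 0) (at x)"
      using less by (subst DERIV_cong_ev[OF refl _ refl, of _ "\<lambda>x. 0"])
        (auto simp: eventually_nhds intro!: exI[of _ "{..<0}"])
    then show ?thesis using less by (simp add: max_def)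
  next
    case greater
    have "((\<lambda>x::real. x ^ Suc (Suc k)) has_field_derivative real (Suc (Suc k)) * x ^ Suc k) (at x)"
      using DERIV_pow[of "Suc (Suc k)" x] by simp
    then have "((\<lambda>x::real. max 0 x ^ Suc (Suc k)) has_field_derivative real (Suc (Suc k)) * x ^ Suc k) (at x)"
      using greater by (subst DERIV_cong_ev[OF refl _ refl, of _ "\<lambda>x. x ^ Suc (Suc k)"])
        (auto simp: eventually_nhds intro!: exI[of _ "{0<..}"])
    then show ?thesis using greater by (simp add: max_def)
  next
    case equal
    \<comment> \<open>At 0 the difference quotient equals this product, which is dominated by
      \<open>max 0 h ^ Suc k\<close>.\<close>
    have "((\<lambda>h::real. max 0 h ^ Suc k * (if h > 0 then 1 else 0)) \<longlongrightarrow> 0) (at 0)"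
    proof (rule tendsto_0_le[where f = "\<lambda>h::real. max 0 h ^ Suc k" and K = 1])
      have "((\<lambda>h::real. max 0 h ^ Suc k) \<longlongrightarrow> max 0 0 ^ Suc k) (at 0)"
        by (intro tendsto_intros)
      then show "((\<lambda>h::real. max 0 h ^ Suc k) \<longlongrightarrow> 0) (at 0)" by simp
    qed simp
    moreover have "max 0 h ^ Suc k * (if h > 0 then 1 else 0) = max 0 h ^ Suc (Suc k) / h" for h :: real
      by (cases "h > 0") auto
    ultimately show ?thesis using equal by (simp add: DERIV_def)
  qed
  have 1: "((\<lambda>s. max 0 (F (t(j := s))) ^ Suc (Suc k)) has_vector_derivative
      real (Suc (Suc k)) * max 0 (F t) ^ Suc k * pd j F t) (at (t j))" for j t
    using DERIV_chain2[OF D, of "\<lambda>s. F (t(j := s))" "pd j F t" "t j" UNIV] C1_has_pd[OF assms(1), of t j]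
    unfolding has_real_derivative_iff_has_vector_derivative by simp
  have 2: "continuous_on UNIV (\<lambda>t. max 0 (F t) ^ Suc (Suc k))"
    by (intro continuous_intros C1_continuous assms)
  have 3: "continuous_on UNIV (\<lambda>t. real (Suc (Suc k)) * max 0 (F t) ^ Suc k * pd j F t)" for j
    by (intro continuous_intros C1_continuous C1_continuous_pd assms)
  show "C1 (\<lambda>t. max 0 (F t) ^ Suc (Suc k))"
    "pd j (\<lambda>t. max 0 (F t) ^ Suc (Suc k)) = (\<lambda>t. real (Suc (Suc k)) * max 0 (F t) ^ Suc k * pd j F t)"
    by (rule C1I[where F' = "\<lambda>j t. real (Suc (Suc k)) * max 0 (F t) ^ Suc k * pd j F t"]; rule 1 2 3)+
qed

lemma C2_pos_part_cube:
  fixes F :: "point \<Rightarrow> real"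
  assumes "C2 F" shows "C2 (\<lambda>t. max 0 (F t) ^ 3)"
proof -
  note 1 = C1_pos_part_power[OF C2_C1[OF assms], where k = 1]
    and 2 = C1_pos_part_power[OF C2_C1[OF assms], where k = 0]
  note 3 = C1_mult[OF 2(1) C2_pd[OF assms]]
  note 4 = C1_mult[OF C1_const[of 3] 3(1)]
  have p: "pd j (\<lambda>t. max 0 (F t) ^ 3) = (\<lambda>t. 3 * (max 0 (F t) ^ Suc (Suc 0) * pd j F t))" for j
    using 1(2) by (simp add: numeral_3_eq_3 mult.assoc)
  show ?thesis
  proof (rule C2I)
    show "C1 (\<lambda>t. max 0 (F t) ^ 3)" using 1(1) by (simp add: numeral_3_eq_3)
    fix j show "C1 (pd j (\<lambda>t. max 0 (F t) ^ 3))" unfolding p by (rule 4)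
    fix i show "pd i (pd j (\<lambda>t. max 0 (F t) ^ 3)) = pd j (pd i (\<lambda>t. max 0 (F t) ^ 3))"
      unfolding p 4(2) 3(2) 2(2) C2_commute[OF assms(1), of i j] by (simp add: mult_ac)
  qed
qed

lemma C2_Pair: 
  assumes "C2 F" "C2 G" shows "C2 (\<lambda>t. (F t, G t))"
proof -
  have 1: "bounded_linear (\<lambda>x::'a. (x, 0::'b))" "bounded_linear (\<lambda>y::'b. (0::'a, y))"
    by (intro bounded_linear_intros)+
  have "(\<lambda>t. (F t, G t)) = (\<lambda>t. (F t, 0) + (0, G t))" by simp
  then show ?thesis
    using C2_add[OF bounded_linear.C2_comp[OF 1(1) assms(1)] bounded_linear.C2_comp[OF 1(2) assms(2)]]
    by metis
qed

text \<open>Records that a map degenerates at a point: an alternating form evaluated on both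
  directions \<open>k\<close> and \<open>l\<close> vanishes there. The value \<open>u = 0\<close>
  covers a vanishing derivative in direction \<open>k\<close>.\<close>

definition proportional_at :: "nat \<Rightarrow> nat \<Rightarrow> real \<Rightarrow> point \<Rightarrow> (point \<Rightarrow> 'b::real_normed_vector) \<Rightarrow> bool" where
  "proportional_at k l u t F \<longleftrightarrow> pd k F t = u *\<^sub>R pd l F t"

lemma proportional_at_const: "proportional_at k l u t (\<lambda>_. c)"
  by (simp add: proportional_at_def)

lemma proportional_at_add:
  "C1 F \<Longrightarrow> C1 G \<Longrightarrow> proportional_at k l u t F \<Longrightarrow> proportional_at k l u t G \<Longrightarrow>
    proportional_at k l u t (\<lambda>t. F t + G t)"
  by (simp add: proportional_at_def C1_add scaleR_add_right)

lemma (in bounded_linear) proportional_at_comp: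
  "C1 F \<Longrightarrow> proportional_at k l u t F \<Longrightarrow> proportional_at k l u t (\<lambda>t. f (F t))"
  by (simp add: proportional_at_def C1_comp(2) scaleR)

lemma (in bounded_bilinear) proportional_at_prod:
  "C1 F \<Longrightarrow> C1 G \<Longrightarrow> proportional_at k l u t F \<Longrightarrow> proportional_at k l u t G \<Longrightarrow>
    proportional_at k l u t (\<lambda>t. prod (F t) (G t))"
  by (simp add: proportional_at_def C1_prod scaleR_add_right scaleR_left scaleR_right)

lemma proportional_at_Pair:
  assumes "C1 F" "C1 G" "proportional_at k l u t F" "proportional_at k l u t G"
  shows "proportional_at k l u t (\<lambda>t. (F t, G t))"
proof -
  have 1: "bounded_linear (\<lambda>x::'a. (x, 0::'b))" "bounded_linear (\<lambda>y::'b. (0::'a, y))"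
    by (intro bounded_linear_intros)+
  have "(\<lambda>t. (F t, G t)) = (\<lambda>t. (F t, 0) + (0, G t))" by simp
  then show ?thesis
    using proportional_at_add[OF bounded_linear.C1_comp(1)[OF 1(1) assms(1)]
        bounded_linear.C1_comp(1)[OF 1(2) assms(2)]
        bounded_linear.proportional_at_comp[OF 1(1) assms(1,3)]
        bounded_linear.proportional_at_comp[OF 1(2) assms(2,4)]]
    by metis
qed

text \<open>A substitute for the chain rule: the operations that preserve \<^const>\<open>C2\<close> and linear
  relations between partial derivatives.\<close>

definition smooth_op :: "('a::real_normed_vector \<Rightarrow> 'b::real_normed_vector) \<Rightarrow> bool" where
  "smooth_op H \<longleftrightarrow> (\<forall>F. C2 F \<longrightarrow> C2 (\<lambda>t. H (F t)) \<and>
     (\<forall>k l u t. proportional_at k l u t F \<longrightarrow> proportional_at k l u t (\<lambda>t. H (F t))))"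

lemma smooth_op_C2: "smooth_op H \<Longrightarrow> C2 F \<Longrightarrow> C2 (\<lambda>t. H (F t))"
  and smooth_op_proportional: "smooth_op H \<Longrightarrow> C2 F \<Longrightarrow> proportional_at k l u t F \<Longrightarrow>
    proportional_at k l u t (\<lambda>t. H (F t))"
  by (auto simp: smooth_op_def)

lemma smooth_op_const: "smooth_op (\<lambda>_. c)"
  unfolding smooth_op_def by (intro allI impI conjI C2_const proportional_at_const)

lemma (in bounded_linear) smooth_op: "smooth_op f"
  unfolding smooth_op_def by (intro allI impI conjI C2_comp proportional_at_comp C2_C1; assumption)

lemma smooth_op_compose: "smooth_op H \<Longrightarrow> smooth_op K \<Longrightarrow> smooth_op (\<lambda>x. H (K x))"
  unfolding smooth_op_def by blast

lemma smooth_op_add: "smooth_op H \<Longrightarrow> smooth_op K \<Longrightarrow> smooth_op (\<lambda>x. H x + K x)"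
  unfolding smooth_op_def by (intro allI impI conjI C2_add proportional_at_add C2_C1; blast)

lemma smooth_op_Pair: "smooth_op H \<Longrightarrow> smooth_op K \<Longrightarrow> smooth_op (\<lambda>x. (H x, K x))"
  unfolding smooth_op_def by (intro allI impI conjI C2_Pair proportional_at_Pair C2_C1; blast)

lemma (in bounded_bilinear) smooth_op_prod:
  "smooth_op H \<Longrightarrow> smooth_op K \<Longrightarrow> smooth_op (\<lambda>x. prod (H x) (K x))"
  unfolding smooth_op_def by (intro allI impI conjI C2_prod proportional_at_prod C2_C1; blast)

lemmas smooth_op_mult = bounded_bilinear.smooth_op_prod[OF bounded_bilinear_mult]
  and smooth_op_scaleR = bounded_bilinear.smooth_op_prod[OF bounded_bilinear_scaleR]
  and smooth_op_inner = bounded_bilinear.smooth_op_prod[OF bounded_bilinear_inner]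
  and smooth_op_ident = bounded_linear.smooth_op[OF bounded_linear_ident]

lemma smooth_op_diff:
  assumes "smooth_op H" "smooth_op K" shows "smooth_op (\<lambda>x. H x - K x)"
proof -
  have "(\<lambda>x. H x - K x) = (\<lambda>x. H x + (- 1) *\<^sub>R K x)" by simp
  then show ?thesis
    using smooth_op_add[OF assms(1) smooth_op_scaleR[OF smooth_op_const[of "- 1"] assms(2)]] by metis
qed

lemma smooth_op_sum: "(\<And>i. i \<in> I \<Longrightarrow> smooth_op (H i)) \<Longrightarrow> smooth_op (\<lambda>x. \<Sum>i\<in>I. H i x)"
  by (induction I rule: infinite_finite_induct) (simp_all add: smooth_op_const smooth_op_add)

lemma smooth_op_inverse:
  fixes H :: "'a::real_normed_vector \<Rightarrow> real"
  assumes "smooth_op H" "\<And>x. H x \<noteq> 0" shows "smooth_op (\<lambda>x. inverse (H x))"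
  unfolding smooth_op_def
proof (intro allI impI conjI)
  fix F :: "point \<Rightarrow> 'a" and k l u t
  assume F: "C2 F"
  note H = smooth_op_C2[OF assms(1) F]
  show "C2 (\<lambda>t. inverse (H (F t)))" by (rule C2_inverse[OF H assms(2)])
  assume "proportional_at k l u t F"
  then show "proportional_at k l u t (\<lambda>t. inverse (H (F t)))"
    using smooth_op_proportional[OF assms(1) F]
    by (simp add: proportional_at_def C1_inverse(2)[OF C2_C1[OF H] assms(2)])
qed

lemma smooth_op_pos_part_cube:
  fixes H :: "'a::real_normed_vector \<Rightarrow> real"
  assumes "smooth_op H" shows "smooth_op (\<lambda>x. max 0 (H x) ^ 3)"
  unfolding smooth_op_def
proof (intro allI impI conjI)
  fix F :: "point \<Rightarrow> 'a" and k l u t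
  assume F: "C2 F"
  note H = smooth_op_C2[OF assms(1) F]
  show "C2 (\<lambda>t. max 0 (H (F t)) ^ 3)" by (rule C2_pos_part_cube[OF H])
  assume "proportional_at k l u t F"
  then show "proportional_at k l u t (\<lambda>t. max 0 (H (F t)) ^ 3)"
    using smooth_op_proportional[OF assms(1) F] C1_pos_part_power(2)[OF C2_C1[OF H], where k = 1]
    by (simp add: proportional_at_def numeral_3_eq_3)
qed

lemma smooth_op_real_polynomial: "real_polynomial_function p \<Longrightarrow> smooth_op p"
proof (induction rule: real_polynomial_function.induct)
  case (linear f) then show ?case by (rule bounded_linear.smooth_op)
next
  case (const c) then show ?case by (rule smooth_op_const)
next
  case (add f g) then show ?case by (intro smooth_op_add)
next
  case (mult f g) then show ?case by (intro smooth_op_mult)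
qed

text \<open>Prepares the use of Stone-Weierstrass: polynomial approximations of a merely continuous
  homotopy can be composed with the cycle without losing degeneracies.\<close>

lemma smooth_op_polynomial_function:
  fixes p :: "'a::real_normed_vector \<Rightarrow> 'b::euclidean_space"
  assumes "polynomial_function p" shows "smooth_op p"
proof -
  have "real_polynomial_function (\<lambda>x. p x \<bullet> b)" for b
    using assms bounded_linear_inner_left[of b] unfolding polynomial_function_def o_def by blast
  then have "smooth_op (\<lambda>x. \<Sum>b\<in>Basis. (p x \<bullet> b) *\<^sub>R b)"
    by (intro smooth_op_sum smooth_op_scaleR smooth_op_const smooth_op_real_polynomial)
  then show ?thesis by (simp add: euclidean_representation)
qed

section \<open>Alternating sums and integrals over boxes\<close>

lemma bounded_bilinear_matrix_mult:
  "bounded_bilinear ((**) :: complex ^ 'n ^ 'm \<Rightarrow> complex ^ 'p ^ 'n \<Rightarrow> complex ^ 'p ^ 'm)"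
proof -
  have "bilinear ((**) :: complex ^ 'n ^ 'm \<Rightarrow> complex ^ 'p ^ 'n \<Rightarrow> complex ^ 'p ^ 'm)"
    unfolding bilinear_def
    by (intro conjI allI linearI)
      (simp_all add: matrix_matrix_mult_def vec_eq_iff scaleR_sum_right
        sum.distrib distrib_left distrib_right)
  then show ?thesis by (simp add: bilinear_conv_bounded_bilinear)
qed

lemma bounded_linear_trace: "bounded_linear (trace :: complex ^ 'n ^ 'n \<Rightarrow> complex)"
proof -
  have "linear (trace :: complex ^ 'n ^ 'n \<Rightarrow> complex)"
    by (intro linearI) (simp_all add: trace_def sum.distrib scaleR_sum_right)
  then show ?thesis by (simp add: linear_conv_bounded_linear)
qed

section \<open>Traces of ordered products and alternating sums\<close>

definition mprod :: "('a::comm_ring_1 ^ 'n ^ 'n) list \<Rightarrow> 'a ^ 'n ^ 'n" where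
  "mprod As = foldr (**) As (mat 1)"

lemma mprod_Nil [simp]: "mprod [] = mat 1"
  and mprod_Cons [simp]: "mprod (A # As) = A ** mprod As"
  by (simp_all add: mprod_def)

lemma mprod_append: "mprod (As @ Bs) = mprod As ** mprod Bs"
  by (induction As) (simp_all add: matrix_mul_assoc)

lemma trace_mprod_rotate1: "trace (mprod (rotate1 As)) = trace (mprod As)"
proof (cases As)
  case (Cons A Bs)
  then show ?thesis using trace_mul_sym[of "mprod Bs" A] by (simp add: mprod_append matrix_mul_rid)
qed simp

lemma sign_cycle_of_list: "distinct cs \<Longrightarrow> cs \<noteq> [] \<Longrightarrow> sign (cycle_of_list cs) = (- 1) ^ (length cs - 1)"
proof (induction cs rule: cycle_of_list.induct)
  case (1 i j cs)
  then have "sign (cycle_of_list (i # j # cs)) = - sign (cycle_of_list (j # cs))"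
    by (simp add: sign_compose permutation_swap_id permutation_of_cycle sign_swap_id)
  also have "\<dots> = (- 1) ^ (length (i # j # cs) - 1)" using 1 by simp
  finally show ?case .
qed auto

text \<open>Applied to the components of a product of 1-forms, this is the coefficient of their
  wedge product on the coordinate volume element.\<close>

definition alt_sum :: "'i set \<Rightarrow> (('i \<Rightarrow> 'i) \<Rightarrow> 'a::comm_ring_1) \<Rightarrow> 'a" where
  "alt_sum S F = (\<Sum>\<sigma> | \<sigma> permutes S. of_int (sign \<sigma>) * F \<sigma>)"

lemma alt_sum_cong: "(\<And>\<sigma>. \<sigma> permutes S \<Longrightarrow> F \<sigma> = G \<sigma>) \<Longrightarrow> alt_sum S F = alt_sum S G"
  by (simp add: alt_sum_def)

lemma alt_sum_0 [simp]: "alt_sum S (\<lambda>_. 0) = 0"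
  by (simp add: alt_sum_def)

lemma alt_sum_add: "alt_sum S (\<lambda>\<sigma>. F \<sigma> + G \<sigma>) = alt_sum S F + alt_sum S G"
  by (simp add: alt_sum_def distrib_left sum.distrib)

lemma alt_sum_cmult: "alt_sum S (\<lambda>\<sigma>. c * F \<sigma>) = c * alt_sum S F"
  by (simp add: alt_sum_def sum_distrib_left mult_ac)

lemma alt_sum_minus: "alt_sum S (\<lambda>\<sigma>. - F \<sigma>) = - alt_sum S F"
  by (simp add: alt_sum_def sum_negf)

lemma alt_sum_sum: "alt_sum S (\<lambda>\<sigma>. \<Sum>i\<in>I. F i \<sigma>) = (\<Sum>i\<in>I. alt_sum S (F i))"
  unfolding alt_sum_def by (subst sum.swap) (simp add: sum_distrib_left)

lemma alt_sum_compose_right: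
  assumes "finite S" "\<pi> permutes S"
  shows "alt_sum S F = of_int (sign \<pi>) * alt_sum S (\<lambda>\<sigma>. F (\<sigma> \<circ> \<pi>))"
proof -
  have "alt_sum S F = (\<Sum>\<sigma> | \<sigma> permutes S. of_int (sign (\<sigma> \<circ> \<pi>)) * F (\<sigma> \<circ> \<pi>))"
    unfolding alt_sum_def by (rule sum_permutations_compose_right[OF assms(2)])
  also have "\<dots> = (\<Sum>\<sigma> | \<sigma> permutes S. of_int (sign \<pi>) * (of_int (sign \<sigma>) * F (\<sigma> \<circ> \<pi>)))"
    using assms permutes_imp_permutation[of S] by (intro sum.cong) (auto simp: sign_compose)
  finally show ?thesis by (simp add: alt_sum_def sum_distrib_left)
qed

lemma alt_sum_eq_0:
  fixes F :: "('i \<Rightarrow> 'i) \<Rightarrow> 'a::{idom, ring_char_0}"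
  assumes "finite S" "\<pi> permutes S" "sign \<pi> = - 1"
    and "\<And>\<sigma>. \<sigma> permutes S \<Longrightarrow> F (\<sigma> \<circ> \<pi>) = F \<sigma>"
  shows "alt_sum S F = 0"
proof -
  have "alt_sum S F = - alt_sum S (\<lambda>\<sigma>. F (\<sigma> \<circ> \<pi>))"
    using alt_sum_compose_right[OF assms(1,2), of F] assms(3) by simp
  also have "alt_sum S (\<lambda>\<sigma>. F (\<sigma> \<circ> \<pi>)) = alt_sum S F"
    by (rule alt_sum_cong[OF assms(4)])
  finally show ?thesis by simp
qed

text \<open>A cycle of even length is an odd permutation, but the trace does not notice it; this is
  the vanishing of tr (\<omega>^d) for even d. The factor \<open>R\<close> collects what depends on
  the slots outside \<open>ys\<close>, which the cycle leaves alone.\<close>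

lemma alt_sum_trace_cycle:
  fixes a :: "'i \<Rightarrow> complex ^ 'n ^ 'n"
  assumes "finite S" "distinct ys" "set ys \<subseteq> S" "even (length ys)" "ys \<noteq> []"
    and R: "\<And>\<sigma> \<tau>. (\<And>x. x \<in> S - set ys \<Longrightarrow> \<sigma> x = \<tau> x) \<Longrightarrow> R \<sigma> = R \<tau>"
  shows "alt_sum S (\<lambda>\<sigma>. trace (mprod (map (\<lambda>x. a (\<sigma> x)) ys)) * R \<sigma>) = 0"
proof (rule alt_sum_eq_0)
  show "cycle_of_list ys permutes S"
    using cycle_permutes assms(3) permutes_subset by blast
  show "sign (cycle_of_list ys) = - 1"
    using assms by (simp add: sign_cycle_of_list)
  fix \<sigma> assume "\<sigma> permutes S"
  have "map (\<lambda>x. a ((\<sigma> \<circ> cycle_of_list ys) x)) ys = map (a \<circ> \<sigma>) (map (cycle_of_list ys) ys)"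
    by simp
  also have "\<dots> = rotate1 (map (a \<circ> \<sigma>) ys)"
    using cyclic_rotation[OF assms(2), of 1] by (simp add: rotate1_map)
  finally have "trace (mprod (map (\<lambda>x. a ((\<sigma> \<circ> cycle_of_list ys) x)) ys)) =
      trace (mprod (map (\<lambda>x. a (\<sigma> x)) ys))"
    by (simp add: trace_mprod_rotate1 o_def)
  moreover have "R (\<sigma> \<circ> cycle_of_list ys) = R \<sigma>"
    by (rule R) (simp add: id_outside_supp)
  ultimately show "trace (mprod (map (\<lambda>x. a ((\<sigma> \<circ> cycle_of_list ys) x)) ys)) * R (\<sigma> \<circ> cycle_of_list ys) =
      trace (mprod (map (\<lambda>x. a (\<sigma> x)) ys)) * R \<sigma>" by simp
qed (fact assms)

text \<open>The result is again a function on \<open>point\<close>, constant in the coordinates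
  already integrated. Integrals over any list of coordinates can thus be nested and exchanged within
  one type.\<close>

primrec box_integral :: "nat list \<Rightarrow> (point \<Rightarrow> 'b::euclidean_space) \<Rightarrow> point \<Rightarrow> 'b" where
  "box_integral [] F = F"
| "box_integral (j # js) F = (\<lambda>t. integral {0..1} (\<lambda>s. box_integral js F (t(j := s))))"

lemma continuous_on_fun_upd: "continuous_on UNIV (\<lambda>(t::point, s). t(j := s))"
proof (rule continuous_on_coordinatewise_then_product)
  fix i
  have "continuous_on UNIV (\<lambda>x::point \<times> real. fst x i)"
    by (rule continuous_on_compose2[OF continuous_on_fun_coord continuous_on_fst[OF continuous_on_id]]) simp
  moreover have "continuous_on UNIV (\<lambda>x::point \<times> real. snd x)"
    by (rule continuous_on_snd[OF continuous_on_id])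
  ultimately show "continuous_on UNIV (\<lambda>x. (case x of (t::point, s) \<Rightarrow> t(j := s)) i)"
    by (cases "i = j") (simp_all add: split_beta)
qed

lemma continuous_on_fun_upd_const:
  fixes F :: "point \<Rightarrow> 'b::topological_space"
  assumes "continuous_on UNIV F" shows "continuous_on UNIV (\<lambda>t. F (t(j := s)))"
proof -
  have "continuous_on UNIV (\<lambda>t::point. (t, s))"
    by (intro continuous_on_Pair continuous_on_id continuous_on_const)
  from continuous_on_compose2[OF continuous_on_fun_upd[of j] this]
  have "continuous_on UNIV (\<lambda>t::point. t(j := s))" by simp
  from continuous_on_compose2[OF assms this] show ?thesis by simp
qed

lemma continuous_on_line:
  fixes F :: "point \<Rightarrow> 'b::topological_space"
  assumes "continuous_on UNIV F" shows "continuous_on S (\<lambda>s. F (t(j := s)))"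
proof -
  have "continuous_on S (\<lambda>s::real. (t, s))"
    by (intro continuous_on_Pair continuous_on_id continuous_on_const)
  from continuous_on_compose2[OF continuous_on_fun_upd[of j] this]
  have "continuous_on S (\<lambda>s. t(j := s))" by simp
  from continuous_on_compose2[OF assms this] show ?thesis by simp
qed

lemma continuous_on_box_integral:
  assumes "continuous_on UNIV F" shows "continuous_on UNIV (box_integral js F)"
proof (induction js)
  case (Cons j js)
  have "continuous_on UNIV (\<lambda>(t, s). box_integral js F (t(j := s)))"
    using continuous_on_compose2[OF Cons continuous_on_fun_upd[of j]]
    by (simp add: split_beta del: fun_upd_apply)
  then have "continuous_on (UNIV \<times> cbox 0 1) (\<lambda>(t, s). box_integral js F (t(j := s)))"
    using continuous_on_subset by blast
  from integral_continuous_on_param[OF this] show ?case by simp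
qed (simp add: assms)

lemma integrable_on_line:
  fixes F :: "point \<Rightarrow> 'b::euclidean_space"
  assumes "continuous_on UNIV F" shows "(\<lambda>s. F (t(j := s))) integrable_on {0..1}"
  by (rule integrable_continuous_real[OF continuous_on_line[OF assms]])

lemma box_integral_append: "box_integral (xs @ ys) F = box_integral xs (box_integral ys F)"
  by (induction xs) simp_all

lemma box_integral_swap:
  assumes "continuous_on UNIV F" "i \<noteq> j"
  shows "box_integral (i # j # js) F = box_integral (j # i # js) F"
proof
  fix t
  define G where "G = box_integral js F"
  have G: "continuous_on UNIV G" unfolding G_def by (rule continuous_on_box_integral[OF assms(1)])
  have "continuous_on UNIV (\<lambda>x::real \<times> real. t(i := fst x, j := snd x))"
  proof (rule continuous_on_coordinatewise_then_product)
    fix k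
    have "continuous_on UNIV (\<lambda>x::real \<times> real. fst x)" "continuous_on UNIV (\<lambda>x::real \<times> real. snd x)"
      by (intro continuous_on_fst continuous_on_snd continuous_on_id)+
    then show "continuous_on UNIV (\<lambda>x::real \<times> real. (t(i := fst x, j := snd x)) k)"
      by (cases "k = i"; cases "k = j") simp_all
  qed
  from continuous_on_compose2[OF G this]
  have "continuous_on UNIV (\<lambda>(x, y). G (t(i := x, j := y)))" by (simp add: split_beta)
  then have "continuous_on (cbox (0, 0) (1, 1)) (\<lambda>(x, y). G (t(i := x, j := y)))"
    using continuous_on_subset by blast
  from integral_swap_continuous[OF this]
  show "box_integral (i # j # js) F t = box_integral (j # i # js) F t"
    using assms(2) by (simp add: G_def fun_upd_twist)
qed

lemma box_integral_move_last:
  assumes "continuous_on UNIV F" "j \<notin> set ys"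
  shows "box_integral (j # ys) F = box_integral (ys @ [j]) F"
  using assms(2)
proof (induction ys)
  case (Cons y ys)
  then have "box_integral (j # y # ys) F = box_integral (y # j # ys) F"
    by (intro box_integral_swap[OF assms(1)]) auto
  also have "\<dots> = box_integral [y] (box_integral (j # ys) F)"
    using box_integral_append[of "[y]" "j # ys" F] by simp
  also have "box_integral (j # ys) F = box_integral (ys @ [j]) F" using Cons by simp
  also have "box_integral [y] (box_integral (ys @ [j]) F) = box_integral ((y # ys) @ [j]) F"
    using box_integral_append[of "[y]" "ys @ [j]" F] by simp
  finally show ?case .
qed simp

lemma box_integral_linear:
  fixes F :: "point \<Rightarrow> 'b::euclidean_space" and h :: "'b \<Rightarrow> 'c::euclidean_space"
  assumes "continuous_on UNIV F" "bounded_linear h"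
  shows "box_integral js (\<lambda>t. h (F t)) = (\<lambda>t. h (box_integral js F t))"
proof (induction js)
  case (Cons j js)
  show ?case
    using integral_linear[OF integrable_on_line[OF continuous_on_box_integral[OF assms(1), of js]] assms(2)]
    by (simp add: Cons o_def fun_eq_iff)
qed simp

lemma box_integral_add:
  assumes "continuous_on UNIV F" "continuous_on UNIV G"
  shows "box_integral js (\<lambda>t. F t + G t) = (\<lambda>t. box_integral js F t + box_integral js G t)"
proof (induction js)
  case (Cons j js)
  show ?case
    using integrable_on_line[OF continuous_on_box_integral[OF assms(1), of js]]
      integrable_on_line[OF continuous_on_box_integral[OF assms(2), of js]]
    by (simp add: Cons integral_add fun_eq_iff)
qed simp

lemma box_integral_zero: "box_integral js (\<lambda>_. 0) = (\<lambda>_. 0)"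
  by (induction js) simp_all

lemma box_integral_sum:
  assumes "\<And>i. i \<in> I \<Longrightarrow> continuous_on UNIV (F i)"
  shows "box_integral js (\<lambda>t. \<Sum>i\<in>I. F i t) = (\<lambda>t. \<Sum>i\<in>I. box_integral js (F i) t)"
  using assms
proof (induction I rule: infinite_finite_induct)
  case (insert i I)
  then show ?case
    by (simp add: box_integral_add continuous_on_sum)
qed (simp_all add: box_integral_zero)

lemma box_integral_pd:
  fixes F :: "point \<Rightarrow> 'b::euclidean_space"
  assumes "C1 F" shows "box_integral [j] (pd j F) = (\<lambda>t. F (t(j := 1)) - F (t(j := 0)))"
proof
  fix t
  have "((\<lambda>s. pd j F (t(j := s))) has_integral (F (t(j := 1)) - F (t(j := 0)))) {0..1}"
    by (rule fundamental_theorem_of_calculus)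
      (simp_all add: has_vector_derivative_at_within[OF C1_has_pd_upd[OF assms]] del: fun_upd_apply)
  then show "box_integral [j] (pd j F) t = F (t(j := 1)) - F (t(j := 0))"
    by (simp add: integral_unique)
qed

text \<open>The divergence theorem on the unit cube: Fubini moves the coordinate \<open>j\<close> to
  the innermost position, where the fundamental theorem of calculus applies.\<close>

lemma divergence_box_integral:
  fixes A :: "nat \<Rightarrow> point \<Rightarrow> 'b::euclidean_space"
  assumes js: "distinct js" and A: "\<And>j. j \<in> set js \<Longrightarrow> C1 (A j)"
    and div: "\<And>t. (\<Sum>j\<in>set js. pd j (A j) t) = 0"
  shows "(\<Sum>j\<in>set js. box_integral (remove1 j js) (\<lambda>t. A j (t(j := 1)) - A j (t(j := 0))) t) = 0"
proof -
  have "box_integral js (pd j (A j)) =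
      box_integral (remove1 j js) (\<lambda>t. A j (t(j := 1)) - A j (t(j := 0)))"
    if j: "j \<in> set js" for j
  proof -
    obtain xs ys where s0: "js = xs @ j # ys" using split_list[OF j] by blast
    then have s: "js = xs @ j # ys" "j \<notin> set xs" "j \<notin> set ys" using js by auto
    have rm: "remove1 j js = xs @ ys" using s by (simp add: remove1_append)
    have "box_integral js (pd j (A j)) = box_integral xs (box_integral (j # ys) (pd j (A j)))"
      by (simp only: s box_integral_append)
    also have "\<dots> = box_integral xs (box_integral ys (box_integral [j] (pd j (A j))))"
      by (simp only: box_integral_move_last[OF C1_continuous_pd[OF A[OF j]] s(3)] box_integral_append)
    finally show ?thesis
      by (simp only: box_integral_pd[OF A[OF j]] rm box_integral_append)
  qed
  then have "(\<Sum>j\<in>set js. box_integral (remove1 j js) (\<lambda>t. A j (t(j := 1)) - A j (t(j := 0))) t) =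
      (\<Sum>j\<in>set js. box_integral js (pd j (A j)) t)"
    by simp
  also have "\<dots> = box_integral js (\<lambda>t. \<Sum>j\<in>set js. pd j (A j) t) t"
    using box_integral_sum[of "set js" "\<lambda>j. pd j (A j)"] C1_continuous_pd[OF A] by simp
  finally show ?thesis by (simp add: div box_integral_zero)
qed

lemma box_integral_nonneg:
  fixes F :: "point \<Rightarrow> real"
  assumes "\<And>t. t \<in> B \<Longrightarrow> F t \<ge> 0" "\<And>t j s. t \<in> B \<Longrightarrow> j \<in> set js \<Longrightarrow> s \<in> {0..1} \<Longrightarrow> t(j := s) \<in> B"
    and "t \<in> B" "continuous_on UNIV F"
  shows "box_integral js F t \<ge> 0"
  using assms(2,3)
proof (induction js arbitrary: t)
  case Nil then show ?case using assms(1) by simp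
next
  case (Cons j js)
  have "box_integral js F (t(j := s)) \<ge> 0" if "s \<in> {0..1}" for s
    using Cons.prems that by (intro Cons.IH) auto
  then show ?case
    using integral_nonneg[OF integrable_on_line[OF continuous_on_box_integral[OF assms(4)]]] by simp
qed

text \<open>Each one-dimensional integrand is continuous and nonnegative, so a single positive value
  makes its integral positive. Taking the positive point itself as base point lets the induction
  meet it again at \<open>s = t j\<close>.\<close>

lemma box_integral_pos:
  fixes F :: "point \<Rightarrow> real"
  assumes "\<And>t. t \<in> B \<Longrightarrow> F t \<ge> 0" "\<And>t j s. t \<in> B \<Longrightarrow> j \<in> set js \<Longrightarrow> s \<in> {0..1} \<Longrightarrow> t(j := s) \<in> B"
    and t: "t \<in> B" "F t > 0" "\<And>j. j \<in> set js \<Longrightarrow> t j \<in> {0..1}" and F: "continuous_on UNIV F"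
  shows "box_integral js F t > 0"
  using assms(2) t(3)
proof (induction js)
  case Nil then show ?case using t by simp
next
  case (Cons j js)
  let ?G = "\<lambda>s. box_integral js F (t(j := s))"
  have nn: "?G s \<ge> 0" if "s \<in> {0..1}" for s
  proof (rule box_integral_nonneg[OF assms(1) _ _ F])
    show "t(j := s) \<in> B" by (rule Cons.prems(1)[OF t(1) _ that]) simp
    show "t(j := s) \<in> B" if "t \<in> B" "j \<in> set js" "s \<in> {0..1}" for t j s
      by (rule Cons.prems(1)[OF that(1) _ that(3)]) (simp add: that)
  qed
  have pos: "?G (t j) > 0" using Cons by simp
  have c: "continuous_on {0..1} ?G" by (rule continuous_on_line[OF continuous_on_box_integral[OF F]])
  have i: "?G integrable_on {0..1}" by (rule integrable_continuous_real[OF c])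
  have "integral {0..1} ?G \<noteq> 0"
  proof
    assume "integral {0..1} ?G = 0"
    then have "(?G has_integral 0) (cbox 0 1)" using i by (metis integrable_integral cbox_interval)
    then have "?G (t j) = 0"
      by (rule has_integral_0_cbox_imp_0[rotated 2]) (use c nn Cons.prems(2) in auto)
    then show False using pos by simp
  qed
  moreover have "integral {0..1} ?G \<ge> 0" by (rule integral_nonneg[OF i nn])
  ultimately show ?case by simp
qed

section \<open>Trace forms\<close>

lemma has_vector_derivative_iff_quotient:
  "(f has_vector_derivative D) (at x) \<longleftrightarrow> ((\<lambda>y. (f y - f x) /\<^sub>R (y - x)) \<longlongrightarrow> D) (at x)"
proof -
  have "norm (f y - f x - (y - x) *\<^sub>R D) / norm (y - x) = norm ((f y - f x) /\<^sub>R (y - x) - D)"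
    if "y \<noteq> x" for y
  proof -
    have "(f y - f x) /\<^sub>R (y - x) - D = (f y - f x - (y - x) *\<^sub>R D) /\<^sub>R (y - x)"
      using that by (simp add: scaleR_diff_right)
    then show ?thesis by (simp add: divide_inverse mult.commute)
  qed
  then have "((\<lambda>y. norm (f y - f x - (y - x) *\<^sub>R D) / norm (y - x)) \<longlongrightarrow> 0) (at x) \<longleftrightarrow>
      ((\<lambda>y. norm ((f y - f x) /\<^sub>R (y - x) - D)) \<longlongrightarrow> 0) (at x)"
    by (intro Lim_cong_within) auto
  then show ?thesis
    by (simp add: has_vector_derivative_def has_derivative_iff_norm bounded_linear_scaleR_left
        tendsto_norm_zero_iff Lim_null[symmetric])
qed

lemma matrix_inv_invertible:
  fixes A :: "'a::field ^ 'n ^ 'n"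
  assumes "invertible A" shows "A ** matrix_inv A = mat 1" "matrix_inv A ** A = mat 1"
  using someI_ex[OF assms[unfolded invertible_def]] by (simp_all add: matrix_inv_def)

lemma matrix_inv_eqI:
  fixes A :: "'a::field ^ 'n ^ 'n"
  assumes "A ** B = mat 1" shows "invertible A" "matrix_inv A = B"
proof -
  show A: "invertible A" using assms matrix_left_right_inverse unfolding invertible_def by blast
  have "matrix_inv A = matrix_inv A ** (A ** B)" by (simp add: assms)
  also have "\<dots> = B" by (simp add: matrix_mul_assoc matrix_inv_invertible[OF A])
  finally show "matrix_inv A = B" .
qed

lemma matrix_inv_diff:
  fixes A B :: "complex ^ 'n ^ 'n"
  assumes "invertible A" "invertible B"
  shows "matrix_inv A - matrix_inv B = - (matrix_inv A ** (A - B) ** matrix_inv B)"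
proof -
  interpret mm: bounded_bilinear "(**) :: complex ^ 'n ^ 'n \<Rightarrow> complex ^ 'n ^ 'n \<Rightarrow> complex ^ 'n ^ 'n"
    by (rule bounded_bilinear_matrix_mult)
  have "matrix_inv A ** (A - B) ** matrix_inv B =
      (matrix_inv A ** A) ** matrix_inv B - matrix_inv A ** (B ** matrix_inv B)"
    by (simp add: matrix_mul_assoc mm.diff_left mm.diff_right)
  then show ?thesis by (simp add: matrix_inv_invertible[OF assms(1)] matrix_inv_invertible[OF assms(2)])
qed

text \<open>The identity \<open>matrix_inv_diff\<close> bounds the change of the inverse by the
  inverse itself times a small number. This first shows that the inverses stay bounded near
  \<open>a\<close>, and then that they converge.\<close>

lemma continuous_matrix_inv:
  fixes G :: "'x::topological_space \<Rightarrow> complex ^ 'n ^ 'n"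
  assumes "continuous_on S G" "\<And>x. x \<in> S \<Longrightarrow> invertible (G x)"
  shows "continuous_on S (\<lambda>x. matrix_inv (G x))"
proof -
  obtain K where K: "K > 0" "\<And>(A :: complex ^ 'n ^ 'n) (B :: complex ^ 'n ^ 'n). norm (A ** B) \<le> norm A * norm B * K"
    using bounded_bilinear.pos_bounded[OF bounded_bilinear_matrix_mult] by blast
  have "((\<lambda>x. matrix_inv (G x)) \<longlongrightarrow> matrix_inv (G a)) (at a within S)" if a: "a \<in> S" for a
  proof -
    define M where "M = norm (matrix_inv (G a))"
    have G: "(G \<longlongrightarrow> G a) (at a within S)" using assms(1) a by (simp add: continuous_on)
    have bound: "norm (matrix_inv (G x) - matrix_inv (G a)) \<le> norm (matrix_inv (G x)) * (norm (G x - G a) * (K * M * K))"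
      if x: "x \<in> S" for x
    proof -
      have "norm (matrix_inv (G x) - matrix_inv (G a)) = norm (matrix_inv (G x) ** (G x - G a) ** matrix_inv (G a))"
        by (simp add: matrix_inv_diff assms(2) a x)
      also have "\<dots> \<le> norm (matrix_inv (G x) ** (G x - G a)) * M * K"
        unfolding M_def by (rule K(2))
      also have "\<dots> \<le> (norm (matrix_inv (G x)) * norm (G x - G a) * K) * M * K"
        using K by (intro mult_right_mono) (auto simp: M_def)
      finally show ?thesis by (simp add: mult_ac)
    qed
    have lim: "((\<lambda>x. norm (G x - G a) * (K * M * K)) \<longlongrightarrow> 0) (at a within S)"
      using G by (intro tendsto_mult_left_zero tendsto_norm_zero) (simp add: LIM_zero)
    \<comment> \<open>Below 1/2 the term with the unknown inverse is absorbed into the left-hand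
      side, so that the norm of the inverse is at most \<open>2 * M\<close>.\<close>
    then have "\<forall>\<^sub>F x in at a within S. norm (G x - G a) * (K * M * K) < 1 / 2"
      by (rule order_tendstoD(2)) simp
    moreover have "\<forall>\<^sub>F x in at a within S. x \<in> S"
      by (simp add: eventually_at_filter)
    ultimately have "\<forall>\<^sub>F x in at a within S. norm (matrix_inv (G x) - matrix_inv (G a)) \<le> norm (norm (G x - G a) * (K * M * K)) * (2 * M)"
    proof eventually_elim
      case (elim x)
      let ?q = "norm (G x - G a) * (K * M * K)"
      have q: "0 \<le> ?q" using K by (simp add: M_def)
      have "norm (matrix_inv (G x)) \<le> norm (matrix_inv (G x) - matrix_inv (G a)) + M"
        unfolding M_def using norm_triangle_sub[of "matrix_inv (G x)" "matrix_inv (G a)"] by simp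
      also have "\<dots> \<le> norm (matrix_inv (G x)) * ?q + M" using bound[OF elim(2)] by simp
      also have "\<dots> \<le> norm (matrix_inv (G x)) * (1 / 2) + M"
        using elim(1) by (intro add_right_mono mult_left_mono) auto
      finally have "norm (matrix_inv (G x)) \<le> 2 * M" by simp
      then have "norm (matrix_inv (G x)) * ?q \<le> 2 * M * ?q" using q by (rule mult_right_mono)
      with bound[OF elim(2)] q show ?case by (simp add: mult_ac)
    qed
    then have "((\<lambda>x. matrix_inv (G x) - matrix_inv (G a)) \<longlongrightarrow> 0) (at a within S)"
      by (rule tendsto_0_le[OF lim])
    then show ?thesis by (rule LIM_zero_cancel)
  qed
  then show ?thesis by (simp add: continuous_on)
qed

lemmas C1_matrix_mult = bounded_bilinear.C1_prod[OF bounded_bilinear_matrix_mult]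
  and C2_matrix_mult = bounded_bilinear.C2_prod[OF bounded_bilinear_matrix_mult]

lemma C1_matrix_inv:
  fixes G :: "point \<Rightarrow> complex ^ 'n ^ 'n"
  assumes "C1 G" "\<And>t. invertible (G t)"
  shows "C1 (\<lambda>t. matrix_inv (G t))"
    "pd j (\<lambda>t. matrix_inv (G t)) = (\<lambda>t. - (matrix_inv (G t) ** pd j G t ** matrix_inv (G t)))"
proof -
  interpret mm: bounded_bilinear "(**) :: complex ^ 'n ^ 'n \<Rightarrow> complex ^ 'n ^ 'n \<Rightarrow> complex ^ 'n ^ 'n"
    by (rule bounded_bilinear_matrix_mult)
  have c: "continuous_on UNIV (\<lambda>t. matrix_inv (G t))"
    by (rule continuous_matrix_inv[OF C1_continuous[OF assms(1)] assms(2)])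
  have d: "((\<lambda>s. matrix_inv (G (t(j := s)))) has_vector_derivative
      - (matrix_inv (G t) ** pd j G t ** matrix_inv (G t))) (at (t j))" for j t
    unfolding has_vector_derivative_iff_quotient
  proof -
    let ?G = "\<lambda>s. G (t(j := s))"
    have q: "(matrix_inv (?G y) - matrix_inv (?G (t j))) /\<^sub>R (y - t j) =
        - (matrix_inv (?G y) ** ((?G y - ?G (t j)) /\<^sub>R (y - t j)) ** matrix_inv (?G (t j)))" for y
      by (simp only: matrix_inv_diff[OF assms(2) assms(2)] mm.scaleR_right mm.scaleR_left scaleR_minus_right)
    have 1: "((\<lambda>y. (?G y - ?G (t j)) /\<^sub>R (y - t j)) \<longlongrightarrow> pd j G t) (at (t j))"
      using C1_has_pd[OF assms(1), of t j] unfolding has_vector_derivative_iff_quotient .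
    have G': "continuous_on UNIV ?G"
      using C1_has_pd_upd[OF assms(1)] has_vector_derivative_continuous
      by (intro continuous_at_imp_continuous_on) blast
    have "continuous_on UNIV (\<lambda>y. matrix_inv (?G y))"
      by (rule continuous_matrix_inv[OF G' assms(2)])
    then have "((\<lambda>y. matrix_inv (?G y)) \<longlongrightarrow> matrix_inv (?G (t j))) (at (t j))"
      unfolding continuous_on by blast
    from tendsto_minus[OF mm.tendsto[OF mm.tendsto[OF this 1] tendsto_const[of "matrix_inv (?G (t j))"]]]
    show "((\<lambda>y. (matrix_inv (?G y) - matrix_inv (?G (t j))) /\<^sub>R (y - t j)) \<longlongrightarrow>
      - (matrix_inv (G t) ** pd j G t ** matrix_inv (G t))) (at (t j))"
      unfolding q by (simp only: fun_upd_triv)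
  qed
  have e: "continuous_on UNIV (\<lambda>t. - (matrix_inv (G t) ** pd j G t ** matrix_inv (G t)))" for j
    by (intro continuous_on_minus mm.continuous_on c C1_continuous_pd[OF assms(1)])
  show "C1 (\<lambda>t. matrix_inv (G t))"
    "pd j (\<lambda>t. matrix_inv (G t)) = (\<lambda>t. - (matrix_inv (G t) ** pd j G t ** matrix_inv (G t)))"
    by (rule C1I[where F' = "\<lambda>j t. - (matrix_inv (G t) ** pd j G t ** matrix_inv (G t))"]; rule c d e)+
qed

text \<open>Component in direction \<open>k\<close> of the Maurer-Cartan form g^{-1} dg.\<close>

definition log_pd :: "(point \<Rightarrow> complex ^ 'm ^ 'm) \<Rightarrow> nat \<Rightarrow> point \<Rightarrow> complex ^ 'm ^ 'm" where
  "log_pd g k t = matrix_inv (g t) ** pd k g t"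

definition GL_map :: "(point \<Rightarrow> complex ^ 'm ^ 'm) \<Rightarrow> bool" where
  "GL_map g \<longleftrightarrow> C2 g \<and> (\<forall>t. invertible (g t))"

text \<open>Antisymmetrized in \<open>j\<close> and \<open>k\<close>, the second equation is the
  Maurer-Cartan equation d\<omega> = - \<omega> \<and> \<omega>.\<close>

lemma C1_log_pd:
  assumes "GL_map g"
  shows "C1 (log_pd g k)"
    "pd j (log_pd g k) t = matrix_inv (g t) ** pd j (pd k g) t - log_pd g j t ** log_pd g k t"
proof -
  have g: "C2 g" "\<And>t. invertible (g t)" using assms by (auto simp: GL_map_def)
  have e: "log_pd g k = (\<lambda>t. matrix_inv (g t) ** pd k g t)" by (simp add: log_pd_def fun_eq_iff)
  interpret mm: bounded_bilinear "(**) :: complex ^ 'm ^ 'm \<Rightarrow> complex ^ 'm ^ 'm \<Rightarrow> complex ^ 'm ^ 'm"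
    by (rule bounded_bilinear_matrix_mult)
  note i = C1_matrix_inv[OF C2_C1[OF g(1)] g(2)]
  note 1 = C1_matrix_mult[OF i(1) C2_pd[OF g(1)]]
  show "C1 (log_pd g k)" unfolding e by (rule 1)
  show "pd j (log_pd g k) t = matrix_inv (g t) ** pd j (pd k g) t - log_pd g j t ** log_pd g k t"
    unfolding e 1(2) i(2) log_pd_def by (simp add: mm.minus_left matrix_mul_assoc)
qed

lemma C1_mprod:
  fixes a :: "'i \<Rightarrow> point \<Rightarrow> complex ^ 'm ^ 'm"
  assumes "\<And>x. x \<in> set xs \<Longrightarrow> C1 (a x)"
  shows "C1 (\<lambda>t. mprod (map (\<lambda>x. a x t) xs))"
    "pd j (\<lambda>t. mprod (map (\<lambda>x. a x t) xs)) t = (\<Sum>p<length xs.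
      mprod (map (\<lambda>x. a x t) (take p xs)) ** pd j (a (xs ! p)) t **
      mprod (map (\<lambda>x. a x t) (drop (Suc p) xs)))"
proof -
  interpret mm: bounded_bilinear "(**) :: complex ^ 'm ^ 'm \<Rightarrow> complex ^ 'm ^ 'm \<Rightarrow> complex ^ 'm ^ 'm"
    by (rule bounded_bilinear_matrix_mult)
  have "C1 (\<lambda>t. mprod (map (\<lambda>x. a x t) xs)) \<and>
    pd j (\<lambda>t. mprod (map (\<lambda>x. a x t) xs)) t = (\<Sum>p<length xs.
      mprod (map (\<lambda>x. a x t) (take p xs)) ** pd j (a (xs ! p)) t **
      mprod (map (\<lambda>x. a x t) (drop (Suc p) xs)))"
    using assms
  proof (induction xs)
    case Nil then show ?case by (simp add: C1_const)
  next
    case (Cons x xs)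
    note c = C1_matrix_mult[of "a x" "\<lambda>t. mprod (map (\<lambda>x. a x t) xs)"]
    have "C1 (a x)" "C1 (\<lambda>t. mprod (map (\<lambda>x. a x t) xs))" using Cons by auto
    note c = C1_matrix_mult[OF this]
    show ?case
      using Cons c(1)
      by (simp add: c(2) sum.lessThan_Suc_shift mm.sum_right matrix_mul_assoc del: sum.lessThan_Suc)
  qed
  then show "C1 (\<lambda>t. mprod (map (\<lambda>x. a x t) xs))"
    "pd j (\<lambda>t. mprod (map (\<lambda>x. a x t) xs)) t = (\<Sum>p<length xs.
      mprod (map (\<lambda>x. a x t) (take p xs)) ** pd j (a (xs ! p)) t **
      mprod (map (\<lambda>x. a x t) (drop (Suc p) xs)))" by blast+
qed

text \<open>The list \<open>xs\<close> names the slots and \<open>\<kappa>\<close> assigns a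
  coordinate direction to each. Alternating over \<open>\<kappa>\<close> turns this into a component
  of tr ((g^{-1} dg)^d) with d the length of \<open>xs\<close>.\<close>

definition trace_form ::
    "(point \<Rightarrow> complex ^ 'm ^ 'm) \<Rightarrow> (nat \<Rightarrow> nat) \<Rightarrow> nat list \<Rightarrow> point \<Rightarrow> complex" where
  "trace_form g \<kappa> xs t = trace (mprod (map (\<lambda>x. log_pd g (\<kappa> x) t) xs))"

lemma C1_trace_form:
  fixes g :: "point \<Rightarrow> complex ^ 'm ^ 'm"
  assumes "GL_map g"
  shows "C1 (trace_form g \<kappa> xs)"
    "pd j (trace_form g \<kappa> xs) t = (\<Sum>p<length xs.
      trace (mprod (map (\<lambda>x. log_pd g (\<kappa> x) t) (take p xs)) ** pd j (log_pd g (\<kappa> (xs ! p))) t **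
      mprod (map (\<lambda>x. log_pd g (\<kappa> x) t) (drop (Suc p) xs))))"
proof -
  interpret tr: bounded_linear "trace :: complex ^ 'm ^ 'm \<Rightarrow> complex" by (rule bounded_linear_trace)
  have e: "trace_form g \<kappa> xs = (\<lambda>t. trace (mprod (map (\<lambda>x. log_pd g (\<kappa> x) t) xs)))"
    by (simp add: trace_form_def fun_eq_iff)
  note 1 = C1_mprod[of xs "\<lambda>x. log_pd g (\<kappa> x)", OF C1_log_pd(1)[OF assms]]
  note 2 = tr.C1_comp[OF 1(1)]
  show "C1 (trace_form g \<kappa> xs)" unfolding e by (rule 2)
  show "pd j (trace_form g \<kappa> xs) t = (\<Sum>p<length xs.
      trace (mprod (map (\<lambda>x. log_pd g (\<kappa> x) t) (take p xs)) ** pd j (log_pd g (\<kappa> (xs ! p))) t **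
      mprod (map (\<lambda>x. log_pd g (\<kappa> x) t) (drop (Suc p) xs))))"
    unfolding e 2(2) 1(2) by (simp add: tr.sum)
qed

text \<open>Closedness of the form \<open>tr ((g\<^sup>-\<^sup>1 dg) ^ d)\<close> for odd \<open>d\<close>: the second derivatives of \<open>g\<close> cancel by
  symmetry, and what remains is a trace of an even power, which vanishes by cyclicity.\<close>

lemma alt_sum_pd_trace_form:
  fixes g :: "point \<Rightarrow> complex ^ 'm ^ 'm"
  assumes g: "GL_map g" and S: "finite S" and z: "z \<in> S" and xs: "distinct xs" "set xs \<subseteq> S - {z}" "odd (length xs)"
    and R: "\<And>\<sigma> \<tau>. (\<And>x. x \<in> S - insert z (set xs) \<Longrightarrow> \<sigma> x = \<tau> x) \<Longrightarrow> R \<sigma> = R \<tau>"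
  shows "alt_sum S (\<lambda>\<sigma>. pd (\<sigma> z) (trace_form g \<sigma> xs) t * R \<sigma>) = 0"
proof -
  interpret mm: bounded_bilinear "(**) :: complex ^ 'm ^ 'm \<Rightarrow> complex ^ 'm ^ 'm \<Rightarrow> complex ^ 'm ^ 'm"
    by (rule bounded_bilinear_matrix_mult)
  let ?a = "\<lambda>\<sigma> x. log_pd g (\<sigma> x) t"
  let ?P = "\<lambda>\<sigma> p. mprod (map (?a \<sigma>) (take p xs))" and ?Q = "\<lambda>\<sigma> p. mprod (map (?a \<sigma>) (drop (Suc p) xs))"
  let ?T = "\<lambda>p \<sigma>. trace (?P \<sigma> p ** (matrix_inv (g t) ** pd (\<sigma> z) (pd (\<sigma> (xs ! p)) g) t) ** ?Q \<sigma> p) * R \<sigma>"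
  \<comment> \<open>Differentiating the inverse in the \<open>p\<close>-th factor puts the slot
    \<open>z\<close> directly in front of that factor.\<close>
  let ?ys = "\<lambda>p. take p xs @ z # drop p xs"
  let ?U = "\<lambda>p \<sigma>. trace (mprod (map (?a \<sigma>) (?ys p))) * R \<sigma>"
  have "pd (\<sigma> z) (trace_form g \<sigma> xs) t * R \<sigma> = (\<Sum>p<length xs. ?T p \<sigma> + - ?U p \<sigma>)" for \<sigma>
  proof -
    have "trace (?P \<sigma> p ** pd (\<sigma> z) (log_pd g (\<sigma> (xs ! p))) t ** ?Q \<sigma> p) * R \<sigma> = ?T p \<sigma> + - ?U p \<sigma>"
      if "p < length xs" for p
    proof -
      have "drop p xs = xs ! p # drop (Suc p) xs" using that by (simp add: Cons_nth_drop_Suc)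
      then show ?thesis
        by (simp add: C1_log_pd(2)[OF g] mm.diff_left mm.diff_right trace_sub mprod_append
            matrix_mul_assoc left_diff_distrib)
    qed
    then show ?thesis by (simp add: C1_trace_form(2)[OF g] sum_distrib_right)
  qed
  then have "alt_sum S (\<lambda>\<sigma>. pd (\<sigma> z) (trace_form g \<sigma> xs) t * R \<sigma>) =
      (\<Sum>p<length xs. alt_sum S (?T p) + - alt_sum S (?U p))"
    by (simp only: alt_sum_sum alt_sum_add alt_sum_minus)
  also have "\<dots> = (\<Sum>p<length xs. 0)"
  proof (rule sum.cong[OF refl])
    fix p assume "p \<in> {..<length xs}"
    then have p: "p < length xs" by simp
    have xs_split: "xs = take p xs @ xs ! p # drop (Suc p) xs" by (rule id_take_nth_drop[OF p])
    have nth: "xs ! p \<in> set xs" using p by simp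
    have U: "alt_sum S (?U p) = 0"
    proof (rule alt_sum_trace_cycle[OF S])
      have "distinct (take p xs @ drop p xs)" using xs by (simp only: append_take_drop_id)
      then show "distinct (?ys p)"
        using xs(2) unfolding distinct_append by (auto dest: in_set_takeD in_set_dropD)
      have "set (?ys p) = insert z (set xs)"
        by (metis append_take_drop_id list.set(2) set_append Un_insert_right)
      note s = this
      show "set (?ys p) \<subseteq> S" unfolding s using xs z by auto
      show "R \<sigma> = R \<tau>" if "\<And>x. x \<in> S - set (?ys p) \<Longrightarrow> \<sigma> x = \<tau> x" for \<sigma> \<tau>
        using R that unfolding s by blast
      show "even (length (?ys p))" using xs p by simp
    qed simp
    have "alt_sum S (?T p) = 0"
    proof (rule alt_sum_eq_0[OF S])
      let ?\<pi> = "Transposition.transpose z (xs ! p)"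
      show "?\<pi> permutes S" using xs nth z by (intro permutes_swap_id) auto
      show "sign ?\<pi> = - 1" using xs nth by (auto simp: sign_swap_id)
      fix \<sigma>
      have d: "xs ! p \<notin> set (take p xs)" "xs ! p \<notin> set (drop (Suc p) xs)"
        using xs(1) by (subst (asm) xs_split; simp)+
      have m: "map (?a (\<sigma> \<circ> ?\<pi>)) ws = map (?a \<sigma>) ws" if "set ws \<subseteq> set xs" "xs ! p \<notin> set ws" for ws
        using that xs by (intro map_cong) (auto simp: Transposition.transpose_def)
      have "R (\<sigma> \<circ> ?\<pi>) = R \<sigma>" using nth by (intro R) (auto simp: Transposition.transpose_def)
      moreover have "pd (\<sigma> z) (pd (\<sigma> (xs ! p)) g) = pd (\<sigma> (xs ! p)) (pd (\<sigma> z) g)"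
        using g C2_commute unfolding GL_map_def by blast
      ultimately show "?T p (\<sigma> \<circ> ?\<pi>) = ?T p \<sigma>"
        unfolding m[OF set_take_subset d(1)] m[OF set_drop_subset d(2)] by simp
    qed
    with U show "alt_sum S (?T p) + - alt_sum S (?U p) = 0" by simp
  qed
  finally show ?thesis by simp
qed

section \<open>Products of trace forms and Stokes' theorem\<close>

lemma alt_sum_compose_left_eq_0:
  fixes F :: "('i \<Rightarrow> 'i) \<Rightarrow> 'a::{idom, ring_char_0}"
  assumes "finite S" "\<pi> permutes S" "sign \<pi> = - 1"
    and "\<And>\<sigma>. \<sigma> permutes S \<Longrightarrow> F (\<pi> \<circ> \<sigma>) = F \<sigma>"
  shows "alt_sum S F = 0"
proof -
  have "alt_sum S F = (\<Sum>\<sigma> | \<sigma> permutes S. of_int (sign (\<pi> \<circ> \<sigma>)) * F (\<pi> \<circ> \<sigma>))"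
    unfolding alt_sum_def by (rule setum_permutations_compose_left[OF assms(2)])
  also have "\<dots> = (\<Sum>\<sigma> | \<sigma> permutes S. - (of_int (sign \<sigma>) * F \<sigma>))"
    using assms permutes_imp_permutation[of S] by (intro sum.cong) (auto simp: sign_compose)
  finally show ?thesis by (simp add: alt_sum_def sum_negf)
qed

lemma mprod_scaleR_one:
  fixes a b :: "'i \<Rightarrow> complex ^ 'm ^ 'm"
  assumes "distinct xs" "x0 \<in> set xs" "a x0 = u *\<^sub>R b x0" "\<And>x. x \<noteq> x0 \<Longrightarrow> a x = b x"
  shows "mprod (map a xs) = u *\<^sub>R mprod (map b xs)"
proof -
  interpret mm: bounded_bilinear "(**) :: complex ^ 'm ^ 'm \<Rightarrow> complex ^ 'm ^ 'm \<Rightarrow> complex ^ 'm ^ 'm"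
    by (rule bounded_bilinear_matrix_mult)
  obtain ys zs where s: "xs = ys @ x0 # zs" using split_list[OF assms(2)] by blast
  with assms(1) have "x0 \<notin> set ys" "x0 \<notin> set zs" by auto
  then have "x \<in> set ys \<Longrightarrow> a x = b x" "x \<in> set zs \<Longrightarrow> a x = b x" for x
    using assms(4) by metis+
  then have m: "map a ys = map b ys" "map a zs = map b zs" by simp_all
  have "mprod (map a xs) = mprod (map b ys) ** (u *\<^sub>R b x0 ** mprod (map b zs))"
    by (simp only: s map_append list.map m mprod_append mprod_Cons assms(3))
  then show ?thesis by (simp add: s mprod_append mm.scaleR_left mm.scaleR_right)
qed

lemma pd_fun_upd_cong:
  assumes "\<And>t. F (t(j := a)) = F (t(j := b))" "k \<noteq> j"
  shows "pd k F (t(j := a)) = pd k F (t(j := b))"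
proof -
  have "F (t(j := a, k := s)) = F (t(j := b, k := s))" for s
    using assms(1)[of "t(k := s)"] assms(2) by (simp add: fun_upd_twist)
  then show ?thesis using assms(2) by (simp add: pd_def)
qed

text \<open>\<open>blk i\<close> lists the coordinates of the \<open>i\<close>-th form, whose degree is the length of the list.\<close>

locale form_blocks =
  fixes n N :: nat and blk :: "nat \<Rightarrow> nat list"
  assumes distinct_blk: "\<And>i. i < n \<Longrightarrow> distinct (blk i)"
    and odd_blk: "\<And>i. i < n \<Longrightarrow> odd (length (blk i))"
    and disjoint_blk: "\<And>i j. i < n \<Longrightarrow> j < n \<Longrightarrow> i \<noteq> j \<Longrightarrow> set (blk i) \<inter> set (blk j) = {}"
    and Union_blk: "(\<Union>i<n. set (blk i)) = {..<N}"
begin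

definition form_prod :: "(nat \<Rightarrow> point \<Rightarrow> complex ^ 'm ^ 'm) \<Rightarrow> (nat \<Rightarrow> nat) \<Rightarrow> point \<Rightarrow> complex" where
  "form_prod g \<kappa> t = (\<Prod>i<n. trace_form (g i) \<kappa> (blk i) t)"

text \<open>Coefficient of the top-degree form in the coordinates below \<open>N\<close>. The map
  may differ from factor to factor, so that each factor can follow a homotopy of its own.\<close>

definition wedge :: "(nat \<Rightarrow> point \<Rightarrow> complex ^ 'm ^ 'm) \<Rightarrow> point \<Rightarrow> complex" where
  "wedge g t = alt_sum {..<N} (\<lambda>\<sigma>. form_prod g \<sigma> t)"

text \<open>The signed component, without the direction \<open>j\<close>, of the
  \<open>N\<close>-form in \<open>N + 1\<close> variables: the slot \<open>N\<close>, which belongs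
  to no form, receives the direction \<open>j\<close>.\<close>

definition flux :: "(nat \<Rightarrow> point \<Rightarrow> complex ^ 'm ^ 'm) \<Rightarrow> nat \<Rightarrow> point \<Rightarrow> complex" where
  "flux g j t = alt_sum {..<Suc N} (\<lambda>\<sigma>. if \<sigma> N = j then form_prod g \<sigma> t else 0)"

lemma blk_less: "i < n \<Longrightarrow> x \<in> set (blk i) \<Longrightarrow> x < N"
  using Union_blk by blast

lemma flux_last: "flux g N t = wedge g t"
proof -
  have "\<sigma> permutes {..<N} \<longleftrightarrow> \<sigma> permutes {..<Suc N} \<and> \<sigma> N = N" for \<sigma>
  proof
    assume "\<sigma> permutes {..<Suc N} \<and> \<sigma> N = N"
    then show "\<sigma> permutes {..<N}"
      by - (rule permutes_superset[of \<sigma> "{..<Suc N}"], auto simp: less_Suc_eq)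
  next
    assume "\<sigma> permutes {..<N}"
    then show "\<sigma> permutes {..<Suc N} \<and> \<sigma> N = N"
      using permutes_subset[of \<sigma> "{..<N}" "{..<Suc N}"] permutes_not_in[of \<sigma> "{..<N}" N] by auto
  qed
  then have set_eq: "{\<sigma>. \<sigma> permutes {..<N}} = {\<sigma> \<in> {\<sigma>. \<sigma> permutes {..<Suc N}}. \<sigma> N = N}" by simp
  have "flux g N t = (\<Sum>\<sigma> | \<sigma> permutes {..<Suc N}. if \<sigma> N = N then of_int (sign \<sigma>) * form_prod g \<sigma> t else 0)"
    unfolding flux_def alt_sum_def by (rule sum.cong) simp_all
  also have "\<dots> = wedge g t"
    unfolding wedge_def alt_sum_def set_eq
    by (rule sum.inter_filter[symmetric]) (simp add: finite_permutations)
  finally show ?thesis .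
qed

context
  fixes g :: "nat \<Rightarrow> point \<Rightarrow> complex ^ 'm ^ 'm"
  assumes g: "\<And>i. i < n \<Longrightarrow> GL_map (g i)"
begin

lemma C1_form_prod:
  "C1 (form_prod g \<kappa>)"
  "pd j (form_prod g \<kappa>) t = (\<Sum>i<n. pd j (trace_form (g i) \<kappa> (blk i)) t *
    (\<Prod>k\<in>{..<n}-{i}. trace_form (g k) \<kappa> (blk k) t))"
proof -
  have e: "form_prod g \<kappa> = (\<lambda>t. \<Prod>i<n. trace_form (g i) \<kappa> (blk i) t)"
    by (simp add: form_prod_def fun_eq_iff)
  have c: "C1 (trace_form (g i) \<kappa> (blk i))" if "i \<in> {..<n}" for i
    using C1_trace_form(1)[OF g] that by simp
  have 1: "C1 (\<lambda>t. \<Prod>i<n. trace_form (g i) \<kappa> (blk i) t)"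
      "pd j (\<lambda>t. \<Prod>i<n. trace_form (g i) \<kappa> (blk i) t) =
        (\<lambda>t. \<Sum>i<n. pd j (trace_form (g i) \<kappa> (blk i)) t *
          (\<Prod>k\<in>{..<n}-{i}. trace_form (g k) \<kappa> (blk k) t))"
    by (rule C1_prod_set[OF finite_lessThan]; rule c; assumption)+
  show "C1 (form_prod g \<kappa>)" unfolding e by (rule 1)
  show "pd j (form_prod g \<kappa>) t = (\<Sum>i<n. pd j (trace_form (g i) \<kappa> (blk i)) t *
    (\<Prod>k\<in>{..<n}-{i}. trace_form (g k) \<kappa> (blk k) t))"
    unfolding e 1(2) by (rule refl)
qed

lemma C1_flux:
  "C1 (flux g j)"
  "pd k (flux g j) t = alt_sum {..<Suc N} (\<lambda>\<sigma>. if \<sigma> N = j then pd k (form_prod g \<sigma>) t else 0)"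
proof -
  let ?f = "\<lambda>\<sigma> t. of_int (sign \<sigma>) * (if \<sigma> N = j then form_prod g \<sigma> t else 0)"
  have e: "flux g j = (\<lambda>t. \<Sum>\<sigma> | \<sigma> permutes {..<Suc N}. ?f \<sigma> t)"
    by (simp add: flux_def alt_sum_def fun_eq_iff)
  have f: "C1 (?f \<sigma>)" "pd k (?f \<sigma>) = (\<lambda>t. of_int (sign \<sigma>) * (if \<sigma> N = j then pd k (form_prod g \<sigma>) t else 0))"
    for \<sigma>
    using C1_mult[OF C1_const[of "of_int (sign \<sigma>) :: complex"] C1_form_prod(1)[of \<sigma>]]
    by (cases "\<sigma> N = j"; simp add: C1_const)+
  show "C1 (flux g j)" unfolding e by (intro C1_sum f)
  show "pd k (flux g j) t = alt_sum {..<Suc N} (\<lambda>\<sigma>. if \<sigma> N = j then pd k (form_prod g \<sigma>) t else 0)"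
    unfolding e by (subst C1_sum(2)[OF f(1)]) (simp add: f(2) alt_sum_def)
qed

text \<open>The product is closed: the Leibniz rule differentiates one factor at a time, and the
  alternating sum of each such term vanishes because that factor is closed.\<close>

lemma divergence_flux: "(\<Sum>j<Suc N. pd j (flux g j) t) = 0"
proof -
  have "(\<Sum>j<Suc N. pd j (flux g j) t) =
      alt_sum {..<Suc N} (\<lambda>\<sigma>. \<Sum>j<Suc N. if \<sigma> N = j then pd j (form_prod g \<sigma>) t else 0)"
    by (simp only: C1_flux(2) alt_sum_sum)
  also have "\<dots> = alt_sum {..<Suc N} (\<lambda>\<sigma>. pd (\<sigma> N) (form_prod g \<sigma>) t)"
  proof (rule alt_sum_cong)
    fix \<sigma> assume "\<sigma> permutes {..<Suc N}"
    then have "\<sigma> N \<in> {..<Suc N}" by (simp only: permutes_in_image) simp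
    then show "(\<Sum>j<Suc N. if \<sigma> N = j then pd j (form_prod g \<sigma>) t else 0) = pd (\<sigma> N) (form_prod g \<sigma>) t"
      by (subst sum.delta') auto
  qed
  also have "\<dots> = (\<Sum>i<n. alt_sum {..<Suc N} (\<lambda>\<sigma>. pd (\<sigma> N) (trace_form (g i) \<sigma> (blk i)) t *
      (\<Prod>k\<in>{..<n}-{i}. trace_form (g k) \<sigma> (blk k) t)))"
    by (simp only: C1_form_prod(2) alt_sum_sum)
  also have "\<dots> = (\<Sum>i<n. 0)"
  proof (rule sum.cong[OF refl])
    fix i assume "i \<in> {..<n}"
    then have i: "i < n" by simp
    show "alt_sum {..<Suc N} (\<lambda>\<sigma>. pd (\<sigma> N) (trace_form (g i) \<sigma> (blk i)) t *
      (\<Prod>k\<in>{..<n}-{i}. trace_form (g k) \<sigma> (blk k) t)) = 0"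
    proof (rule alt_sum_pd_trace_form[OF g[OF i]])
      show "set (blk i) \<subseteq> {..<Suc N} - {N}" using blk_less[OF i] by fastforce
      fix \<sigma> \<tau> :: "nat \<Rightarrow> nat"
      assume a: "\<And>x. x \<in> {..<Suc N} - insert N (set (blk i)) \<Longrightarrow> \<sigma> x = \<tau> x"
      have "trace_form (g k) \<sigma> (blk k) t = trace_form (g k) \<tau> (blk k) t" if "k \<in> {..<n} - {i}" for k
      proof -
        have "\<sigma> x = \<tau> x" if "x \<in> set (blk k)" for x
        proof (rule a)
          have "x < N" using \<open>k \<in> {..<n} - {i}\<close> that blk_less[of k x] by simp
          moreover have "x \<notin> set (blk i)" using \<open>k \<in> {..<n} - {i}\<close> that disjoint_blk[of i k] i by auto
          ultimately show "x \<in> {..<Suc N} - insert N (set (blk i))" by simp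
        qed
        then have "map (\<lambda>x. log_pd (g k) (\<sigma> x) t) (blk k) = map (\<lambda>x. log_pd (g k) (\<tau> x) t) (blk k)" by simp
        then show ?thesis
          unfolding trace_form_def by (rule arg_cong[where f = "\<lambda>As. trace (mprod As)"])
      qed
      then show "(\<Prod>k\<in>{..<n}-{i}. trace_form (g k) \<sigma> (blk k) t) = (\<Prod>k\<in>{..<n}-{i}. trace_form (g k) \<tau> (blk k) t)"
        by (rule prod.cong[OF refl])
    qed (use distinct_blk odd_blk i in auto)
  qed
  finally show ?thesis by simp
qed

text \<open>The flux across a face of \<open>j\<close> involves every other direction, in particular
  both \<open>k\<close> and \<open>l\<close>. Proportional derivatives there amount to an
  alternating form with two parallel arguments.\<close>

lemma flux_eq_0:
  assumes kl: "k \<noteq> l" "k \<noteq> j" "l \<noteq> j" "k \<le> N" "l \<le> N"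
    and p: "\<And>i. i < n \<Longrightarrow> proportional_at k l u t (g i)"
  shows "flux g j t = 0"
  unfolding flux_def
proof (rule alt_sum_compose_left_eq_0)
  let ?\<pi> = "Transposition.transpose k l"
  \<comment> \<open>Renaming direction \<open>k\<close> to \<open>l\<close> costs a factor
    \<open>u\<close>; after the renaming, exchanging \<open>k\<close> and \<open>l\<close>
    beforehand makes no difference.\<close>
  let ?\<rho> = "\<lambda>y. if y = k then l else y"
  show "?\<pi> permutes {..<Suc N}" using kl by (intro permutes_swap_id) auto
  show "sign ?\<pi> = - 1" using kl by (simp add: sign_swap_id)
  have log: "log_pd (g i) k t = u *\<^sub>R log_pd (g i) l t" if "i < n" for i
    using p[OF that] bounded_bilinear.scaleR_right[OF bounded_bilinear_matrix_mult]
    by (simp add: log_pd_def proportional_at_def)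
  have *: "form_prod g \<sigma> t = u *\<^sub>R form_prod g (?\<rho> \<circ> \<sigma>) t" if \<sigma>: "\<sigma> permutes {..<Suc N}" "\<sigma> N = j" for \<sigma>
  proof -
    obtain x0 where x0: "\<sigma> x0 = k" using permutes_surj[OF \<sigma>(1)] by (metis surjD)
    have inj: "inj \<sigma>" by (rule permutes_inj[OF \<sigma>(1)])
    have "x0 \<in> {..<Suc N}" using permutes_in_image[OF \<sigma>(1), of x0] x0 kl by auto
    moreover have "x0 \<noteq> N" using x0 \<sigma> kl by auto
    ultimately have "x0 \<in> (\<Union>i<n. set (blk i))" by (simp add: Union_blk)
    then obtain i0 where i0: "i0 < n" "x0 \<in> set (blk i0)" by blast
    have "mprod (map (\<lambda>x. log_pd (g i0) (\<sigma> x) t) (blk i0)) =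
        u *\<^sub>R mprod (map (\<lambda>x. log_pd (g i0) ((?\<rho> \<circ> \<sigma>) x) t) (blk i0))"
      by (rule mprod_scaleR_one[OF distinct_blk[OF i0(1)] i0(2)])
        (simp_all add: x0 log[OF i0(1)] inj_eq[OF inj, of _ x0, unfolded x0])
    then have 1: "trace_form (g i0) \<sigma> (blk i0) t = u *\<^sub>R trace_form (g i0) (?\<rho> \<circ> \<sigma>) (blk i0) t"
      unfolding trace_form_def by (simp add: linear_scale[OF bounded_linear.linear[OF bounded_linear_trace]])
    have 2: "trace_form (g i) \<sigma> (blk i) t = trace_form (g i) (?\<rho> \<circ> \<sigma>) (blk i) t"
      if "i \<in> {..<n} - {i0}" for i
    proof -
      have "\<sigma> x \<noteq> k" if "x \<in> set (blk i)" for x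
        using that disjoint_blk[of i i0] i0 \<open>i \<in> {..<n} - {i0}\<close> x0 injD[OF inj, of x x0] by auto
      then have "map (\<lambda>x. log_pd (g i) (\<sigma> x) t) (blk i) = map (\<lambda>x. log_pd (g i) ((?\<rho> \<circ> \<sigma>) x) t) (blk i)"
        by simp
      then show ?thesis
        unfolding trace_form_def by (rule arg_cong[where f = "\<lambda>As. trace (mprod As)"])
    qed
    have 3: "(\<Prod>i\<in>{..<n}-{i0}. trace_form (g i) \<sigma> (blk i) t) =
        (\<Prod>i\<in>{..<n}-{i0}. trace_form (g i) (?\<rho> \<circ> \<sigma>) (blk i) t)"
      by (rule prod.cong[OF refl 2])
    have 4: "form_prod g \<kappa> t = trace_form (g i0) \<kappa> (blk i0) t *
        (\<Prod>i\<in>{..<n}-{i0}. trace_form (g i) \<kappa> (blk i) t)" for \<kappa>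
      unfolding form_prod_def by (rule prod.remove) (use i0 in auto)
    show ?thesis unfolding 4 3 1 by (rule mult_scaleR_left)
  qed
  fix \<sigma> assume \<sigma>: "\<sigma> permutes {..<Suc N}"
  have \<pi>\<sigma>: "(?\<pi> \<circ> \<sigma>) permutes {..<Suc N}" by (rule permutes_compose[OF \<sigma> \<open>?\<pi> permutes {..<Suc N}\<close>])
  have N: "(?\<pi> \<circ> \<sigma>) N = j \<longleftrightarrow> \<sigma> N = j"
    using kl by (auto simp: Transposition.transpose_def)
  have \<rho>: "?\<rho> \<circ> (?\<pi> \<circ> \<sigma>) = ?\<rho> \<circ> \<sigma>"
    using kl by (auto simp: Transposition.transpose_def fun_eq_iff)
  show "(if (?\<pi> \<circ> \<sigma>) N = j then form_prod g (?\<pi> \<circ> \<sigma>) t else 0) = (if \<sigma> N = j then form_prod g \<sigma> t else 0)"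
    unfolding N using *[OF \<sigma>] *[OF \<pi>\<sigma>, unfolded N \<rho>] by simp
qed simp

text \<open>The flux through a face differentiates only along that face, so equal values on the two
  faces give equal fluxes.\<close>

lemma flux_periodic:
  assumes j: "j < N" and per: "\<And>i t. i < n \<Longrightarrow> g i (t(j := 1)) = g i (t(j := 0))"
  shows "flux g j (t(j := 1)) = flux g j (t(j := 0))"
  unfolding flux_def
proof (rule alt_sum_cong)
  fix \<sigma> assume \<sigma>: "\<sigma> permutes {..<Suc N}"
  have "form_prod g \<sigma> (t(j := 1)) = form_prod g \<sigma> (t(j := 0))" if \<sigma>N: "\<sigma> N = j"
    unfolding form_prod_def trace_form_def
  proof (intro prod.cong refl arg_cong[where f = trace] arg_cong[where f = mprod] map_cong)
    fix i x assume i: "i \<in> {..<n}" and x: "x \<in> set (blk i)"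
    have "\<sigma> x \<noteq> j" using \<sigma>N injD[OF permutes_inj[OF \<sigma>], of x N] blk_less[of i x] i x by auto
    then show "log_pd (g i) (\<sigma> x) (t(j := 1)) = log_pd (g i) (\<sigma> x) (t(j := 0))"
      unfolding log_pd_def using per i pd_fun_upd_cong[of "g i" j 1 0 "\<sigma> x" t] by simp
  qed
  then show "(if \<sigma> N = j then form_prod g \<sigma> (t(j := 1)) else 0) =
      (if \<sigma> N = j then form_prod g \<sigma> (t(j := 0)) else 0)" by simp
qed

text \<open>The coordinate \<open>N\<close> is the time of the homotopy. Each of the other coordinates is either
  periodic or degenerates at both ends of the unit interval.\<close>

theorem box_integral_wedge_homotopy:
  assumes bdry: "\<And>j. j < N \<Longrightarrow>
    (\<forall>i<n. \<forall>t. g i (t(j := 1)) = g i (t(j := 0))) \<or>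
    (\<forall>t. t j \<in> {0, 1} \<longrightarrow> (\<exists>k l u. k \<noteq> l \<and> k \<noteq> j \<and> l \<noteq> j \<and> k \<le> N \<and> l \<le> N \<and>
      (\<forall>i<n. proportional_at k l u t (g i))))"
  shows "box_integral [0..<N] (\<lambda>t. wedge g (t(N := 1))) t = box_integral [0..<N] (\<lambda>t. wedge g (t(N := 0))) t"
proof -
  have "flux g j (t(j := 1)) - flux g j (t(j := 0)) = 0" if j: "j < N" for j t
    using bdry[OF j]
  proof
    assume "\<forall>i<n. \<forall>t. g i (t(j := 1)) = g i (t(j := 0))"
    then show ?thesis using flux_periodic[OF j] by simp
  next
    assume *: "\<forall>t. t j \<in> {0, 1} \<longrightarrow> (\<exists>k l u. k \<noteq> l \<and> k \<noteq> j \<and> l \<noteq> j \<and> k \<le> N \<and> l \<le> N \<and>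
      (\<forall>i<n. proportional_at k l u t (g i)))"
    have "flux g j t = 0" if "t j \<in> {0, 1}" for t
    proof -
      from * have "t j \<in> {0, 1} \<longrightarrow> (\<exists>k l u. k \<noteq> l \<and> k \<noteq> j \<and> l \<noteq> j \<and> k \<le> N \<and> l \<le> N \<and>
        (\<forall>i<n. proportional_at k l u t (g i)))" by (rule spec)
      from mp[OF this that] show ?thesis by (elim exE conjE) (rule flux_eq_0, blast+)
    qed
    from this[of "t(j := 1)"] this[of "t(j := 0)"] show ?thesis by simp
  qed
  then have z: "(\<lambda>t. flux g j (t(j := 1)) - flux g j (t(j := 0))) = (\<lambda>_. 0)" if "j < N" for j
    using that by (simp add: fun_eq_iff)
  have "(\<Sum>j\<in>set [0..<Suc N]. box_integral (remove1 j [0..<Suc N])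
      (\<lambda>t. flux g j (t(j := 1)) - flux g j (t(j := 0))) t) = 0"
    by (rule divergence_box_integral[OF distinct_upt C1_flux(1)])
      (simp only: set_upt atLeast0LessThan divergence_flux)
  also have "(\<Sum>j\<in>set [0..<Suc N]. box_integral (remove1 j [0..<Suc N])
      (\<lambda>t. flux g j (t(j := 1)) - flux g j (t(j := 0))) t) =
      box_integral (remove1 N [0..<Suc N]) (\<lambda>t. flux g N (t(N := 1)) - flux g N (t(N := 0))) t"
    by (simp only: set_upt atLeast0LessThan sum.lessThan_Suc) (simp add: z box_integral_zero)
  also have "remove1 N [0..<Suc N] = [0..<N]" by (simp add: remove1_append)
  finally have "box_integral [0..<N] (\<lambda>t. wedge g (t(N := 1)) + - wedge g (t(N := 0))) t = 0"
    by (simp only: flux_last diff_conv_add_uminus)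
  moreover have c: "continuous_on UNIV (wedge g)"
    using C1_continuous[OF C1_flux(1)[of N]] by (simp add: flux_last[abs_def])
  have c0: "continuous_on UNIV (\<lambda>t. - wedge g (t(N := 0)))"
    by (intro continuous_on_minus continuous_on_fun_upd_const[OF c])
  have "box_integral [0..<N] (\<lambda>t. wedge g (t(N := 1)) + - wedge g (t(N := 0))) t =
      box_integral [0..<N] (\<lambda>t. wedge g (t(N := 1))) t - box_integral [0..<N] (\<lambda>t. wedge g (t(N := 0))) t"
    using box_integral_add[OF continuous_on_fun_upd_const[OF c] c0]
      box_integral_linear[OF continuous_on_fun_upd_const[OF c] bounded_linear_minus[OF bounded_linear_ident]]
    by simp
  ultimately show ?thesis by simp
qed

end

end

section \<open>Alternating sums over pairs\<close>

lemma permutes_fixing_iff: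
  assumes "a \<notin> S" shows "\<sigma> permutes S \<longleftrightarrow> \<sigma> permutes (insert a S) \<and> \<sigma> a = a"
proof
  assume "\<sigma> permutes S"
  then show "\<sigma> permutes (insert a S) \<and> \<sigma> a = a"
    using permutes_subset[of \<sigma> S "insert a S"] permutes_not_in[of \<sigma> S a] assms by blast
next
  assume "\<sigma> permutes (insert a S) \<and> \<sigma> a = a"
  then show "\<sigma> permutes S"
    by - (rule permutes_superset[of \<sigma> "insert a S"], auto)
qed

lemma alt_sum_fixing:
  assumes "finite S" "a \<notin> S"
  shows "alt_sum (insert a S) (\<lambda>\<sigma>. if \<sigma> a = a then F \<sigma> else 0) = alt_sum S F"
proof -
  have eq: "{\<sigma>. \<sigma> permutes S} = {\<sigma> \<in> {\<sigma>. \<sigma> permutes (insert a S)}. \<sigma> a = a}"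
    using permutes_fixing_iff[OF assms(2)] by blast
  have "alt_sum (insert a S) (\<lambda>\<sigma>. if \<sigma> a = a then F \<sigma> else 0) =
      (\<Sum>\<sigma> | \<sigma> permutes (insert a S). if \<sigma> a = a then of_int (sign \<sigma>) * F \<sigma> else 0)"
    unfolding alt_sum_def by (rule sum.cong) simp_all
  also have "\<dots> = alt_sum S F"
    unfolding alt_sum_def eq
    by (rule sum.inter_filter[symmetric]) (simp add: finite_permutations assms)
  finally show ?thesis .
qed

lemma in_pair:
  assumes "x \<in> {q..<q + 2 * m}" obtains a where "a < m" "x = q + 2 * a \<or> x = Suc (q + 2 * a)"
proof -
  obtain d where d: "x = q + d" using assms le_Suc_ex by auto
  have "d div 2 < m" "d = 2 * (d div 2) \<or> d = Suc (2 * (d div 2))" using assms d by auto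
  then show thesis using that[of "d div 2"] d by auto
qed

text \<open>Permutations of \<open>{q..<q + 2 * m}\<close> are evaluated on the pairs \<open>(q + 2 * l, q + 2 * l + 1)\<close>.\<close>

definition pair_prod :: "(nat \<Rightarrow> nat \<Rightarrow> complex) \<Rightarrow> nat \<Rightarrow> nat \<Rightarrow> (nat \<Rightarrow> nat) \<Rightarrow> complex" where
  "pair_prod h q m \<sigma> = (\<Prod>l<m. h (\<sigma> (q + 2 * l)) (\<sigma> (Suc (q + 2 * l))))"

text \<open>Exchanging the two entries of one pair is an odd permutation, so \<open>h\<close> can be
  antisymmetrized in one pair after the other, each time at the cost of a factor 2.\<close>

lemma alt_sum_pair_prod_antisym:
  "2 ^ m * alt_sum {q..<q + 2 * m} (pair_prod h q m) =
    alt_sum {q..<q + 2 * m} (pair_prod (\<lambda>x y. h x y - h y x) q m)"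
proof -
  let ?S = "{q..<q + 2 * m}"
  let ?w = "\<lambda>x y. h x y - h y x"
  let ?F = "\<lambda>j \<sigma>. (\<Prod>l<m. (if l < j then ?w else h) (\<sigma> (q + 2 * l)) (\<sigma> (Suc (q + 2 * l))))"
  have "2 ^ j * alt_sum ?S (pair_prod h q m) = alt_sum ?S (?F j)" if "j \<le> m" for j
    using that
  proof (induction j)
    case 0 then show ?case by (simp add: pair_prod_def[abs_def])
  next
    case (Suc j)
    let ?\<pi> = "Transposition.transpose (q + 2 * j) (Suc (q + 2 * j))"
    let ?G = "\<lambda>\<sigma>. \<Prod>l\<in>{..<m} - {j}. (if l < j then ?w else h) (\<sigma> (q + 2 * l)) (\<sigma> (Suc (q + 2 * l)))"
    let ?h = "\<lambda>\<sigma>. h (\<sigma> (q + 2 * j)) (\<sigma> (Suc (q + 2 * j)))"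
    let ?h' = "\<lambda>\<sigma>. h (\<sigma> (Suc (q + 2 * j))) (\<sigma> (q + 2 * j))"
    have G: "(\<Prod>l\<in>{..<m} - {j}. (if l < Suc j then ?w else h) (\<sigma> (q + 2 * l)) (\<sigma> (Suc (q + 2 * l)))) = ?G \<sigma>" for \<sigma>
      by (rule prod.cong) auto
    have F: "?F j \<sigma> = ?h \<sigma> * ?G \<sigma>" "?F (Suc j) \<sigma> = ?h \<sigma> * ?G \<sigma> + - (?h' \<sigma> * ?G \<sigma>)" for \<sigma>
      using Suc.prems G[of \<sigma>] by (simp_all add: prod.remove[of "{..<m}" j] left_diff_distrib)
    have \<pi>: "?\<pi> permutes ?S" using Suc.prems by (intro permutes_swap_id) auto
    have G\<pi>: "?G (\<sigma> \<circ> ?\<pi>) = ?G \<sigma>" for \<sigma>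
    proof (rule prod.cong[OF refl])
      fix l assume l: "l \<in> {..<m} - {j}"
      have "?\<pi> (q + 2 * l) = q + 2 * l" "?\<pi> (Suc (q + 2 * l)) = Suc (q + 2 * l)"
        using l by (auto simp: Transposition.transpose_def)
      then show "(if l < j then ?w else h) ((\<sigma> \<circ> ?\<pi>) (q + 2 * l)) ((\<sigma> \<circ> ?\<pi>) (Suc (q + 2 * l))) =
          (if l < j then ?w else h) (\<sigma> (q + 2 * l)) (\<sigma> (Suc (q + 2 * l)))"
        by simp
    qed
    have "alt_sum ?S (\<lambda>\<sigma>. ?h \<sigma> * ?G \<sigma>) = - alt_sum ?S (\<lambda>\<sigma>. ?h (\<sigma> \<circ> ?\<pi>) * ?G (\<sigma> \<circ> ?\<pi>))"
      using alt_sum_compose_right[OF _ \<pi>, of "\<lambda>\<sigma>. ?h \<sigma> * ?G \<sigma>"] by (simp add: sign_swap_id)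
    also have "\<dots> = - alt_sum ?S (\<lambda>\<sigma>. ?h' \<sigma> * ?G \<sigma>)"
      unfolding G\<pi> by simp
    finally have "alt_sum ?S (?F (Suc j)) = 2 * alt_sum ?S (?F j)"
      unfolding F alt_sum_add alt_sum_minus by simp
    then show ?case using Suc by simp
  qed
  from this[of m] have "2 ^ m * alt_sum ?S (pair_prod h q m) = alt_sum ?S (?F m)" by simp
  also have "?F m = pair_prod ?w q m"
    unfolding pair_prod_def by (intro ext prod.cong) auto
  finally show ?thesis .
qed

text \<open>As for Pfaffians: exchanging two whole pairs is an even permutation, and turning a pair
  around changes the sign of both the permutation and \<open>w\<close>. The induction first brings
  the last pair back to its place.\<close>

lemma sign_pair_prod:
  assumes anti: "\<And>x y. w x y = - w y x"
    and "\<sigma> permutes {q..<q + 2 * m}"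
    and "\<And>l. l < m \<Longrightarrow> \<exists>k<m. {\<sigma> (q + 2 * l), \<sigma> (Suc (q + 2 * l))} = {q + 2 * k, Suc (q + 2 * k)}"
  shows "of_int (sign \<sigma>) * pair_prod w q m \<sigma> = pair_prod w q m id"
  using assms(2,3)
proof (induction m arbitrary: \<sigma>)
  case 0 then show ?case by (simp add: pair_prod_def)
next
  case (Suc m)
  let ?S = "{q..<q + 2 * Suc m}"
  let ?x = "q + 2 * m"
  have reduce: "of_int (sign \<sigma>) * pair_prod w q (Suc m) \<sigma> = pair_prod w q (Suc m) id"
    if \<sigma>: "\<sigma> permutes ?S" and pairs: "\<And>l. l < Suc m \<Longrightarrow>
        \<exists>k<Suc m. {\<sigma> (q + 2 * l), \<sigma> (Suc (q + 2 * l))} = {q + 2 * k, Suc (q + 2 * k)}"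
      and fixed: "\<sigma> ?x = ?x" "\<sigma> (Suc ?x) = Suc ?x" for \<sigma>
  proof -
    have "\<sigma> permutes {q..<q + 2 * m}"
      using \<sigma> fixed by - (rule permutes_superset[OF \<sigma>], auto simp: less_Suc_eq)
    moreover have "\<exists>k<m. {\<sigma> (q + 2 * l), \<sigma> (Suc (q + 2 * l))} = {q + 2 * k, Suc (q + 2 * k)}" if l: "l < m" for l
    proof -
      obtain k where k: "k < Suc m" "{\<sigma> (q + 2 * l), \<sigma> (Suc (q + 2 * l))} = {q + 2 * k, Suc (q + 2 * k)}"
        using pairs[of l] l by auto
      have "\<sigma> (q + 2 * l) \<noteq> ?x" "\<sigma> (Suc (q + 2 * l)) \<noteq> ?x"
        using permutes_inj[OF \<sigma>, THEN injD, of "q + 2 * l" ?x]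
          permutes_inj[OF \<sigma>, THEN injD, of "Suc (q + 2 * l)" ?x] fixed(1) l by auto
      moreover have "q + 2 * k \<in> {\<sigma> (q + 2 * l), \<sigma> (Suc (q + 2 * l))}" unfolding k(2) by simp
      ultimately have "k \<noteq> m" by auto
      then show ?thesis using k by (intro exI[of _ k]) auto
    qed
    ultimately have "of_int (sign \<sigma>) * pair_prod w q m \<sigma> = pair_prod w q m id"
      by (rule Suc.IH)
    then show ?thesis using fixed by (simp add: pair_prod_def mult.assoc[symmetric])
  qed
  have reduce2: "of_int (sign \<sigma>) * pair_prod w q (Suc m) \<sigma> = pair_prod w q (Suc m) id"
    if \<sigma>: "\<sigma> permutes ?S" and pairs: "\<And>l. l < Suc m \<Longrightarrow>
        \<exists>k<Suc m. {\<sigma> (q + 2 * l), \<sigma> (Suc (q + 2 * l))} = {q + 2 * k, Suc (q + 2 * k)}"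
      and fixed: "{\<sigma> ?x, \<sigma> (Suc ?x)} = {?x, Suc ?x}" for \<sigma>
  proof (cases "\<sigma> ?x = ?x")
    case True
    then show ?thesis using reduce[OF \<sigma> pairs] fixed by (metis doubleton_eq_iff)
  next
    case False
    then have f: "\<sigma> ?x = Suc ?x" "\<sigma> (Suc ?x) = ?x" using fixed by (auto simp: doubleton_eq_iff)
    let ?\<pi> = "Transposition.transpose ?x (Suc ?x)"
    have \<pi>: "?\<pi> permutes ?S" by (intro permutes_swap_id) auto
    have \<pi>l: "?\<pi> (q + 2 * l) = q + 2 * l" "?\<pi> (Suc (q + 2 * l)) = Suc (q + 2 * l)" if "l < m" for l
      using that by (auto simp: Transposition.transpose_def)
    have "of_int (sign (\<sigma> \<circ> ?\<pi>)) * pair_prod w q (Suc m) (\<sigma> \<circ> ?\<pi>) = pair_prod w q (Suc m) id"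
    proof (rule reduce)
      show "(\<sigma> \<circ> ?\<pi>) permutes ?S" by (rule permutes_compose[OF \<pi> \<sigma>])
      show "(\<sigma> \<circ> ?\<pi>) ?x = ?x" "(\<sigma> \<circ> ?\<pi>) (Suc ?x) = Suc ?x" using f by simp_all
      fix l assume l: "l < Suc m"
      show "\<exists>k<Suc m. {(\<sigma> \<circ> ?\<pi>) (q + 2 * l), (\<sigma> \<circ> ?\<pi>) (Suc (q + 2 * l))} = {q + 2 * k, Suc (q + 2 * k)}"
      proof (cases "l = m")
        case True then show ?thesis using f by (intro exI[of _ m]) simp
      next
        case False then show ?thesis using pairs[OF l] \<pi>l[of l] l by simp
      qed
    qed
    moreover have "sign (\<sigma> \<circ> ?\<pi>) = - sign \<sigma>"
      using permutes_imp_permutation[OF _ \<sigma>] permutes_imp_permutation[OF _ \<pi>]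
      by (simp add: sign_compose sign_swap_id)
    moreover have "pair_prod w q (Suc m) (\<sigma> \<circ> ?\<pi>) = - pair_prod w q (Suc m) \<sigma>"
    proof -
      have "(\<Prod>l<m. w ((\<sigma> \<circ> ?\<pi>) (q + 2 * l)) ((\<sigma> \<circ> ?\<pi>) (Suc (q + 2 * l)))) =
          (\<Prod>l<m. w (\<sigma> (q + 2 * l)) (\<sigma> (Suc (q + 2 * l))))"
        by (rule prod.cong) (simp_all add: \<pi>l)
      then show ?thesis using anti[of ?x "Suc ?x"] f by (simp add: pair_prod_def)
    qed
    ultimately show ?thesis by simp
  qed
  \<comment> \<open>The pair that \<open>\<sigma>\<close> sends to the last pair; an even exchange
    of pairs moves it to the end.\<close>
  obtain a where a: "a < Suc m" "{\<sigma> (q + 2 * a), \<sigma> (Suc (q + 2 * a))} = {?x, Suc ?x}"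
  proof -
    define y where "y = Hilbert_Choice.inv \<sigma> ?x"
    have y: "\<sigma> y = ?x" unfolding y_def by (rule permutes_inverses(1)[OF Suc.prems(1)])
    have "y \<in> ?S" using permutes_in_image[OF Suc.prems(1), of y] y by simp
    then obtain l where l: "l < Suc m" "y = q + 2 * l \<or> y = Suc (q + 2 * l)" by (rule in_pair)
    obtain k where k: "k < Suc m" "{\<sigma> (q + 2 * l), \<sigma> (Suc (q + 2 * l))} = {q + 2 * k, Suc (q + 2 * k)}"
      using Suc.prems(2)[OF l(1)] by auto
    have "?x \<in> {\<sigma> (q + 2 * l), \<sigma> (Suc (q + 2 * l))}" using l(2) y by auto
    then have "?x = q + 2 * k \<or> ?x = Suc (q + 2 * k)" unfolding k(2) by simp
    then have "k = m" by presburger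
    then show ?thesis using that l(1) k(2) by simp
  qed
  let ?\<tau> = "Transposition.transpose (q + 2 * a) ?x \<circ> Transposition.transpose (Suc (q + 2 * a)) (Suc ?x)"
  let ?t = "Transposition.transpose a m"
  have \<tau>: "?\<tau> permutes ?S"
    using a(1) by (intro permutes_compose permutes_swap_id) auto
  have \<tau>l: "?\<tau> (q + 2 * l) = q + 2 * ?t l" "?\<tau> (Suc (q + 2 * l)) = Suc (q + 2 * ?t l)" for l
    by (auto simp: Transposition.transpose_def)
  have "of_int (sign (\<sigma> \<circ> ?\<tau>)) * pair_prod w q (Suc m) (\<sigma> \<circ> ?\<tau>) = pair_prod w q (Suc m) id"
  proof (rule reduce2)
    show "(\<sigma> \<circ> ?\<tau>) permutes ?S" by (rule permutes_compose[OF \<tau> Suc.prems(1)])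
    have "?t m = a" by simp
    then show "{(\<sigma> \<circ> ?\<tau>) ?x, (\<sigma> \<circ> ?\<tau>) (Suc ?x)} = {?x, Suc ?x}"
      using a(2) \<tau>l[of m] by (simp only: comp_apply)
    fix l assume l: "l < Suc m"
    have "?t l < Suc m" using l a(1) by (auto simp: Transposition.transpose_def)
    from Suc.prems(2)[OF this]
    show "\<exists>k<Suc m. {(\<sigma> \<circ> ?\<tau>) (q + 2 * l), (\<sigma> \<circ> ?\<tau>) (Suc (q + 2 * l))} = {q + 2 * k, Suc (q + 2 * k)}"
      using \<tau>l[of l] by (simp only: comp_apply)
  qed
  moreover have "sign (\<sigma> \<circ> ?\<tau>) = sign \<sigma>"
  proof -
    have "sign ?\<tau> = 1" by (auto simp: sign_compose permutation_swap_id sign_swap_id)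
    then show ?thesis
      using permutes_imp_permutation[OF _ Suc.prems(1)] permutes_imp_permutation[OF _ \<tau>]
      by (simp add: sign_compose)
  qed
  moreover have "pair_prod w q (Suc m) (\<sigma> \<circ> ?\<tau>) = pair_prod w q (Suc m) \<sigma>"
  proof -
    have "?t permutes {..<Suc m}" using a(1) by (intro permutes_swap_id) auto
    note perm = prod.permute[OF this, of "\<lambda>l. w (\<sigma> (q + 2 * l)) (\<sigma> (Suc (q + 2 * l)))"]
    show ?thesis
      by (simp only: pair_prod_def perm) (simp only: comp_apply \<tau>l[unfolded comp_apply], simp only: comp_def)
  qed
  ultimately show ?case by (simp only:)
qed

text \<open>The hyperoctahedral group, of order 2^m m!. Its order enters the integral as a positive
  factor.\<close>

definition pair_perms :: "nat \<Rightarrow> nat \<Rightarrow> (nat \<Rightarrow> nat) set" where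
  "pair_perms q m = {\<sigma>. \<sigma> permutes {q..<q + 2 * m} \<and>
    (\<forall>l<m. \<exists>k<m. {\<sigma> (q + 2 * l), \<sigma> (Suc (q + 2 * l))} = {q + 2 * k, Suc (q + 2 * k)})}"

lemma card_pair_perms: "card (pair_perms q m) > 0"
proof -
  have "finite (pair_perms q m)"
    using finite_permutations[of "{q..<q + 2 * m}"] unfolding pair_perms_def
    by (rule finite_subset[rotated]) auto
  moreover have "id \<in> pair_perms q m" unfolding pair_perms_def by (auto simp: permutes_id)
  ultimately show ?thesis by (auto simp: card_gt_0_iff)
qed

text \<open>If \<open>w\<close> couples the even positions to the odd ones in a triangular way, only the permutations
  that preserve all pairs contribute, and all of them contribute the same.\<close>

lemma alt_sum_pair_prod_triangular:
  assumes anti: "\<And>x y. w x y = - w y x"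
    and even0: "\<And>a b. a < m \<Longrightarrow> b < m \<Longrightarrow> w (q + 2 * a) (q + 2 * b) = 0"
    and odd0: "\<And>a b. a < m \<Longrightarrow> b < m \<Longrightarrow> w (Suc (q + 2 * a)) (Suc (q + 2 * b)) = 0"
    and tri: "\<And>a b. a < m \<Longrightarrow> b < a \<Longrightarrow> w (q + 2 * a) (Suc (q + 2 * b)) = 0"
  shows "alt_sum {q..<q + 2 * m} (pair_prod w q m) = of_nat (card (pair_perms q m)) * pair_prod w q m id"
proof -
  let ?S = "{q..<q + 2 * m}"
  define K where "K = pair_perms q m"
  note K_def = K_def pair_perms_def
  have zero: "pair_prod w q m \<sigma> = 0" if \<sigma>: "\<sigma> permutes ?S" "\<sigma> \<notin> K" for \<sigma>
  proof (rule ccontr)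
    assume nz: "pair_prod w q m \<sigma> \<noteq> 0"
    have inS: "\<sigma> x \<in> ?S" if "x \<in> ?S" for x using permutes_in_image[OF \<sigma>(1)] that by blast
    have claim: "\<exists>a b. a \<le> b \<and> b < m \<and> {\<sigma> (q + 2 * l), \<sigma> (Suc (q + 2 * l))} = {q + 2 * a, Suc (q + 2 * b)}"
      if l: "l < m" for l
    proof -
      let ?x = "\<sigma> (q + 2 * l)" and ?y = "\<sigma> (Suc (q + 2 * l))"
      have w: "w ?x ?y \<noteq> 0" using nz l unfolding pair_prod_def by simp
      then have w': "w ?y ?x \<noteq> 0" using anti[of ?x ?y] by simp
      have xy: "?x \<in> ?S" "?y \<in> ?S" using l by (intro inS; simp)+
      obtain a where a: "a < m" "?x = q + 2 * a \<or> ?x = Suc (q + 2 * a)" by (rule in_pair[OF xy(1)])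
      obtain b where b: "b < m" "?y = q + 2 * b \<or> ?y = Suc (q + 2 * b)" by (rule in_pair[OF xy(2)])
      show ?thesis
      proof (cases "?x = q + 2 * a")
        case True
        then have y: "?y = Suc (q + 2 * b)" using even0[OF a(1) b(1)] w b(2) by metis
        have "a \<le> b" using tri[OF a(1), of b] w True y by (metis not_le)
        then show ?thesis
          by (intro exI[of _ a] exI[of _ b]) (simp only: True y b(1))
      next
        case False
        then have x: "?x = Suc (q + 2 * a)" using a(2) by blast
        then have y: "?y = q + 2 * b" using odd0[OF a(1) b(1)] w b(2) by metis
        have "b \<le> a" using tri[OF b(1), of a] w' x y by (metis not_le)
        then show ?thesis
          by (intro exI[of _ b] exI[of _ a]) (simp only: x y a(1) insert_commute)
      qed
    qed
    have "\<forall>l. \<exists>ab. l < m \<longrightarrow> fst ab \<le> snd ab \<and> snd ab < m \<and>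
        {\<sigma> (q + 2 * l), \<sigma> (Suc (q + 2 * l))} = {q + 2 * fst ab, Suc (q + 2 * snd ab)}"
    proof (intro allI)
      fix l
      show "\<exists>ab. l < m \<longrightarrow> fst ab \<le> snd ab \<and> snd ab < m \<and>
        {\<sigma> (q + 2 * l), \<sigma> (Suc (q + 2 * l))} = {q + 2 * fst ab, Suc (q + 2 * snd ab)}"
      proof (cases "l < m")
        case True
        then obtain a b where "a \<le> b" "b < m" "{\<sigma> (q + 2 * l), \<sigma> (Suc (q + 2 * l))} = {q + 2 * a, Suc (q + 2 * b)}"
          using claim[OF True] by (elim exE conjE)
        then show ?thesis by (intro exI[of _ "(a, b)"]) simp
      qed simp
    qed
    from choice[OF this] obtain f where f: "\<forall>l. l < m \<longrightarrow> fst (f l) \<le> snd (f l) \<and> snd (f l) < m \<and>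
        {\<sigma> (q + 2 * l), \<sigma> (Suc (q + 2 * l))} = {q + 2 * fst (f l), Suc (q + 2 * snd (f l))}"
      by blast
    \<comment> \<open>By the triangular shape, each pair of slots takes one even position, with
      index \<open>A l\<close>, and one odd position, with index \<open>B l\<close>, where
      \<open>A l \<le> B l\<close>.\<close>
    define A B where "A l = fst (f l)" and "B l = snd (f l)" for l
    have AB: "A l \<le> B l" "B l < m" "{\<sigma> (q + 2 * l), \<sigma> (Suc (q + 2 * l))} = {q + 2 * A l, Suc (q + 2 * B l)}"
      if "l < m" for l
      using f that by (simp_all add: A_def B_def)
    have surj: "\<exists>l<m. x \<in> {q + 2 * A l, Suc (q + 2 * B l)}" if x: "x \<in> ?S" for x
    proof -
      define y where "y = Hilbert_Choice.inv \<sigma> x"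
      have y: "\<sigma> y = x" unfolding y_def by (rule permutes_inverses(1)[OF \<sigma>(1)])
      have "y \<in> ?S" using permutes_in_image[OF \<sigma>(1), of y] y x by simp
      then obtain l where l: "l < m" "y = q + 2 * l \<or> y = Suc (q + 2 * l)" by (rule in_pair)
      from l(2) have "\<sigma> y \<in> {\<sigma> (q + 2 * l), \<sigma> (Suc (q + 2 * l))}" by (elim disjE) simp_all
      then show ?thesis unfolding AB(3)[OF l(1)] y using l(1) by blast
    qed
    have "{..<m} \<subseteq> A ` {..<m}"
    proof
      fix a assume "a \<in> {..<m}"
      then obtain l where "l < m" "q + 2 * a \<in> {q + 2 * A l, Suc (q + 2 * B l)}"
        using surj[of "q + 2 * a"] by auto
      then have "l < m" "q + 2 * a = q + 2 * A l \<or> q + 2 * a = Suc (q + 2 * B l)" by simp_all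
      then have "l < m" "A l = a" by presburger+
      then show "a \<in> A ` {..<m}" by blast
    qed
    moreover have "A ` {..<m} \<subseteq> {..<m}" using AB(1,2) by fastforce
    ultimately have imA: "A ` {..<m} = {..<m}" by blast
    have "{..<m} \<subseteq> B ` {..<m}"
    proof
      fix b assume "b \<in> {..<m}"
      then obtain l where "l < m" "Suc (q + 2 * b) \<in> {q + 2 * A l, Suc (q + 2 * B l)}"
        using surj[of "Suc (q + 2 * b)"] by auto
      then have "l < m" "Suc (q + 2 * b) = q + 2 * A l \<or> Suc (q + 2 * b) = Suc (q + 2 * B l)" by simp_all
      then have "l < m" "B l = b" by presburger+
      then show "b \<in> B ` {..<m}" by blast
    qed
    then have imB: "B ` {..<m} = {..<m}" using AB(2) by auto
    have "inj_on A {..<m}" "inj_on B {..<m}" using imA imB by (auto intro!: eq_card_imp_inj_on)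
    \<comment> \<open>Both \<open>A\<close> and \<open>B\<close> permute the same index set and
      \<open>A \<le> B\<close> pointwise, so equality of the sums forces equality
      everywhere.\<close>
    then have "(\<Sum>l<m. A l) = (\<Sum>l<m. B l)"
      using sum.reindex[of A "{..<m}" id] sum.reindex[of B "{..<m}" id] imA imB by simp
    then have eq: "A l = B l" if "l < m" for l
      using sum_mono_inv[of A "{..<m}" B l] AB(1) that by auto
    have "\<sigma> \<in> K" unfolding K_def using \<sigma>(1) AB(2,3) eq by auto
    then show False using \<sigma>(2) by simp
  qed
  have "alt_sum ?S (pair_prod w q m) = (\<Sum>\<sigma>\<in>K. of_int (sign \<sigma>) * pair_prod w q m \<sigma>)"
    unfolding alt_sum_def
    by (rule sum.mono_neutral_right) (auto simp: finite_permutations K_def intro: zero[unfolded K_def])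
  also have "\<dots> = (\<Sum>\<sigma>\<in>K. pair_prod w q m id)"
    by (rule sum.cong[OF refl], rule sign_pair_prod[OF anti]) (auto simp: K_def)
  also have "\<dots> = of_nat (card K) * pair_prod w q m id" by simp
  finally show ?thesis by (simp only: K_def(1))
qed

section \<open>Complex reflections\<close>

definition cscale :: "complex \<Rightarrow> complex ^ 'n ^ 'm \<Rightarrow> complex ^ 'n ^ 'm" where
  "cscale c A = (\<chi> i j. c * A $ i $ j)"

definition outer :: "complex ^ 'm \<Rightarrow> complex ^ 'n \<Rightarrow> complex ^ 'n ^ 'm" where
  "outer a b = (\<chi> i j. a $ i * cnj (b $ j))"

definition herm :: "complex ^ 'm \<Rightarrow> complex ^ 'm \<Rightarrow> complex" where
  "herm a b = (\<Sum>i\<in>UNIV. cnj (a $ i) * b $ i)"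

lemma bounded_bilinear_cscale: "bounded_bilinear (cscale :: _ \<Rightarrow> complex ^ 'n ^ 'm \<Rightarrow> _)"
proof -
  have "bilinear (cscale :: _ \<Rightarrow> complex ^ 'n ^ 'm \<Rightarrow> _)"
    unfolding bilinear_def
    by (intro conjI allI linearI) (simp_all add: cscale_def vec_eq_iff algebra_simps)
  then show ?thesis by (simp add: bilinear_conv_bounded_bilinear)
qed

lemma bounded_bilinear_outer: "bounded_bilinear (outer :: complex ^ 'm \<Rightarrow> complex ^ 'n \<Rightarrow> _)"
proof -
  have "bilinear (outer :: complex ^ 'm \<Rightarrow> complex ^ 'n \<Rightarrow> _)"
    unfolding bilinear_def
    by (intro conjI allI linearI) (simp_all add: outer_def vec_eq_iff algebra_simps)
  then show ?thesis by (simp add: bilinear_conv_bounded_bilinear)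
qed

lemma bounded_bilinear_herm: "bounded_bilinear (herm :: complex ^ 'm \<Rightarrow> _)"
proof -
  have "bilinear (herm :: complex ^ 'm \<Rightarrow> _)"
    unfolding bilinear_def
    by (intro conjI allI linearI) (simp_all add: herm_def algebra_simps sum.distrib scaleR_sum_right)
  then show ?thesis by (simp add: bilinear_conv_bounded_bilinear)
qed

lemma cscale_matrix_mult: "cscale c A ** B = cscale c (A ** B)" "A ** cscale c B = cscale c (A ** B)"
  by (simp_all add: cscale_def matrix_matrix_mult_def vec_eq_iff sum_distrib_left mult_ac)

lemma cscale_cscale: "cscale c (cscale d A) = cscale (c * d) A"
  by (simp add: cscale_def vec_eq_iff mult.assoc)

lemma cscale_1 [simp]: "cscale 1 A = A" and cscale_0 [simp]: "cscale 0 A = 0"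
  by (simp_all add: cscale_def vec_eq_iff)

lemma cscale_add: "cscale c (A + B) = cscale c A + cscale c B" "cscale (c + d) A = cscale c A + cscale d A"
  by (simp_all add: cscale_def vec_eq_iff algebra_simps)

lemma trace_cscale: "trace (cscale c A) = c * trace A"
  by (simp add: trace_def cscale_def sum_distrib_left)

lemma outer_mult: "outer a b ** outer c d = cscale (herm b c) (outer a d)"
  by (simp add: outer_def herm_def cscale_def matrix_matrix_mult_def vec_eq_iff
      sum_distrib_left sum_distrib_right mult_ac)

lemma trace_outer: "trace (outer a b) = herm b a"
  by (simp add: trace_def outer_def herm_def mult.commute)

section \<open>The Maurer-Cartan form of a reflection with moving axis\<close>

lemma pd_indep:
  assumes "\<And>t s. F (t(j := s)) = F t" shows "pd j F = (\<lambda>_. 0)"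
proof
  fix t show "pd j F t = 0"
    by (rule pd_eqI) (simp add: assms)
qed

lemma has_vector_derivative_cis_mult:
  "((\<lambda>x. cis (c * x)) has_vector_derivative (complex_of_real c * \<i> * cis (c * x))) (at x)"
  unfolding has_vector_derivative_def
  by (rule derivative_eq_intros refl)+ (auto simp: fun_eq_iff scaleR_conv_of_real)

locale reflection_map =
  fixes v :: "point \<Rightarrow> complex ^ 'm" and z :: nat
  assumes C2_v: "C2 v" and unit_v: "\<And>t. herm (v t) (v t) = 1"
    and indep_v: "\<And>t s. v (t(z := s)) = v t"
begin

definition proj where "proj t = outer (v t) (v t)"

definition phase :: "point \<Rightarrow> complex" where "phase t = cis (2 * pi * t z)"

definition reflect :: "point \<Rightarrow> complex ^ 'm ^ 'm" where
  "reflect t = mat 1 + cscale (phase t - 1) (proj t)"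

lemma phase_cnj: "phase t * cnj (phase t) = 1"
  by (simp add: phase_def cis_cnj cis_mult)

lemma pd_phase: "C2 phase" "pd z phase t = 2 * pi * \<i> * phase t" "k \<noteq> z \<Longrightarrow> pd k phase t = 0"
proof -
  have e: "phase = (\<lambda>t. cis (2 * pi * t z))" by (simp add: phase_def fun_eq_iff)
  note 1 = C1_coord[OF has_vector_derivative_cis_mult, of "2 * pi" z]
  have c: "continuous_on UNIV (\<lambda>x. complex_of_real c * \<i> * cis (c * x))" for c
    by (intro continuous_intros)
  show "C2 phase" unfolding e
    by (rule C2_coord[OF has_vector_derivative_cis_mult
          has_vector_derivative_mult_right[OF has_vector_derivative_cis_mult]]) (intro continuous_intros)
  show "pd z phase t = 2 * pi * \<i> * phase t" "k \<noteq> z \<Longrightarrow> pd k phase t = 0"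
    unfolding e by (simp_all add: C1_coord(2)[OF has_vector_derivative_cis_mult c])
qed

lemma C2_proj: "C2 proj"
  unfolding proj_def[abs_def] by (rule bounded_bilinear.C2_prod[OF bounded_bilinear_outer C2_v C2_v])

lemma pd_proj: "pd k proj t = outer (v t) (pd k v t) + outer (pd k v t) (v t)"
  unfolding proj_def[abs_def]
  by (simp add: bounded_bilinear.C1_prod(2)[OF bounded_bilinear_outer C2_C1[OF C2_v] C2_C1[OF C2_v]])

lemma pd_z_v: "pd z v t = 0"
  using pd_indep[of v z] indep_v by simp

lemma C2_reflect: "C2 reflect"
  and pd_reflect: "pd k reflect t = cscale (phase t - 1) (pd k proj t) + cscale (pd k phase t) (proj t)"
proof -
  note 1 = C2_diff[OF pd_phase(1) C2_const[of 1]]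
  note 2 = bounded_bilinear.C2_prod[OF bounded_bilinear_cscale 1 C2_proj]
  show "C2 reflect"
    unfolding reflect_def[abs_def] by (rule C2_add[OF C2_const 2])
  show "pd k reflect t = cscale (phase t - 1) (pd k proj t) + cscale (pd k phase t) (proj t)"
    unfolding reflect_def[abs_def] C1_add(2)[OF C1_const C2_C1[OF 2]]
      bounded_bilinear.C1_prod(2)[OF bounded_bilinear_cscale C2_C1[OF 1] C2_C1[OF C2_proj]]
      C1_diff(2)[OF C2_C1[OF pd_phase(1)] C1_const]
    by simp
qed

lemma proj_idem: "proj t ** proj t = proj t"
  by (simp add: proj_def outer_mult unit_v)

lemma proj_combination:
  "(mat 1 + cscale a (proj t)) ** (mat 1 + cscale b (proj t)) = mat 1 + cscale (a + b + a * b) (proj t)"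
proof -
  interpret mm: bounded_bilinear "(**) :: complex ^ 'm ^ 'm \<Rightarrow> complex ^ 'm ^ 'm \<Rightarrow> complex ^ 'm ^ 'm"
    by (rule bounded_bilinear_matrix_mult)
  show ?thesis
    by (simp add: mm.add_left mm.add_right cscale_matrix_mult cscale_cscale proj_idem cscale_add mult.commute)
qed

lemma reflect_inverse:
  "reflect t ** (mat 1 + cscale (cnj (phase t) - 1) (proj t)) = mat 1"
  "invertible (reflect t)" "matrix_inv (reflect t) = mat 1 + cscale (cnj (phase t) - 1) (proj t)"
proof -
  have "phase t - 1 + (cnj (phase t) - 1) + (phase t - 1) * (cnj (phase t) - 1) = 0"
    using phase_cnj[of t] by (simp add: algebra_simps)
  then show 1: "reflect t ** (mat 1 + cscale (cnj (phase t) - 1) (proj t)) = mat 1"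
    by (simp add: reflect_def proj_combination)
  show "invertible (reflect t)" "matrix_inv (reflect t) = mat 1 + cscale (cnj (phase t) - 1) (proj t)"
    by (rule matrix_inv_eqI[OF 1])+
qed

lemma GL_map_reflect: "GL_map reflect"
  by (simp add: GL_map_def C2_reflect reflect_inverse(2))

lemma log_pd_reflect_z: "log_pd reflect z t = cscale (2 * pi * \<i>) (proj t)"
proof -
  interpret mm: bounded_bilinear "(**) :: complex ^ 'm ^ 'm \<Rightarrow> complex ^ 'm ^ 'm \<Rightarrow> complex ^ 'm ^ 'm"
    by (rule bounded_bilinear_matrix_mult)
  interpret o: bounded_bilinear "outer :: complex ^ 'm \<Rightarrow> complex ^ 'm \<Rightarrow> _"
    by (rule bounded_bilinear_outer)
  have "pd z reflect t = cscale (2 * pi * \<i> * phase t) (proj t)"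
    by (simp add: pd_reflect pd_proj pd_z_v o.zero_left o.zero_right pd_phase(2)) (simp add: cscale_def vec_eq_iff)
  then have "log_pd reflect z t = cscale ((2 * pi * \<i> * phase t) + (cnj (phase t) - 1) * (2 * pi * \<i> * phase t)) (proj t)"
    by (simp add: log_pd_def reflect_inverse(3) mm.add_left cscale_matrix_mult cscale_cscale proj_idem cscale_add mult.commute)
  also have "(2 * pi * \<i> * phase t) + (cnj (phase t) - 1) * (2 * pi * \<i> * phase t) = 2 * pi * \<i>"
    using phase_cnj[of t] by (simp add: algebra_simps)
  finally show ?thesis .
qed

text \<open>Its antisymmetric part is, up to a constant factor, the pulled-back Fubini-Study form of
  the line spanned by \<open>v\<close>; the second summand is symmetric and drops out.\<close>

definition curv :: "point \<Rightarrow> nat \<Rightarrow> nat \<Rightarrow> complex" where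
  "curv t k l = herm (pd k v t) (pd l v t) + herm (v t) (pd k v t) * herm (v t) (pd l v t)"

text \<open>The squared distance of \<open>phase t\<close> from 1.\<close>

definition weight :: "point \<Rightarrow> real" where "weight t = 2 - 2 * cos (2 * pi * t z)"

lemma herm_v_pd: "herm (pd k v t) (v t) + herm (v t) (pd k v t) = 0"
proof -
  have "pd k (\<lambda>t. herm (v t) (v t)) t = herm (v t) (pd k v t) + herm (pd k v t) (v t)"
    by (simp add: bounded_bilinear.C1_prod(2)[OF bounded_bilinear_herm C2_C1[OF C2_v] C2_C1[OF C2_v]])
  then show ?thesis by (simp add: unit_v add.commute)
qed

text \<open>The first logarithmic derivative leads from the axis into its complement and the second
  one back, up to parts that cancel. After a projection of rank one only a scalar survives, so long
  products collapse pair by pair.\<close>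

lemma proj_log_pd_pair:
  assumes "k \<noteq> z" "l \<noteq> z"
  shows "proj t ** (log_pd reflect k t ** log_pd reflect l t) = cscale (- weight t * curv t k l) (proj t)"
proof -
  interpret mm: bounded_bilinear "(**) :: complex ^ 'm ^ 'm \<Rightarrow> complex ^ 'm ^ 'm \<Rightarrow> complex ^ 'm ^ 'm"
    by (rule bounded_bilinear_matrix_mult)
  define e where "e = phase t - 1"
  define e' where "e' = cnj (phase t) - 1"
  define X where "X = cscale (herm (v t) (pd k v t)) (outer (v t) (v t)) + outer (v t) (pd k v t)"
  have L: "log_pd reflect j t = (mat 1 + cscale e' (proj t)) ** cscale e (outer (v t) (pd j v t) + outer (pd j v t) (v t))"
    if "j \<noteq> z" for j
    using that by (simp add: log_pd_def reflect_inverse(3) e'_def e_def pd_reflect pd_phase(3) pd_proj)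
  have P: "proj t ** (mat 1 + cscale e' (proj t)) = cscale (1 + e') (proj t)"
    by (simp add: mm.add_right cscale_matrix_mult proj_idem cscale_add)
  have X: "proj t ** (outer (v t) (pd k v t) + outer (pd k v t) (v t)) = X"
    by (simp add: mm.add_right proj_def outer_mult unit_v X_def add.commute)
  \<comment> \<open>\<open>X\<close> kills the axis because \<open>v\<close> has constant length.
    Hence the inverse reflection inside the second logarithmic derivative acts on \<open>X\<close>
    as the identity.\<close>
  have XP: "X ** proj t = 0"
    using herm_v_pd[of k t]
    by (simp add: X_def mm.add_left cscale_matrix_mult proj_def outer_mult unit_v cscale_cscale
        cscale_add(2)[symmetric] add.commute)
  have X1: "X ** (mat 1 + cscale e' (proj t)) = X"
    by (simp add: mm.add_right cscale_matrix_mult XP) (simp add: cscale_def vec_eq_iff)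
  have X2: "X ** (outer (v t) (pd l v t) + outer (pd l v t) (v t)) = cscale (curv t k l) (proj t)"
  proof -
    have "X ** outer (v t) (pd l v t) = cscale (herm (v t) (pd k v t) + herm (pd k v t) (v t)) (outer (v t) (pd l v t))"
      by (simp add: X_def mm.add_left cscale_matrix_mult outer_mult unit_v cscale_cscale cscale_add(2))
    then have "X ** outer (v t) (pd l v t) = 0"
      using herm_v_pd[of k t] by (simp add: add.commute)
    moreover have "X ** outer (pd l v t) (v t) = cscale (curv t k l) (proj t)"
      by (simp add: X_def mm.add_left cscale_matrix_mult outer_mult cscale_cscale cscale_add(2)[symmetric]
          curv_def proj_def add.commute)
    ultimately show ?thesis by (simp add: mm.add_right)
  qed
  have "proj t ** (log_pd reflect k t ** log_pd reflect l t) = cscale ((1 + e') * e * e)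
      (((proj t ** (outer (v t) (pd k v t) + outer (pd k v t) (v t))) ** (mat 1 + cscale e' (proj t))) **
        (outer (v t) (pd l v t) + outer (pd l v t) (v t)))"
    by (simp only: L[OF assms(1)] L[OF assms(2)] matrix_mul_assoc P cscale_matrix_mult cscale_cscale mult_ac)
  also have "\<dots> = cscale ((1 + e') * e * e * curv t k l) (proj t)"
    by (simp only: X X1 X2 cscale_cscale)
  also have "(1 + e') * e * e = - weight t"
  proof -
    have "(1 + e') * e * e = cnj (phase t) * (phase t * phase t) - 2 * (phase t * cnj (phase t)) + cnj (phase t)"
      by (simp add: e_def e'_def algebra_simps)
    also have "\<dots> = phase t + cnj (phase t) - 2"
      using phase_cnj[of t] by (simp add: mult.assoc[symmetric] mult.commute)
    also have "\<dots> = - weight t" by (simp add: phase_def weight_def complex_eq_iff)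
    finally show ?thesis .
  qed
  finally show ?thesis by simp
qed

lemma proj_mprod:
  assumes "\<And>x. x \<in> {q..<q + 2 * m} \<Longrightarrow> \<kappa> x \<noteq> z"
  shows "proj t ** mprod (map (\<lambda>x. log_pd reflect (\<kappa> x) t) [q..<q + 2 * m]) =
    cscale ((- weight t) ^ m * pair_prod (curv t) q m \<kappa>) (proj t)"
  using assms
proof (induction m)
  case 0 then show ?case by (simp add: pair_prod_def)
next
  case (Suc m)
  have u: "[q..<q + 2 * Suc m] = [q..<q + 2 * m] @ [q + 2 * m, Suc (q + 2 * m)]" by simp
  have z: "\<kappa> (q + 2 * m) \<noteq> z" "\<kappa> (Suc (q + 2 * m)) \<noteq> z" using Suc.prems by simp_all
  have "proj t ** mprod (map (\<lambda>x. log_pd reflect (\<kappa> x) t) [q..<q + 2 * Suc m]) =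
      (proj t ** mprod (map (\<lambda>x. log_pd reflect (\<kappa> x) t) [q..<q + 2 * m])) **
      (log_pd reflect (\<kappa> (q + 2 * m)) t ** log_pd reflect (\<kappa> (Suc (q + 2 * m))) t)"
    unfolding u map_append mprod_append by (simp add: matrix_mul_assoc)
  also have "\<dots> = cscale ((- weight t) ^ m * pair_prod (curv t) q m \<kappa>)
      (proj t ** (log_pd reflect (\<kappa> (q + 2 * m)) t ** log_pd reflect (\<kappa> (Suc (q + 2 * m))) t))"
    using Suc by (simp add: cscale_matrix_mult)
  also have "\<dots> = cscale ((- weight t) ^ m * pair_prod (curv t) q m \<kappa> *
      (- weight t * curv t (\<kappa> (q + 2 * m)) (\<kappa> (Suc (q + 2 * m))))) (proj t)"
    by (simp only: proj_log_pd_pair[OF z] cscale_cscale)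
  also have "(- weight t) ^ m * pair_prod (curv t) q m \<kappa> *
      (- weight t * curv t (\<kappa> (q + 2 * m)) (\<kappa> (Suc (q + 2 * m)))) =
      (- weight t) ^ Suc m * pair_prod (curv t) q (Suc m) \<kappa>"
    by (simp add: pair_prod_def mult_ac)
  finally show ?case .
qed

text \<open>The phase direction may occupy any of the \<open>2 * m + 1\<close> slots. A cycle of odd
  length is even, so by cyclicity of the trace all slots contribute alike. With the phase in front,
  its logarithmic derivative is a multiple of the projection, and the remaining directions pair
  up.\<close>

lemma alt_sum_reflect:
  "alt_sum {z..<z + 2 * m + 1} (\<lambda>\<sigma>. trace_form reflect \<sigma> [z..<z + 2 * m + 1] t) =
    of_nat (2 * m + 1) * (2 * pi * \<i>) * (- weight t) ^ m *
    alt_sum {Suc z..<Suc z + 2 * m} (pair_prod (curv t) (Suc z) m)"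
proof -
  let ?S = "{z..<z + 2 * m + 1}" and ?xs = "[z..<z + 2 * m + 1]"
  let ?T = "\<lambda>\<sigma>. trace_form reflect \<sigma> ?xs t"
  let ?c = "cycle_of_list ?xs"
  define F where "F x = alt_sum ?S (\<lambda>\<sigma>. if \<sigma> x = z then ?T \<sigma> else 0)" for x
  have c: "?c permutes ?S" using cycle_permutes[of ?xs] by (simp only: set_upt)
  have sgn: "sign ?c = 1" by (subst sign_cycle_of_list) (auto simp: not_le)
  have rot: "map ?c ?xs = rotate1 ?xs"
    using cyclic_rotation[OF distinct_upt, of 1 z "z + 2 * m + 1"] by simp
  have T: "?T (\<sigma> \<circ> ?c) = ?T \<sigma>" for \<sigma>
  proof -
    have "map (\<lambda>x. log_pd reflect ((\<sigma> \<circ> ?c) x) t) ?xs = map (\<lambda>x. log_pd reflect (\<sigma> x) t) (map ?c ?xs)"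
      by (simp only: map_map comp_def)
    also have "\<dots> = rotate1 (map (\<lambda>x. log_pd reflect (\<sigma> x) t) ?xs)"
      unfolding rot by (rule rotate1_map[symmetric])
    finally show ?thesis unfolding trace_form_def by (simp only: trace_mprod_rotate1)
  qed
  have Fc: "F x = F (?c x)" for x
  proof -
    have "F x = alt_sum ?S (\<lambda>\<sigma>. if (\<sigma> \<circ> ?c) x = z then ?T (\<sigma> \<circ> ?c) else 0)"
      unfolding F_def by (subst alt_sum_compose_right[OF finite_atLeastLessThan c]) (simp only: sgn of_int_1 mult_1_left)
    then show ?thesis unfolding T F_def by (simp only: comp_apply)
  qed
  have step: "?c (z + i) = Suc (z + i)" if "i < 2 * m" for i
  proof -
    have x: "?xs ! i = z + i" "?xs ! Suc i = Suc (z + i)" "Suc i < length ?xs"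
      using that by (simp_all only: length_upt nth_upt)
    have "?c (z + i) = map ?c ?xs ! i" using x by (subst nth_map) simp_all
    also have "\<dots> = rotate1 ?xs ! i" unfolding rot ..
    also have "\<dots> = ?xs ! Suc i" using x(3) by (subst nth_rotate1) simp_all
    finally show ?thesis unfolding x .
  qed
  have Fi: "F (z + i) = F z" if "i \<le> 2 * m" for i
    using that
  proof (induction i)
    case (Suc i)
    then have "F (Suc (z + i)) = F (z + i)" using Fc[of "z + i"] step[of i] by (simp only: Suc_le_eq)
    then show ?case using Suc by simp
  qed simp
  have F0: "F z = (2 * pi * \<i>) * (- weight t) ^ m * alt_sum {Suc z..<Suc z + 2 * m} (pair_prod (curv t) (Suc z) m)"
  proof -
    have S: "?S = insert z {Suc z..<Suc z + 2 * m}" by auto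
    have "F z = alt_sum (insert z {Suc z..<Suc z + 2 * m}) (\<lambda>\<sigma>. if \<sigma> z = z then ?T \<sigma> else 0)"
      unfolding F_def S ..
    also have "\<dots> = alt_sum {Suc z..<Suc z + 2 * m} ?T" by (rule alt_sum_fixing) simp_all
    also have "\<dots> = alt_sum {Suc z..<Suc z + 2 * m} (\<lambda>\<sigma>. (2 * pi * \<i>) * (- weight t) ^ m * pair_prod (curv t) (Suc z) m \<sigma>)"
    proof (rule alt_sum_cong)
      fix \<sigma> assume \<sigma>: "\<sigma> permutes {Suc z..<Suc z + 2 * m}"
      have z: "\<sigma> z = z" using permutes_not_in[OF \<sigma>] by simp
      have "\<sigma> x \<noteq> z" if "x \<in> {Suc z..<Suc z + 2 * m}" for x
      proof -
        have "\<sigma> x \<in> {Suc z..<Suc z + 2 * m}" using permutes_in_image[OF \<sigma>] that by blast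
        then show ?thesis by simp
      qed
      then have "proj t ** mprod (map (\<lambda>x. log_pd reflect (\<sigma> x) t) [Suc z..<Suc z + 2 * m]) =
          cscale ((- weight t) ^ m * pair_prod (curv t) (Suc z) m \<sigma>) (proj t)"
        by (rule proj_mprod)
      moreover have "?xs = z # [Suc z..<Suc z + 2 * m]" by (simp add: upt_conv_Cons)
      ultimately show "?T \<sigma> = (2 * pi * \<i>) * (- weight t) ^ m * pair_prod (curv t) (Suc z) m \<sigma>"
        by (simp only: trace_form_def list.map mprod_Cons z log_pd_reflect_z cscale_matrix_mult trace_cscale)
          (simp add: proj_def trace_outer unit_v)
    qed
    finally show ?thesis by (simp only: alt_sum_cmult)
  qed
  have "alt_sum ?S ?T = alt_sum ?S (\<lambda>\<sigma>. \<Sum>x\<in>?S. if \<sigma> x = z then ?T \<sigma> else 0)"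
  proof (rule alt_sum_cong)
    fix \<sigma> assume \<sigma>: "\<sigma> permutes ?S"
    let ?y = "Hilbert_Choice.inv \<sigma> z"
    have y: "\<sigma> x = z \<longleftrightarrow> x = ?y" for x
      using permutes_inv_eq[OF \<sigma>, of z x] by auto
    have "?y \<in> ?S" using permutes_in_image[OF \<sigma>, of ?y] permutes_inverses(1)[OF \<sigma>, of z] by simp
    then show "?T \<sigma> = (\<Sum>x\<in>?S. if \<sigma> x = z then ?T \<sigma> else 0)"
      unfolding y by (subst sum.delta) simp_all
  qed
  also have "\<dots> = (\<Sum>x\<in>?S. F x)" by (simp only: alt_sum_sum F_def)
  also have "\<dots> = (\<Sum>x\<in>?S. F z)"
  proof (rule sum.cong[OF HOL.refl])
    fix x assume "x \<in> ?S"
    then show "F x = F z" using Fi[of "x - z"] by auto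
  qed
  also have "\<dots> = of_nat (2 * m + 1) * F z" by simp
  finally show ?thesis unfolding F0 by (simp only: mult.assoc)
qed

end

section \<open>Unit vectors in polar coordinates\<close>

lemma bounded_linear_axis: "bounded_linear (\<lambda>x. axis i x :: 'a::euclidean_space ^ 'm)"
proof -
  have "linear (\<lambda>x. axis i x :: 'a ^ 'm)"
    by (intro linearI) (simp_all add: axis_def vec_eq_iff)
  then show ?thesis by (simp add: linear_conv_bounded_linear)
qed

lemma vec_lambda_eq_sum_axis: "(\<chi> i. f i) = (\<Sum>i\<in>UNIV. axis i (f i))"
  by (simp add: vec_eq_iff axis_def sum.delta')

lemma C2_vec_lambda:
  fixes f :: "'m::finite \<Rightarrow> point \<Rightarrow> 'a::euclidean_space"
  assumes "\<And>i. C2 (f i)" shows "C2 (\<lambda>t. \<chi> i. f i t)"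
  unfolding vec_lambda_eq_sum_axis
  by (rule C2_sum, rule bounded_linear.C2_comp[OF bounded_linear_axis], rule assms)

lemma pd_vec_nth:
  fixes F :: "point \<Rightarrow> 'a::real_normed_vector ^ 'm"
  assumes "C1 F" shows "pd j F t $ i = pd j (\<lambda>t. F t $ i) t"
  by (simp add: bounded_linear.C1_comp(2)[OF bounded_linear_vec_nth assms])

lemma sin_cos_derivative:
  "((\<lambda>x::real. sin (c * x)) has_vector_derivative c * cos (c * x)) (at x)"
  "((\<lambda>x::real. cos (c * x)) has_vector_derivative c * - sin (c * x)) (at x)"
  unfolding has_real_derivative_iff_has_vector_derivative[symmetric]
  by (auto intro!: derivative_eq_intros)

lemma C2_sin_coord: "C2 (\<lambda>t. sin (c * t i))" "pd k (\<lambda>t. sin (c * t i)) t = (if k = i then c * cos (c * t i) else 0)"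
  and C2_cos_coord: "C2 (\<lambda>t. cos (c * t i))"
proof -
  have c: "continuous_on UNIV (\<lambda>x::real. c * cos (c * x))" by (intro continuous_intros)
  have d: "((\<lambda>x::real. c * cos (c * x)) has_vector_derivative c * (c * - sin (c * x))) (at x)"
      "((\<lambda>x::real. c * - sin (c * x)) has_vector_derivative c * - (c * cos (c * x))) (at x)" for x
    by (rule has_vector_derivative_mult_right[OF sin_cos_derivative(2)]
        has_vector_derivative_mult_right[OF has_vector_derivative_minus[OF sin_cos_derivative(1)]])+
  show "C2 (\<lambda>t. sin (c * t i))"
    by (rule C2_coord[OF sin_cos_derivative(1) d(1)]) (intro continuous_intros)
  show "C2 (\<lambda>t. cos (c * t i))"
    by (rule C2_coord[OF sin_cos_derivative(2) d(2)]) (intro continuous_intros)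
  show "pd k (\<lambda>t. sin (c * t i)) t = (if k = i then c * cos (c * t i) else 0)"
    by (simp add: C1_coord(2)[OF sin_cos_derivative(1) c])
qed

text \<open>Coordinate \<open>z\<close> is the phase of the reflection; the next \<open>2 * m\<close> coordinates are the angles
  \<open>theta\<close> and \<open>alpha\<close> of the reflected unit vector, which lies in the first \<open>m + 1\<close> dimensions. The sign
  \<open>eps\<close> selects the vector or its complex conjugate.\<close>

locale polar_coordinates =
  fixes z m :: nat and eps :: real and idx :: "'m::finite \<Rightarrow> nat"
  assumes bij_idx: "bij_betw idx UNIV {..<CARD('m)}" and m_less: "m < CARD('m)" and eps: "\<bar>eps\<bar> = 1"
begin

definition theta where "theta j = Suc z + 2 * j"
definition alpha where "alpha j = Suc (Suc z + 2 * j)"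

lemma coord_distinct [simp]:
  "theta j \<noteq> alpha k" "alpha k \<noteq> theta j" "theta j \<noteq> z" "alpha j \<noteq> z" "z \<noteq> theta j" "z \<noteq> alpha j"
  "theta j = theta k \<longleftrightarrow> j = k" "alpha j = alpha k \<longleftrightarrow> j = k"
  unfolding theta_def alpha_def by presburger+

definition sn :: "nat \<Rightarrow> point \<Rightarrow> real" where "sn j t = sin (pi / 2 * t (theta j))"
definition cn :: "nat \<Rightarrow> point \<Rightarrow> real" where "cn j t = cos (pi / 2 * t (theta j))"

text \<open>Spherical coordinates with angles in a quarter circle. The last radius carries no
  cosine, so that the squares add up to 1.\<close>

definition rad :: "nat \<Rightarrow> point \<Rightarrow> real" where
  "rad p t = (if p \<le> m then (\<Prod>j<p. sn j t) * (if p < m then cn p t else 1) else 0)"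

text \<open>The phases are cumulative: \<open>alpha j\<close> turns all components above
  \<open>j\<close> at once. This is what makes the pairing of phases with angles triangular.\<close>

definition ph :: "nat \<Rightarrow> point \<Rightarrow> complex" where
  "ph p t = (\<Prod>j<p. cis (2 * pi * eps * t (alpha j)))"

definition comp :: "nat \<Rightarrow> point \<Rightarrow> complex" where "comp p t = of_real (rad p t) * ph p t"

definition vec :: "point \<Rightarrow> complex ^ 'm" where "vec t = (\<chi> i. comp (idx i) t)"

lemma sum_idx:
  fixes f :: "nat \<Rightarrow> 'b::comm_monoid_add"
  assumes "\<And>p. p > m \<Longrightarrow> f p = 0" shows "(\<Sum>i\<in>UNIV. f (idx i)) = (\<Sum>p\<le>m. f p)"
proof -
  have "(\<Sum>i\<in>UNIV. f (idx i)) = (\<Sum>p<CARD('m). f p)"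
    by (rule sum.reindex_bij_betw[OF bij_idx])
  also have "\<dots> = (\<Sum>p\<le>m. f p)"
    by (rule sum.mono_neutral_right) (use m_less assms in auto)
  finally show ?thesis .
qed

lemma sn_cn: "sn j t ^ 2 + cn j t ^ 2 = 1"
  by (simp add: sn_def cn_def)

text \<open>The sum telescopes from the top by sin^2 + cos^2 = 1. Up to constants, these tail sums
  are the moment maps of the rotations by the phases \<open>alpha\<close>.\<close>

lemma sum_rad_sq: "q \<le> m \<Longrightarrow> (\<Sum>p=q..m. rad p t ^ 2) = (\<Prod>j<q. sn j t ^ 2)"
proof (induction rule: inc_induct)
  case base then show ?case by (simp add: rad_def prod_power_distrib)
next
  case (step q)
  have "(\<Sum>p=q..m. rad p t ^ 2) = rad q t ^ 2 + (\<Sum>p=Suc q..m. rad p t ^ 2)"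
    using step by (simp add: sum.atLeast_Suc_atMost)
  also have "\<dots> = (\<Prod>j<q. sn j t ^ 2) * (cn q t ^ 2 + sn q t ^ 2)"
    using step by (simp add: rad_def power_mult_distrib prod_power_distrib distrib_left)
  finally show ?case using sn_cn[of q t] by (simp add: add.commute)
qed

lemma cnj_ph: "cnj (ph p t) * ph p t = 1" "ph p t * cnj (ph p t) = 1"
  by (simp_all add: ph_def prod.distrib[symmetric] cis_cnj cis_mult)

lemma C2_sn: "C2 (sn j)" and pd_sn: "pd k (sn j) t = (if k = theta j then pi / 2 * cn j t else 0)"
  and C2_cn: "C2 (cn j)"
  unfolding sn_def[abs_def] cn_def[abs_def] by (rule C2_sin_coord C2_cos_coord)+

lemma C2_rad: "C2 (rad p)"
proof -
  have "rad p = (\<lambda>t. if p \<le> m then (\<Prod>j<p. sn j t) * (if p < m then cn p t else 1) else 0)"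
    by (simp add: rad_def fun_eq_iff)
  then show ?thesis
    by (cases "p \<le> m"; cases "p < m") (simp_all add: C2_mult C2_prod_set C2_sn C2_cn C2_const)
qed

lemma C2_ph: "C2 (ph p)"
  unfolding ph_def[abs_def]
proof (rule C2_prod_set)
  fix j
  have d: "((\<lambda>x. complex_of_real c * \<i> * cis (c * x)) has_vector_derivative
      complex_of_real c * \<i> * (complex_of_real c * \<i> * cis (c * x))) (at x)" for c x
    by (rule has_vector_derivative_mult_right[OF has_vector_derivative_cis_mult])
  show "C2 (\<lambda>t. cis (2 * pi * eps * t (alpha j)))"
    by (rule C2_coord[OF has_vector_derivative_cis_mult d]) (intro continuous_intros)
qed

lemma C2_comp: "C2 (comp p)"
  unfolding comp_def[abs_def]
  by (intro C2_mult C2_ph bounded_linear.C2_comp[OF bounded_linear_of_real C2_rad])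

lemma C2_vec: "C2 vec"
  unfolding vec_def[abs_def] by (rule C2_vec_lambda[OF C2_comp])

lemma rad_indep: "k \<notin> theta ` UNIV \<Longrightarrow> rad p (t(k := s)) = rad p t"
proof -
  assume "k \<notin> theta ` UNIV"
  then have "theta j \<noteq> k" for j by auto
  then have "sn j (t(k := s)) = sn j t" "cn j (t(k := s)) = cn j t" for j
    by (simp_all add: sn_def cn_def)
  then show ?thesis by (simp add: rad_def)
qed

lemma ph_indep: "k \<notin> alpha ` {..<p} \<Longrightarrow> ph p (t(k := s)) = ph p t"
  unfolding ph_def by (rule prod.cong) (auto simp: image_iff)

lemma pd_alpha_ph: "pd (alpha j) (ph p) t = (if j < p then 2 * pi * eps * \<i> * ph p t else 0)"
proof (cases "j < p")
  case True
  let ?c = "2 * pi * eps"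
  let ?C = "\<Prod>i\<in>{..<p} - {j}. cis (?c * t (alpha i))"
  have r: "ph p (t(alpha j := s)) = ?C * cis (?c * s)" for s
  proof -
    have "(\<Prod>i\<in>{..<p} - {j}. cis (?c * (t(alpha j := s)) (alpha i))) = ?C"
      by (rule prod.cong) auto
    then show ?thesis
      unfolding ph_def using True by (simp add: prod.remove[of "{..<p}" j] mult.commute)
  qed
  have "((\<lambda>s. ?C * cis (?c * s)) has_vector_derivative
      ?C * (complex_of_real ?c * \<i> * cis (?c * t (alpha j)))) (at (t (alpha j)))"
    by (rule has_vector_derivative_mult_right[OF has_vector_derivative_cis_mult])
  then have "pd (alpha j) (ph p) t = ?C * (complex_of_real ?c * \<i> * cis (?c * t (alpha j)))"
    by (intro pd_eqI) (simp only: r)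
  also have "\<dots> = complex_of_real ?c * \<i> * ph p t"
    using r[of "t (alpha j)"] by simp
  finally show ?thesis using True by simp
next
  case False
  then have "pd (alpha j) (ph p) = (\<lambda>_. 0)"
    by (intro pd_indep ph_indep) auto
  then show ?thesis using False by simp
qed

lemma pd_comp: "pd k (comp p) t = of_real (rad p t) * pd k (ph p) t + of_real (pd k (rad p) t) * ph p t"
  unfolding comp_def[abs_def]
  by (simp add: C1_mult(2)[OF bounded_linear.C1_comp(1)[OF bounded_linear_of_real C2_C1[OF C2_rad]] C2_C1[OF C2_ph]]
      bounded_linear.C1_comp(2)[OF bounded_linear_of_real C2_C1[OF C2_rad]])

lemma pd_theta_comp: "pd (theta k) (comp p) t = of_real (pd (theta k) (rad p) t) * ph p t"
proof -
  have "pd (theta k) (ph p) = (\<lambda>_. 0)" by (intro pd_indep ph_indep) auto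
  then show ?thesis by (simp add: pd_comp)
qed

lemma pd_alpha_comp: "pd (alpha j) (comp p) t = (if j < p then 2 * pi * eps * \<i> * comp p t else 0)"
proof -
  have "pd (alpha j) (rad p) = (\<lambda>_. 0)" by (intro pd_indep rad_indep) auto
  then show ?thesis by (simp add: pd_comp pd_alpha_ph) (simp add: comp_def)
qed

lemma pd_vec: "pd k vec t $ i = pd k (comp (idx i)) t"
  by (simp add: pd_vec_nth[OF C2_C1[OF C2_vec]]) (simp add: vec_def)

lemma rad_large: "p > m \<Longrightarrow> rad p = (\<lambda>_. 0)"
  by (simp add: rad_def fun_eq_iff)

lemma comp_large: "p > m \<Longrightarrow> comp p = (\<lambda>_. 0)"
  by (simp add: comp_def rad_large fun_eq_iff)

lemma herm_pd_vec: "herm (pd k vec t) (pd l vec t) = (\<Sum>p\<le>m. cnj (pd k (comp p) t) * pd l (comp p) t)"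
  unfolding herm_def pd_vec by (rule sum_idx) (simp add: comp_large)

lemma unit_vec: "herm (vec t) (vec t) = 1"
proof -
  have "herm (vec t) (vec t) = (\<Sum>p\<le>m. cnj (comp p t) * comp p t)"
    unfolding herm_def vec_def by (simp add: sum_idx[of "\<lambda>p. cnj (comp p t) * comp p t"] comp_large)
  also have "\<dots> = (\<Sum>p\<le>m. of_real (rad p t ^ 2))"
  proof (rule sum.cong[OF HOL.refl])
    fix p
    have "cnj (comp p t) * comp p t = of_real (rad p t ^ 2) * (cnj (ph p t) * ph p t)"
      by (simp add: comp_def power2_eq_square)
    then show "cnj (comp p t) * comp p t = of_real (rad p t ^ 2)" by (simp add: cnj_ph)
  qed
  also have "\<dots> = of_real (\<Sum>p=0..m. rad p t ^ 2)" by (simp add: atMost_atLeast0)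
  finally show ?thesis by (simp add: sum_rad_sq)
qed

lemma vec_indep:
  assumes "k \<notin> theta ` {..<m} \<union> alpha ` {..<m}" shows "vec (t(k := s)) = vec t"
proof -
  have "comp p (t(k := s)) = comp p t" for p
  proof (cases "p \<le> m")
    case True
    have "rad p (t(k := s)) = rad p t" using assms True
      unfolding rad_def sn_def cn_def by (auto simp: image_iff intro!: prod.cong)
    moreover have "ph p (t(k := s)) = ph p t" using assms True by (intro ph_indep) auto
    ultimately show ?thesis by (simp add: comp_def)
  qed (simp add: comp_large)
  then show ?thesis by (simp add: vec_def)
qed

sublocale reflection_map vec z
  by standard (auto simp: C2_vec unit_vec intro!: vec_indep)

lemma curv_diff: "curv t k l - curv t l k = herm (pd k vec t) (pd l vec t) - herm (pd l vec t) (pd k vec t)"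
  by (simp add: curv_def)

lemma curv_theta_theta: "curv t (theta k) (theta l) - curv t (theta l) (theta k) = 0"
proof -
  have "cnj (pd (theta k) (comp p) t) * pd (theta l) (comp p) t =
      of_real (pd (theta k) (rad p) t * pd (theta l) (rad p) t) * (cnj (ph p t) * ph p t)" for p k l
    by (simp add: pd_theta_comp)
  then show ?thesis
    unfolding curv_diff herm_pd_vec by (simp add: cnj_ph mult.commute)
qed

lemma curv_alpha_alpha: "curv t (alpha k) (alpha l) - curv t (alpha l) (alpha k) = 0"
  unfolding curv_diff herm_pd_vec sum_subtractf[symmetric]
  by (rule sum.neutral) (simp add: pd_alpha_comp mult_ac)

text \<open>Turning the components above \<open>j\<close> pairs with an angle through the derivative
  of the squared length of those components. That length is a tail sum and collapses to a product of
  squared sines.\<close>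

lemma curv_theta_alpha:
  assumes "j < m"
  shows "curv t (theta k) (alpha j) - curv t (alpha j) (theta k) =
    2 * pi * eps * \<i> * of_real (pd (theta k) (\<lambda>t. \<Prod>i<Suc j. sn i t ^ 2) t)"
proof -
  let ?c = "2 * pi * eps * \<i>"
  have e: "cnj (pd (theta k) (comp p) t) * pd (alpha j) (comp p) t - cnj (pd (alpha j) (comp p) t) * pd (theta k) (comp p) t =
      (if j < p then ?c * of_real (2 * rad p t * pd (theta k) (rad p) t) else 0)" for p
  proof -
    have "cnj (of_real (pd (theta k) (rad p) t) * ph p t) * (?c * comp p t) -
        cnj (?c * comp p t) * (of_real (pd (theta k) (rad p) t) * ph p t) =
      ?c * of_real (2 * rad p t * pd (theta k) (rad p) t) * (cnj (ph p t) * ph p t)"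
      by (simp add: comp_def algebra_simps)
    then show ?thesis by (simp add: pd_theta_comp pd_alpha_comp cnj_ph)
  qed
  have "curv t (theta k) (alpha j) - curv t (alpha j) (theta k) =
      (\<Sum>p\<le>m. if j < p then ?c * of_real (2 * rad p t * pd (theta k) (rad p) t) else 0)"
    unfolding curv_diff herm_pd_vec sum_subtractf[symmetric] e ..
  also have "\<dots> = (\<Sum>p=Suc j..m. ?c * of_real (2 * rad p t * pd (theta k) (rad p) t))"
    by (rule sum.mono_neutral_cong_right) auto
  also have "\<dots> = ?c * of_real (\<Sum>p=Suc j..m. 2 * rad p t * pd (theta k) (rad p) t)"
    by (simp add: sum_distrib_left)
  also have "(\<Sum>p=Suc j..m. 2 * rad p t * pd (theta k) (rad p) t) =
      pd (theta k) (\<lambda>t. \<Sum>p=Suc j..m. rad p t * rad p t) t"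
    by (simp add: C1_sum(2)[OF C1_mult(1)[OF C2_C1[OF C2_rad] C2_C1[OF C2_rad]]]
        C1_mult(2)[OF C2_C1[OF C2_rad] C2_C1[OF C2_rad]] mult_ac)
  also have "(\<lambda>t. \<Sum>p=Suc j..m. rad p t * rad p t) = (\<lambda>t. \<Prod>i<Suc j. sn i t ^ 2)"
    using sum_rad_sq[of "Suc j"] assms by (simp add: fun_eq_iff power2_eq_square)
  finally show ?thesis .
qed

definition density :: "nat \<Rightarrow> point \<Rightarrow> real" where
  "density j t = sn j t * cn j t * (\<Prod>i<j. sn i t ^ 2)"

text \<open>The product involves the angles up to \<open>theta j\<close> only. This yields the zeros
  on one side of the diagonal, and the diagonal entries.\<close>

lemma pd_prod_sn:
  "j < k \<Longrightarrow> pd (theta k) (\<lambda>t. \<Prod>i<Suc j. sn i t ^ 2) t = 0"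
  "pd (theta j) (\<lambda>t. \<Prod>i<Suc j. sn i t ^ 2) t = pi * density j t"
proof -
  have sn: "sn i (t(theta k := s)) = sn i t" if "i \<noteq> k" for i k t s using that by (simp add: sn_def)
  assume "j < k"
  then have "(\<Prod>i<Suc j. sn i (t(theta k := s)) ^ 2) = (\<Prod>i<Suc j. sn i t ^ 2)" for t s
    by (intro prod.cong) (auto simp: sn)
  then show "pd (theta k) (\<lambda>t. \<Prod>i<Suc j. sn i t ^ 2) t = 0"
    using pd_indep[of "\<lambda>t. \<Prod>i<Suc j. sn i t ^ 2" "theta k"] by simp
next
  have sn: "sn i (t(theta j := s)) = sn i t" if "i \<noteq> j" for i t s using that by (simp add: sn_def)
  have P: "(\<Prod>i<j. sn i (t(theta j := s)) ^ 2) = (\<Prod>i<j. sn i t ^ 2)" for t s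
    by (intro prod.cong) (auto simp: sn)
  have c: "C1 (\<lambda>t. \<Prod>i<j. sn i t ^ 2)"
    unfolding power2_eq_square by (intro C1_prod_set(1) C1_mult(1) C2_C1 C2_sn finite_lessThan)
  have 1: "pd (theta j) (\<lambda>t. \<Prod>i<j. sn i t ^ 2) = (\<lambda>_. 0)" by (rule pd_indep[OF P])
  have 2: "pd (theta j) (\<lambda>t. sn j t * sn j t) t = pi * (sn j t * cn j t)"
    by (simp add: C1_mult(2)[OF C2_C1[OF C2_sn] C2_C1[OF C2_sn]] pd_sn)
  have "(\<lambda>t. \<Prod>i<Suc j. sn i t ^ 2) = (\<lambda>t. (\<Prod>i<j. sn i t ^ 2) * (sn j t * sn j t))"
    by (simp add: fun_eq_iff power2_eq_square)
  then show "pd (theta j) (\<lambda>t. \<Prod>i<Suc j. sn i t ^ 2) t = pi * density j t"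
    by (simp add: C1_mult(2)[OF c C1_mult(1)[OF C2_C1[OF C2_sn] C2_C1[OF C2_sn]]] 1 2 density_def)
qed

text \<open>Assembled from the \<open>2 * m + 1\<close> slots for the phase, the value 2 pi i of its
  logarithmic derivative, the sign in front of \<open>weight\<close>, the number of pair
  permutations, the 2^m of the antisymmetrization and 2 pi^2 i for each pair. The sign
  \<open>eps\<close> is missing because it enters with the even power \<open>m\<close>.\<close>

definition const :: complex where
  "const = of_nat (2 * m + 1) * (2 * pi * \<i>) * (- 1) ^ m * of_nat (card (pair_perms (Suc z) m)) / 2 ^ m *
    (2 * pi ^ 2 * \<i>) ^ m"

definition total_density :: "point \<Rightarrow> real" where
  "total_density t = weight t ^ m * (\<Prod>j<m. density j t)"

lemma const_nonzero: "const \<noteq> 0"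
  using card_pair_perms[of "Suc z" m] of_nat_neq_0[of "2 * m", where 'a = complex]
  unfolding const_def by simp

lemma alt_sum_trace_form_reflect:
  assumes "even m"
  shows "alt_sum {z..<z + 2 * m + 1} (\<lambda>\<sigma>. trace_form reflect \<sigma> [z..<z + 2 * m + 1] t) =
    const * of_real (total_density t)"
proof -
  let ?w = "\<lambda>x y. curv t x y - curv t y x"
  have "2 ^ m * alt_sum {Suc z..<Suc z + 2 * m} (pair_prod (curv t) (Suc z) m) =
      alt_sum {Suc z..<Suc z + 2 * m} (pair_prod ?w (Suc z) m)"
    by (rule alt_sum_pair_prod_antisym)
  also have "\<dots> = of_nat (card (pair_perms (Suc z) m)) * pair_prod ?w (Suc z) m id"
  proof (rule alt_sum_pair_prod_triangular)
    fix a b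
    show "?w (Suc z + 2 * a) (Suc z + 2 * b) = 0"
      using curv_theta_theta[of t a b] by (simp add: theta_def)
    show "?w (Suc (Suc z + 2 * a)) (Suc (Suc z + 2 * b)) = 0"
      using curv_alpha_alpha[of t a b] by (simp add: alpha_def)
    assume "a < m" "b < a"
    then show "?w (Suc z + 2 * a) (Suc (Suc z + 2 * b)) = 0"
      using curv_theta_alpha[of b t a] pd_prod_sn(1)[of b a t] by (simp add: theta_def alpha_def)
  qed simp
  also have "pair_prod ?w (Suc z) m id = (\<Prod>j<m. of_real eps * (2 * pi ^ 2 * \<i>) * of_real (density j t))"
    unfolding pair_prod_def
  proof (rule prod.cong[OF HOL.refl])
    fix j assume "j \<in> {..<m}"
    then have "?w (theta j) (alpha j) = of_real eps * (2 * pi ^ 2 * \<i>) * of_real (density j t)"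
      using curv_theta_alpha[of j t j] pd_prod_sn(2)[of j t] by (simp add: power2_eq_square)
    then show "?w (id (Suc z + 2 * j)) (id (Suc (Suc z + 2 * j))) = of_real eps * (2 * pi ^ 2 * \<i>) * of_real (density j t)"
      by (simp add: theta_def alpha_def)
  qed
  also have "\<dots> = of_real (eps ^ m) * ((2 * pi ^ 2 * \<i>) ^ m * of_real (\<Prod>j<m. density j t))"
    by (simp add: prod.distrib power_mult_distrib)
  \<comment> \<open>For odd \<open>m\<close> the two values of \<open>eps\<close> would give
    opposite results.\<close>
  also have "eps ^ m = 1" using eps assms by (metis power_even_abs power_one)
  finally have *: "alt_sum {Suc z..<Suc z + 2 * m} (pair_prod (curv t) (Suc z) m) =
      of_nat (card (pair_perms (Suc z) m)) * ((2 * pi ^ 2 * \<i>) ^ m * of_real (\<Prod>j<m. density j t)) / 2 ^ m"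
    by (simp add: field_simps)
  have "(- complex_of_real (weight t)) ^ m = (- 1) ^ m * of_real (weight t ^ m)"
    by (simp add: power_minus[of "complex_of_real (weight t)"])
  then show ?thesis
    unfolding alt_sum_reflect * by (simp add: const_def total_density_def mult_ac)
qed

lemma weight_nonneg: "weight t \<ge> 0"
  by (simp add: weight_def)

lemma total_density_nonneg:
  assumes "\<And>j. j < m \<Longrightarrow> t (theta j) \<in> {0..1}" shows "total_density t \<ge> 0"
proof -
  have "sn j t \<ge> 0 \<and> cn j t \<ge> 0" if "j < m" for j
  proof -
    have "0 \<le> pi / 2 * t (theta j)" "pi / 2 * t (theta j) \<le> pi / 2"
      using assms[OF that] mult_left_le[of "t (theta j)" "pi / 2"] by auto
    moreover from this have "pi / 2 * t (theta j) \<le> pi" "- (pi / 2) \<le> pi / 2 * t (theta j)"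
      using pi_ge_zero by linarith+
    ultimately show ?thesis unfolding sn_def cn_def by (intro conjI sin_ge_zero cos_ge_zero)
  qed
  then show ?thesis
    unfolding total_density_def density_def
    by (intro mult_nonneg_nonneg zero_le_power weight_nonneg prod_nonneg ballI) auto
qed

lemma total_density_pos:
  assumes "\<And>j. t j = 1 / 2" shows "total_density t > 0"
proof -
  have "sn j t > 0" "cn j t > 0" for j
    unfolding sn_def cn_def assms by (auto intro!: sin_gt_zero cos_gt_zero)
  moreover have "weight t > 0" by (simp add: weight_def assms)
  ultimately show ?thesis
    unfolding total_density_def density_def
    by (intro mult_pos_pos zero_less_power prod_pos ballI) auto
qed

lemma continuous_total_density: "continuous_on UNIV total_density"
proof -
  have z: "continuous_on UNIV (\<lambda>t::point. t z)" by (rule continuous_on_fun_coord)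
  have "continuous_on UNIV (\<lambda>t. weight t)"
    unfolding weight_def by (intro continuous_intros z)
  moreover have "continuous_on UNIV (sn j)" "continuous_on UNIV (cn j)" for j
    by (rule C2_continuous[OF C2_sn] C2_continuous[OF C2_cn])+
  ultimately show ?thesis
    unfolding total_density_def[abs_def] density_def by (intro continuous_intros)
qed

lemma reflect_indep:
  assumes "k \<notin> {z..<z + 2 * m + 1}" shows "reflect (t(k := s)) = reflect t"
proof -
  have "vec (t(k := s)) = vec t"
    using assms by (intro vec_indep) (auto simp: theta_def alpha_def)
  moreover have "k \<noteq> z" using assms by auto
  ultimately show ?thesis by (simp add: reflect_def proj_def phase_def)
qed

lemma reflect_periodic:
  assumes "k = z \<or> k \<in> alpha ` UNIV" shows "reflect (t(k := 1)) = reflect (t(k := 0))"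
  using assms
proof
  assume k: "k = z"
  have "vec (t(k := s)) = vec t" for s unfolding k by (intro vec_indep) auto
  then show ?thesis by (simp add: reflect_def proj_def phase_def k)
next
  assume "k \<in> alpha ` UNIV"
  then obtain j where k: "k = alpha j" by blast
  have c: "cis (2 * pi * eps) = 1" using eps by (auto simp: abs_if complex_eq_iff split: if_splits)
  have "rad p (t(k := s)) = rad p t" for p s unfolding k by (intro rad_indep) auto
  moreover have "ph p (t(k := 1)) = ph p (t(k := 0))" for p
    unfolding ph_def k by (rule prod.cong) (auto simp: c)
  ultimately have "vec (t(k := 1)) = vec (t(k := 0))" by (simp add: vec_def comp_def)
  then show ?thesis by (simp add: reflect_def proj_def phase_def k)
qed

lemma pd_reflect_eq:
  assumes "k \<noteq> z" "l \<noteq> z" "pd k vec t = pd l vec t" shows "pd k reflect t = pd l reflect t"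
  using assms by (simp add: pd_reflect pd_phase(3) pd_proj)

text \<open>The vector moves along its own complex line by a phase, which the projection onto that
  line does not see.\<close>

lemma pd_reflect_imaginary:
  assumes "k \<noteq> z" "pd k vec t = (\<chi> i. (of_real c * \<i>) * vec t $ i)" shows "pd k reflect t = 0"
proof -
  have "pd k proj t = 0"
    by (simp add: pd_proj assms(2) outer_def vec_eq_iff)
  then show ?thesis using assms(1)
    by (simp add: pd_reflect pd_phase(3)) (simp add: cscale_def vec_eq_iff)
qed

text \<open>The phase \<open>alpha j\<close> turns the components above \<open>j\<close>. If
  \<open>sn j\<close> vanishes, these are zero. If component 0 vanishes, \<open>alpha 0\<close> is a
  common phase of the whole vector. If component \<open>j\<close> vanishes,
  \<open>alpha (j - 1)\<close> and \<open>alpha j\<close> turn the same nonzero components.\<close>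

lemma reflect_degenerate:
  "t (theta j) = 0 \<Longrightarrow> pd (alpha j) reflect t = 0"
  "t (theta 0) = 1 \<Longrightarrow> 0 < m \<Longrightarrow> pd (alpha 0) reflect t = 0"
  "t (theta j) = 1 \<Longrightarrow> 0 < j \<Longrightarrow> j < m \<Longrightarrow> pd (alpha (j - 1)) reflect t = pd (alpha j) reflect t"
proof -
  assume "t (theta j) = 0"
  then have "sn j t = 0" by (simp add: sn_def)
  then have "rad p t = 0" if "j < p" for p using that by (auto simp: rad_def)
  then have "pd (alpha j) vec t = (\<chi> i. (of_real 0 * \<i>) * vec t $ i)"
    by (simp add: vec_eq_iff pd_vec pd_alpha_comp comp_def)
  then show "pd (alpha j) reflect t = 0" by (intro pd_reflect_imaginary[of _ t 0]) auto
next
  assume "t (theta 0) = 1" "0 < m"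
  then have "cn 0 t = 0" by (simp add: cn_def)
  then have "rad 0 t = 0" using \<open>0 < m\<close> by (simp add: rad_def)
  then have "comp 0 t = 0" by (simp add: comp_def)
  then have "pd (alpha 0) vec t = (\<chi> i. (of_real (2 * pi * eps) * \<i>) * vec t $ i)"
    by (auto simp: vec_eq_iff pd_vec pd_alpha_comp vec_def)
  then show "pd (alpha 0) reflect t = 0"
    by (intro pd_reflect_imaginary[of _ t "2 * pi * eps"]) auto
next
  assume t: "t (theta j) = 1" and j: "0 < j" "j < m"
  then have "cn j t = 0" by (simp add: cn_def)
  then have "rad j t = 0" using j by (simp add: rad_def)
  then have c: "comp j t = 0" by (simp add: comp_def)
  have "pd (alpha (j - 1)) (comp p) t = pd (alpha j) (comp p) t" for p
  proof (cases "p = j")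
    case True then show ?thesis using j by (simp add: pd_alpha_comp c)
  next
    case False
    then have "j - 1 < p \<longleftrightarrow> j < p" using j by linarith
    then show ?thesis by (simp add: pd_alpha_comp)
  qed
  then have "pd (alpha (j - 1)) vec t = pd (alpha j) vec t" by (simp add: vec_eq_iff pd_vec)
  then show "pd (alpha (j - 1)) reflect t = pd (alpha j) reflect t"
    by (intro pd_reflect_eq) simp_all
qed

end

section \<open>Rotation into blocks\<close>

lemma sum_UNIV_prod: "(\<Sum>p\<in>(UNIV :: ('a::finite \<times> 'b::finite) set). f p) = (\<Sum>a\<in>UNIV. \<Sum>b\<in>UNIV. f (a, b))"
  unfolding UNIV_Times_UNIV[symmetric] sum.cartesian_product by simp

definition block_diag :: "('b \<Rightarrow> complex ^ 'm ^ 'm) \<Rightarrow> complex ^ ('b::finite \<times> 'm::finite) ^ ('b \<times> 'm)" where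
  "block_diag F = (\<chi> p q. if fst p = fst q then F (fst p) $ snd p $ snd q else 0)"

lemma block_diag_mult: "block_diag F ** block_diag G = block_diag (\<lambda>b. F b ** G b)"
proof -
  have "(block_diag F ** block_diag G) $ p $ q = block_diag (\<lambda>b. F b ** G b) $ p $ q" for p q
  proof -
    have "(block_diag F ** block_diag G) $ p $ q = (\<Sum>a\<in>UNIV. if fst p = a then
        (\<Sum>k\<in>UNIV. F (fst p) $ snd p $ k * (if a = fst q then G a $ k $ snd q else 0)) else 0)"
    proof -
      have "(\<Sum>b\<in>UNIV. (if fst p = a then F (fst p) $ snd p $ b else 0) * (if a = fst q then G a $ b $ snd q else 0)) =
          (if fst p = a then (\<Sum>k\<in>UNIV. F (fst p) $ snd p $ k * (if a = fst q then G a $ k $ snd q else 0)) else 0)" for a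
        by simp
      then show ?thesis
        unfolding matrix_matrix_mult_def block_diag_def by (simp only: vec_lambda_beta sum_UNIV_prod fst_conv snd_conv)
    qed
    then show ?thesis by (simp add: block_diag_def matrix_matrix_mult_def)
  qed
  then show ?thesis by (simp add: vec_eq_iff)
qed

lemma block_diag_1: "block_diag (\<lambda>_. mat 1) = mat 1"
  by (simp add: block_diag_def mat_def vec_eq_iff prod_eq_iff)

lemma trace_block_diag: "trace (block_diag F) = (\<Sum>b\<in>UNIV. trace (F b))"
  by (simp add: trace_def block_diag_def sum_UNIV_prod)

lemma mprod_block_diag: "mprod (map (\<lambda>x. block_diag (A x)) xs) = block_diag (\<lambda>b. mprod (map (\<lambda>x. A x b) xs))"
  by (induction xs) (simp_all add: block_diag_1 block_diag_mult)

lemma C2_matrix_entries: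
  fixes f :: "'m::finite \<Rightarrow> 'k::finite \<Rightarrow> point \<Rightarrow> complex"
  assumes "\<And>i j. C2 (f i j)"
  shows "C2 (\<lambda>t. \<chi> i j. f i j t)" "pd k (\<lambda>t. \<chi> i j. f i j t) t = (\<chi> i j. pd k (f i j) t)"
proof -
  have 1: "C2 (\<lambda>t. \<chi> j. f i j t)" for i by (rule C2_vec_lambda[OF assms])
  show 2: "C2 (\<lambda>t. \<chi> i j. f i j t)" by (rule C2_vec_lambda[OF 1])
  show "pd k (\<lambda>t. \<chi> i j. f i j t) t = (\<chi> i j. pd k (f i j) t)"
    by (simp add: vec_eq_iff pd_vec_nth[OF C2_C1[OF 2]] pd_vec_nth[OF C2_C1[OF 1]])
qed

lemma C2_entry:
  fixes F :: "point \<Rightarrow> complex ^ 'k::finite ^ 'm::finite"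
  assumes "C2 F" shows "C2 (\<lambda>t. F t $ i $ j)" "pd k (\<lambda>t. F t $ i $ j) t = pd k F t $ i $ j"
proof -
  have 1: "C2 (\<lambda>t. F t $ i)" by (rule bounded_linear.C2_comp[OF bounded_linear_vec_nth assms])
  show "C2 (\<lambda>t. F t $ i $ j)" by (rule bounded_linear.C2_comp[OF bounded_linear_vec_nth 1])
  show "pd k (\<lambda>t. F t $ i $ j) t = pd k F t $ i $ j"
    by (simp add: pd_vec_nth[OF C2_C1[OF 1]] pd_vec_nth[OF C2_C1[OF assms]])
qed

lemma GL_map_block_diag:
  assumes "\<And>b. GL_map (F b)"
  shows "GL_map (\<lambda>t. block_diag (\<lambda>b. F b t))"
    "log_pd (\<lambda>t. block_diag (\<lambda>b. F b t)) k t = block_diag (\<lambda>b. log_pd (F b) k t)"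
proof -
  have F: "C2 (F b)" "invertible (F b t)" for b t using assms by (simp_all add: GL_map_def)
  have e: "C2 (\<lambda>t. if fst p = fst q then F (fst p) t $ snd p $ snd q else 0)" for p q
    by (cases "fst p = fst q") (simp_all add: C2_entry[OF F(1)] C2_const)
  have inv: "block_diag (\<lambda>b. F b t) ** block_diag (\<lambda>b. matrix_inv (F b t)) = mat 1" for t
    by (simp add: block_diag_mult matrix_inv_invertible[OF F(2)] block_diag_1)
  have "C2 (\<lambda>t. block_diag (\<lambda>b. F b t))"
    unfolding block_diag_def by (rule C2_matrix_entries(1)[OF e])
  then show "GL_map (\<lambda>t. block_diag (\<lambda>b. F b t))"
    by (simp add: GL_map_def matrix_inv_eqI(1)[OF inv])
  have "pd k (\<lambda>t. block_diag (\<lambda>b. F b t)) t = block_diag (\<lambda>b. pd k (F b) t)"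
    unfolding block_diag_def C2_matrix_entries(2)[OF e]
    by (simp add: vec_eq_iff C2_entry(2)[OF F(1)])
  then show "log_pd (\<lambda>t. block_diag (\<lambda>b. F b t)) k t = block_diag (\<lambda>b. log_pd (F b) k t)"
    by (simp add: log_pd_def matrix_inv_eqI(2)[OF inv] block_diag_mult)
qed

text \<open>Additivity over direct sums is what the rotation into blocks is made for.\<close>

lemma trace_form_block_diag:
  assumes "\<And>b. GL_map (F b)"
  shows "trace_form (\<lambda>t. block_diag (\<lambda>b. F b t)) \<kappa> xs t = (\<Sum>b\<in>UNIV. trace_form (F b) \<kappa> xs t)"
  by (simp add: trace_form_def GL_map_block_diag(2)[OF assms] mprod_block_diag trace_block_diag)

lemma GL_map_mprod:
  fixes G :: "'b \<Rightarrow> point \<Rightarrow> complex ^ 'm ^ 'm"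
  assumes "\<And>b. b \<in> set bs \<Longrightarrow> GL_map (G b)"
  shows "GL_map (\<lambda>t. mprod (map (\<lambda>b. G b t) bs))"
  using assms
proof (induction bs)
  case Nil then show ?case using matrix_inv_eqI(1)[of "mat 1 :: complex ^ 'm ^ 'm" "mat 1"]
    by (simp add: GL_map_def C2_const)
next
  case (Cons b bs)
  then show ?case by (simp add: GL_map_def C2_matrix_mult invertible_mult)
qed

lemma proportional_at_mprod:
  assumes "\<And>b. b \<in> set bs \<Longrightarrow> GL_map (G b)" "\<And>b. b \<in> set bs \<Longrightarrow> proportional_at k l u t (G b)"
  shows "proportional_at k l u t (\<lambda>t. mprod (map (\<lambda>b. G b t) bs))"
  using assms
proof (induction bs)
  case Nil then show ?case by (simp add: proportional_at_const)
next
  case (Cons b bs)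
  have "C1 (G b)" "C1 (\<lambda>t. mprod (map (\<lambda>b. G b t) bs))"
    using Cons.prems GL_map_mprod[of bs G] by (auto simp: GL_map_def C2_C1)
  from bounded_bilinear.proportional_at_prod[OF bounded_bilinear_matrix_mult this] Cons
  show ?case by simp
qed

text \<open>The block at position \<open>b\<close> is rotated from the position \<open>b0\<close> while the time \<open>t N\<close> runs from
  0 to 1. This turns a product into a direct sum.\<close>

definition rot_coeff :: "nat \<Rightarrow> 'b \<Rightarrow> 'b \<Rightarrow> 'b \<Rightarrow> point \<Rightarrow> real" where
  "rot_coeff N b0 b a t = (if b = b0 then (if a = b0 then 1 else 0)
     else if a = b0 then cos (pi / 2 * t N) else if a = b then sin (pi / 2 * t N) else 0)"

text \<open>With the unit vector w whose entries are \<open>rot_coeff N b0 b\<close>, this matrix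
  acts as \<open>F t\<close> on w \<otimes> C^m and as the identity on the orthogonal
  complement.\<close>

definition rot_block :: "nat \<Rightarrow> 'b \<Rightarrow> 'b \<Rightarrow> (point \<Rightarrow> complex ^ 'm ^ 'm) \<Rightarrow> point \<Rightarrow>
    complex ^ ('b::finite \<times> 'm::finite) ^ ('b \<times> 'm)" where
  "rot_block N b0 b F t = mat 1 + (\<chi> p q. of_real (rot_coeff N b0 b (fst p) t * rot_coeff N b0 b (fst q) t) *
     (F t - mat 1) $ snd p $ snd q)"

lemma C2_rot_coeff: "C2 (rot_coeff N b0 b a)"
  and pd_rot_coeff: "k \<noteq> N \<Longrightarrow> pd k (rot_coeff N b0 b a) t = 0"
proof -
  have "rot_coeff N b0 b a = (if b = b0 then (if a = b0 then (\<lambda>_. 1) else (\<lambda>_. 0))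
     else if a = b0 then (\<lambda>t. cos (pi / 2 * t N)) else if a = b then (\<lambda>t. sin (pi / 2 * t N)) else (\<lambda>_. 0))"
    by (simp add: rot_coeff_def fun_eq_iff)
  then show "C2 (rot_coeff N b0 b a)"
    by (simp only: C2_const C2_cos_coord C2_sin_coord split: if_split) simp
  show "k \<noteq> N \<Longrightarrow> pd k (rot_coeff N b0 b a) t = 0"
    using pd_indep[of "rot_coeff N b0 b a" k] by (simp add: rot_coeff_def)
qed

lemma sum_rot_coeff_sq: "(\<Sum>a\<in>(UNIV :: 'b::finite set). rot_coeff N b0 b a t * rot_coeff N b0 b a t) = 1"
proof (cases "b = b0")
  case True
  then have "rot_coeff N b0 b a t * rot_coeff N b0 b a t = (if a = b0 then 1 else 0)" for a
    by (simp add: rot_coeff_def)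
  then show ?thesis by simp
next
  case False
  have "(\<Sum>a\<in>UNIV. rot_coeff N b0 b a t * rot_coeff N b0 b a t) =
      (\<Sum>a\<in>{b0, b}. rot_coeff N b0 b a t * rot_coeff N b0 b a t)"
    by (rule sum.mono_neutral_right) (use False in \<open>auto simp: rot_coeff_def\<close>)
  also have "\<dots> = cos (pi / 2 * t N) ^ 2 + sin (pi / 2 * t N) ^ 2"
    using False by (simp add: rot_coeff_def power2_eq_square)
  finally show ?thesis by simp
qed

text \<open>\<open>K A\<close> is the tensor product of the projection onto the unit vector
  \<open>w\<close> with \<open>A\<close>, so \<open>K\<close> is multiplicative.\<close>

lemma rank_one_block_mult:
  fixes w :: "'b::finite \<Rightarrow> real" and A B :: "complex ^ 'm ^ 'm"
  assumes "(\<Sum>a\<in>UNIV. w a * w a) = 1"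
  defines "K \<equiv> \<lambda>A :: complex ^ 'm ^ 'm. (\<chi> p q. of_real (w (fst p) * w (fst q)) * A $ snd p $ snd q)"
  shows "(mat 1 + K A) ** (mat 1 + K B) = mat 1 + K (A + B + A ** B)"
proof -
  interpret mm: bounded_bilinear "(**) :: complex ^ ('b \<times> 'm) ^ ('b \<times> 'm) \<Rightarrow> complex ^ ('b \<times> 'm) ^ ('b \<times> 'm) \<Rightarrow> complex ^ ('b \<times> 'm) ^ ('b \<times> 'm)"
    by (rule bounded_bilinear_matrix_mult)
  have "(K A ** K B) $ p $ q = K (A ** B) $ p $ q" for p q
  proof -
    have "(K A ** K B) $ p $ q = (\<Sum>a\<in>UNIV. \<Sum>k\<in>UNIV. of_real (w a * w a) *
        (of_real (w (fst p) * w (fst q)) * (A $ snd p $ k * B $ k $ snd q)))"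
      unfolding matrix_matrix_mult_def K_def by (simp add: sum_UNIV_prod mult_ac)
    also have "\<dots> = of_real (\<Sum>a\<in>UNIV. w a * w a) *
        (\<Sum>k\<in>UNIV. of_real (w (fst p) * w (fst q)) * (A $ snd p $ k * B $ k $ snd q))"
      by (simp only: of_real_sum sum_product)
    finally show ?thesis by (simp add: assms(1) K_def matrix_matrix_mult_def sum_distrib_left)
  qed
  then have "K A ** K B = K (A ** B)" by (simp add: vec_eq_iff)
  moreover have "K (A + B + C) = K A + K B + K C" for C
    by (simp add: K_def vec_eq_iff algebra_simps)
  moreover have "(mat 1 + K A) ** (mat 1 + K B) = mat 1 + (K A + K B + K A ** K B)"
    by (simp add: mm.add_left mm.add_right add_ac)
  ultimately show ?thesis by (simp only:)
qed

lemma GL_map_rot_block: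
  assumes "GL_map F" shows "GL_map (rot_block N b0 b F)"
proof -
  have F: "C2 F" "invertible (F t)" for t using assms by (auto simp: GL_map_def)
  interpret mm: bounded_bilinear "(**) :: complex ^ 'm ^ 'm \<Rightarrow> complex ^ 'm ^ 'm \<Rightarrow> complex ^ 'm ^ 'm"
    by (rule bounded_bilinear_matrix_mult)
  have e: "C2 (\<lambda>t. of_real (rot_coeff N b0 b (fst p) t * rot_coeff N b0 b (fst q) t) * (F t - mat 1) $ snd p $ snd q)" for p q
    by (intro C2_mult bounded_linear.C2_comp[OF bounded_linear_of_real] C2_rot_coeff C2_entry C2_diff F C2_const)
  have "C2 (rot_block N b0 b F)"
    unfolding rot_block_def[abs_def] by (rule C2_add[OF C2_const C2_matrix_entries(1)[OF e]])
  moreover have "invertible (rot_block N b0 b F t)" for t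
  proof (rule matrix_inv_eqI(1))
    have "(F t - mat 1) + (matrix_inv (F t) - mat 1) + (F t - mat 1) ** (matrix_inv (F t) - mat 1) = 0"
      by (simp add: mm.diff_left mm.diff_right matrix_inv_invertible[OF F(2)])
    then show "rot_block N b0 b F t ** rot_block N b0 b (\<lambda>t. matrix_inv (F t)) t = mat 1"
      unfolding rot_block_def rank_one_block_mult[OF sum_rot_coeff_sq] by (simp add: vec_eq_iff)
  qed
  ultimately show ?thesis by (simp add: GL_map_def)
qed

text \<open>The rotation depends on the time alone, so relations between derivatives in other
  directions are kept.\<close>

lemma proportional_at_rot_block:
  assumes F: "GL_map F" and p: "proportional_at k l u t F" and kl: "k \<noteq> N" "l \<noteq> N"
  shows "proportional_at k l u t (rot_block N b0 b F)"
proof -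
  have c: "C2 F" using F by (simp add: GL_map_def)
  let ?q = "\<lambda>p q t. of_real (rot_coeff N b0 b (fst p) t * rot_coeff N b0 b (fst q) t) :: complex"
  have Fm: "C2 (\<lambda>t. F t - mat 1)" by (rule C2_diff[OF c C2_const])
  have q: "C2 (?q p q)" for p q
    by (intro C2_mult bounded_linear.C2_comp[OF bounded_linear_of_real] C2_rot_coeff)
  have qi: "pd j (?q p q) t = 0" if "j \<noteq> N" for j p q
    using that pd_indep[of "?q p q" j] by (simp add: rot_coeff_def)
  note e = C2_mult[OF q C2_entry(1)[OF Fm]]
  have d: "pd j (rot_block N b0 b F) t = (\<chi> p q. ?q p q t * pd j F t $ snd p $ snd q)" if "j \<noteq> N" for j
  proof -
    have "pd j (rot_block N b0 b F) t = (\<chi> p q. pd j (\<lambda>t. ?q p q t * (F t - mat 1) $ snd p $ snd q) t)"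
      unfolding rot_block_def[abs_def] C1_add(2)[OF C1_const C2_C1[OF C2_matrix_entries(1)[OF e]]]
        C2_matrix_entries(2)[OF e] pd_const by (rule add_0_left)
    also have "\<dots> = (\<chi> p q. ?q p q t * pd j (\<lambda>t. F t - mat 1) t $ snd p $ snd q)"
      unfolding C1_mult(2)[OF C2_C1[OF q] C2_C1[OF C2_entry(1)[OF Fm]]] qi[OF that] C2_entry(2)[OF Fm] by simp
    finally show ?thesis unfolding C1_diff(2)[OF C2_C1[OF c] C1_const] by simp
  qed
  show ?thesis
    using p unfolding proportional_at_def d[OF kl(1)] d[OF kl(2)] by (simp add: vec_eq_iff)
qed

lemma rot_block_ends:
  assumes "\<And>t s. F (t(N := s)) = F t"
  shows "rot_block N b0 b F (t(N := 0)) = block_diag (\<lambda>a. if a = b0 then F t else mat 1)"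
    "rot_block N b0 b F (t(N := 1)) = block_diag (\<lambda>a. if a = b then F t else mat 1)"
  unfolding rot_block_def block_diag_def assms
  by (auto simp: vec_eq_iff rot_coeff_def mat_def prod_eq_iff)

lemma mprod_block_diag_distinct:
  "distinct bs \<Longrightarrow> mprod (map (\<lambda>b. block_diag (\<lambda>a. if a = b then A b else mat 1)) bs) =
    block_diag (\<lambda>a. if a \<in> set bs then A a else mat 1)"
proof (induction bs)
  case (Cons b bs)
  then have "mprod (map (\<lambda>b. block_diag (\<lambda>a. if a = b then A b else mat 1)) (b # bs)) =
    block_diag (\<lambda>a. (if a = b then A b else mat 1) ** (if a \<in> set bs then A a else mat 1))"
    by (simp add: block_diag_mult)
  also have "(\<lambda>a. (if a = b then A b else mat 1) ** (if a \<in> set bs then A a else mat 1)) =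
      (\<lambda>a. if a \<in> set (b # bs) then A a else mat 1)"
    using Cons.prems by (auto simp: fun_eq_iff)
  finally show ?case .
qed (simp add: block_diag_1)

lemma mprod_block_diag_same:
  "mprod (map (\<lambda>b. block_diag (\<lambda>a. if a = b0 then A b else mat 1)) bs) =
    block_diag (\<lambda>a. if a = b0 then mprod (map A bs) else mat 1)"
proof -
  have one: "mprod (map (\<lambda>x. mat 1) bs) = mat 1" by (induction bs) simp_all
  have "mprod (map (\<lambda>b. block_diag (\<lambda>a. if a = b0 then A b else mat 1)) bs) =
      block_diag (\<lambda>a. mprod (map (\<lambda>b. if a = b0 then A b else mat 1) bs))"
    by (rule mprod_block_diag)
  also have "(\<lambda>a. mprod (map (\<lambda>b. if a = b0 then A b else mat 1) bs)) =
      (\<lambda>a. if a = b0 then mprod (map A bs) else mat 1)"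
    using one by (auto simp: fun_eq_iff)
  finally show ?thesis .
qed

lemma log_pd_slice:
  assumes "k \<noteq> N" shows "log_pd g k (t(N := s)) = log_pd (\<lambda>t. g (t(N := s))) k t"
  using assms by (simp add: log_pd_def pd_def fun_upd_twist)

lemma trace_form_const_block:
  assumes "xs \<noteq> []" shows "trace_form (\<lambda>_. c) \<kappa> xs t = 0"
proof -
  interpret mm: bounded_bilinear "(**) :: complex ^ 'm ^ 'm \<Rightarrow> complex ^ 'm ^ 'm \<Rightarrow> complex ^ 'm ^ 'm"
    by (rule bounded_bilinear_matrix_mult)
  show ?thesis using assms
    by (cases xs) (simp_all add: trace_form_def log_pd_def mm.zero_left mm.zero_right trace_0[unfolded mat_0] trace_def)
qed

context form_blocks
begin

text \<open>The slots of the wedge take only directions below \<open>N\<close>, and such derivatives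
  commute with freezing the time.\<close>

lemma wedge_slice: "wedge g (t(N := s)) = wedge (\<lambda>i t. g i (t(N := s))) t"
  unfolding wedge_def
proof (rule alt_sum_cong)
  fix \<sigma> assume \<sigma>: "\<sigma> permutes {..<N}"
  have *: "\<sigma> x \<noteq> N" if "i \<in> {..<n}" "x \<in> set (blk i)" for i x
  proof -
    have "\<sigma> x \<in> {..<N}" using permutes_in_image[OF \<sigma>, of x] blk_less[of i x] that by simp
    then show ?thesis by simp
  qed
  show "form_prod g \<sigma> (t(N := s)) = form_prod (\<lambda>i t. g i (t(N := s))) \<sigma> t"
    unfolding form_prod_def trace_form_def
    by (intro prod.cong refl arg_cong[where f = trace] arg_cong[where f = mprod] map_cong log_pd_slice *)
qed

lemma blk_nonempty: "i < n \<Longrightarrow> blk i \<noteq> []"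
  using odd_blk by fastforce

text \<open>Primitivity of the classes tr ((g^{-1} dg)^d) in integrated form: for a product of maps
  the form may be replaced by the sum of the forms of the factors, since the mixed terms disappear
  under the homotopy to a direct sum.\<close>

theorem box_integral_wedge_mprod:
  fixes F :: "'b::finite \<Rightarrow> point \<Rightarrow> complex ^ 'm ^ 'm"
  assumes F: "\<And>b. GL_map (F b)" and FN: "\<And>b t s. F b (t(N := s)) = F b t"
    and bs: "distinct bs" "set bs = UNIV"
    and bdry: "\<And>j. j < N \<Longrightarrow> (\<forall>b t. F b (t(j := 1)) = F b (t(j := 0))) \<or>
      (\<forall>t. t j \<in> {0, 1} \<longrightarrow> (\<exists>k l u. k \<noteq> l \<and> k \<noteq> j \<and> l \<noteq> j \<and> k < N \<and> l < N \<and>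
        (\<forall>b. proportional_at k l u t (F b))))"
  shows "box_integral [0..<N] (wedge (\<lambda>_ t. mprod (map (\<lambda>b. F b t) bs))) t =
    box_integral [0..<N] (\<lambda>t. alt_sum {..<N} (\<lambda>\<sigma>. \<Prod>i<n. \<Sum>b\<in>UNIV. trace_form (F b) \<sigma> (blk i) t)) t"
proof -
  obtain b0 :: 'b where True by blast
  define G where "G t = mprod (map (\<lambda>b. rot_block N b0 b (F b) t) bs)" for t
  have R: "GL_map (rot_block N b0 b (F b))" for b by (rule GL_map_rot_block[OF F])
  have G: "GL_map G" unfolding G_def[abs_def] by (rule GL_map_mprod[OF R])
  have hom: "box_integral [0..<N] (\<lambda>t. wedge (\<lambda>_. G) (t(N := 1))) t = box_integral [0..<N] (\<lambda>t. wedge (\<lambda>_. G) (t(N := 0))) t"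
  proof (rule box_integral_wedge_homotopy[OF G])
    fix j assume j: "j < N"
    from bdry[OF j] show "(\<forall>i<n. \<forall>t. G (t(j := 1)) = G (t(j := 0))) \<or>
      (\<forall>t. t j \<in> {0, 1} \<longrightarrow> (\<exists>k l u. k \<noteq> l \<and> k \<noteq> j \<and> l \<noteq> j \<and> k \<le> N \<and> l \<le> N \<and>
        (\<forall>i<n. proportional_at k l u t G)))"
    proof
      assume per: "\<forall>b t. F b (t(j := 1)) = F b (t(j := 0))"
      have "rot_block N b0 b (F b) (t(j := 1)) = rot_block N b0 b (F b) (t(j := 0))" for b t
      proof -
        have "rot_coeff N b0 b a (t(j := s)) = rot_coeff N b0 b a t" for a s
          using j by (simp add: rot_coeff_def)
        then show ?thesis unfolding rot_block_def per[rule_format] by simp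
      qed
      then show ?thesis unfolding G_def by simp
    next
      assume deg: "\<forall>t. t j \<in> {0, 1} \<longrightarrow> (\<exists>k l u. k \<noteq> l \<and> k \<noteq> j \<and> l \<noteq> j \<and> k < N \<and> l < N \<and>
        (\<forall>b. proportional_at k l u t (F b)))"
      have "\<exists>k l u. k \<noteq> l \<and> k \<noteq> j \<and> l \<noteq> j \<and> k \<le> N \<and> l \<le> N \<and>
        (\<forall>i<n. proportional_at k l u t G)" if t: "t j \<in> {0, 1}" for t
      proof -
        from deg have "t j \<in> {0, 1} \<longrightarrow> (\<exists>k l u. k \<noteq> l \<and> k \<noteq> j \<and> l \<noteq> j \<and> k < N \<and> l < N \<and>
          (\<forall>b. proportional_at k l u t (F b)))" by (rule spec)
        from mp[OF this t] obtain k l u where kl: "k \<noteq> l" "k \<noteq> j" "l \<noteq> j" "k < N" "l < N"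
          "\<forall>b. proportional_at k l u t (F b)" by (elim exE conjE)
        have "proportional_at k l u t G"
          unfolding G_def[abs_def]
          by (rule proportional_at_mprod[OF R], rule proportional_at_rot_block[OF F])
            (use kl in auto)
        then show ?thesis using kl less_imp_le by blast
      qed
      then show ?thesis by blast
    qed
  qed
  have one: "GL_map (\<lambda>t::point. mat 1 :: complex ^ 'm ^ 'm)"
    using GL_map_mprod[of "[]"] by simp
  have P: "GL_map (\<lambda>t. mprod (map (\<lambda>b. F b t) bs))" by (rule GL_map_mprod[OF F])
  have e0: "rot_block N b0 b (F b) (t(N := 0)) = block_diag (\<lambda>a. if a = b0 then F b t else mat 1)" for b t
    by (rule rot_block_ends(1)[OF FN])
  have e1: "rot_block N b0 b (F b) (t(N := 1)) = block_diag (\<lambda>a. if a = b then F b t else mat 1)" for b t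
    by (rule rot_block_ends(2)[OF FN])
  have G0: "(\<lambda>t. G (t(N := 0))) = (\<lambda>t. block_diag (\<lambda>a. (if a = b0 then (\<lambda>t. mprod (map (\<lambda>b. F b t) bs)) else (\<lambda>_. mat 1)) t))"
    unfolding G_def e0 mprod_block_diag_same
    by (rule ext, rule arg_cong[where f = block_diag]) (simp add: fun_eq_iff)
  have G1: "(\<lambda>t. G (t(N := 1))) = (\<lambda>t. block_diag (\<lambda>a. F a t))"
    unfolding G_def e1 mprod_block_diag_distinct[OF bs(1)] by (simp add: bs(2))
  have c: "GL_map ((if a = b0 then (\<lambda>t. mprod (map (\<lambda>b. F b t) bs)) else (\<lambda>_. mat 1)))" for a
    using P one by simp
  have W0: "wedge (\<lambda>_. G) (t(N := 0)) = wedge (\<lambda>_ t. mprod (map (\<lambda>b. F b t) bs)) t" for t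
    unfolding wedge_slice G0 unfolding wedge_def form_prod_def
  proof (intro alt_sum_cong prod.cong refl)
    fix \<sigma> i assume i: "i \<in> {..<n}"
    have "(\<Sum>b\<in>UNIV. trace_form (if b = b0 then (\<lambda>t. mprod (map (\<lambda>b. F b t) bs)) else (\<lambda>_. mat 1)) \<sigma> (blk i) t) =
        (\<Sum>b\<in>UNIV. if b = b0 then trace_form (\<lambda>t. mprod (map (\<lambda>b. F b t) bs)) \<sigma> (blk i) t else 0)"
      using blk_nonempty i by (intro sum.cong refl) (simp add: trace_form_const_block)
    then show "trace_form (\<lambda>t. block_diag (\<lambda>a. (if a = b0 then (\<lambda>t. mprod (map (\<lambda>b. F b t) bs)) else (\<lambda>_. mat 1)) t)) \<sigma> (blk i) t =
        trace_form (\<lambda>t. mprod (map (\<lambda>b. F b t) bs)) \<sigma> (blk i) t"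
      by (simp only: trace_form_block_diag[OF c]) simp
  qed
  have W1: "wedge (\<lambda>_. G) (t(N := 1)) = alt_sum {..<N} (\<lambda>\<sigma>. \<Prod>i<n. \<Sum>b\<in>UNIV. trace_form (F b) \<sigma> (blk i) t)" for t
    unfolding wedge_slice G1 unfolding wedge_def form_prod_def trace_form_block_diag[OF F] ..
  show ?thesis using hom unfolding W0 W1 by simp
qed

end

section \<open>Alternating sums split along blocks of slots\<close>

lemma alt_sum_factor:
  fixes f g :: "('i \<Rightarrow> 'i) \<Rightarrow> complex"
  assumes fin: "finite A" "finite B" and AB: "A \<inter> B = {}"
    and f: "\<And>\<sigma> \<tau>. (\<And>x. x \<in> A \<Longrightarrow> \<sigma> x = \<tau> x) \<Longrightarrow> f \<sigma> = f \<tau>"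
    and g: "\<And>\<sigma> \<tau>. (\<And>x. x \<in> B \<Longrightarrow> \<sigma> x = \<tau> x) \<Longrightarrow> g \<sigma> = g \<tau>"
  shows "alt_sum (A \<union> B) (\<lambda>\<sigma>. if \<sigma> ` A = A then f \<sigma> * g \<sigma> else 0) = alt_sum A f * alt_sum B g"
proof -
  let ?P = "{\<sigma>. \<sigma> permutes (A \<union> B) \<and> \<sigma> ` A = A}"
  let ?h = "\<lambda>\<sigma>. of_int (sign \<sigma>) * (f \<sigma> * g \<sigma>)"
  have "alt_sum (A \<union> B) (\<lambda>\<sigma>. if \<sigma> ` A = A then f \<sigma> * g \<sigma> else 0) = (\<Sum>\<sigma>\<in>?P. ?h \<sigma>)"
    unfolding alt_sum_def
    by (rule sum.mono_neutral_cong_right) (auto simp: finite_permutations fin)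
  also have "\<dots> = (\<Sum>(p, q)\<in>{p. p permutes A} \<times> {q. q permutes B}.
      (of_int (sign p) * f p) * (of_int (sign q) * g q))"
  proof (rule sum.reindex_bij_witness[where i = "\<lambda>(p, q). p \<circ> q" and j = "\<lambda>\<sigma>. (restrict_id \<sigma> A, restrict_id \<sigma> B)"])
    fix \<sigma> assume \<sigma>: "\<sigma> \<in> ?P"
    then have s: "\<sigma> permutes (A \<union> B)" "\<sigma> ` A = A" by auto
    have inj: "inj \<sigma>" by (rule permutes_inj[OF s(1)])
    have AB': "\<sigma> ` (A \<union> B) = A \<union> B" by (rule permutes_image[OF s(1)])
    have "\<sigma> ` B = \<sigma> ` (A \<union> B) - \<sigma> ` A"
      using AB image_set_diff[OF inj, of "A \<union> B" A] by (simp add: Un_Diff Diff_triv Int_commute)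
    then have B: "\<sigma> ` B = B" unfolding AB' s(2) using AB by blast
    have pq: "restrict_id \<sigma> A permutes A" "restrict_id \<sigma> B permutes B"
      using s(2) B inj_on_subset[OF inj subset_UNIV] by (auto intro!: permutes_restrict_id simp: bij_betw_def)
    have comp: "restrict_id \<sigma> A \<circ> restrict_id \<sigma> B = \<sigma>"
    proof
      fix x
      show "(restrict_id \<sigma> A \<circ> restrict_id \<sigma> B) x = \<sigma> x"
      proof (cases "x \<in> B")
        case True
        then have "\<sigma> x \<in> B" using B by blast
        then show ?thesis using True AB by (auto simp: restrict_id_def)
      next
        case False
        then show ?thesis using permutes_not_in[OF s(1), of x] by (simp add: restrict_id_def)
      qed
    qed
    show "(\<lambda>(p, q). p \<circ> q) (restrict_id \<sigma> A, restrict_id \<sigma> B) = \<sigma>" using comp by simp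
    show "(restrict_id \<sigma> A, restrict_id \<sigma> B) \<in> {p. p permutes A} \<times> {q. q permutes B}" using pq by simp
    have "sign \<sigma> = sign (restrict_id \<sigma> A) * sign (restrict_id \<sigma> B)"
      using sign_compose[OF permutes_imp_permutation[OF fin(1) pq(1)] permutes_imp_permutation[OF fin(2) pq(2)]]
      unfolding comp .
    moreover have "f (restrict_id \<sigma> A) = f \<sigma>" "g (restrict_id \<sigma> B) = g \<sigma>"
      by (rule f, simp add: restrict_id_def, rule g, simp add: restrict_id_def)
    ultimately show "(case (restrict_id \<sigma> A, restrict_id \<sigma> B) of (p, q) \<Rightarrow>
        (of_int (sign p) * f p) * (of_int (sign q) * g q)) = ?h \<sigma>" by simp
  next
    fix pq assume "pq \<in> {p. p permutes A} \<times> {q. q permutes B}"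
    then obtain p q where pq: "pq = (p, q)" "p permutes A" "q permutes B" by auto
    have q: "q x = x" if "x \<in> A" for x using permutes_not_in[OF pq(3)] that AB by blast
    have "p \<circ> q permutes A \<union> B"
      by (rule permutes_compose[OF permutes_subset[OF pq(3)] permutes_subset[OF pq(2)]]) auto
    moreover have "(p \<circ> q) ` A = A" using q permutes_image[OF pq(2)] by (simp add: image_comp[symmetric])
    ultimately show "(\<lambda>(p, q). p \<circ> q) pq \<in> ?P" by (simp add: pq)
    have "restrict_id (p \<circ> q) A = p"
      using q permutes_not_in[OF pq(2)] by (auto simp: restrict_id_def fun_eq_iff)
    moreover have "restrict_id (p \<circ> q) B = q"
    proof
      fix x
      show "restrict_id (p \<circ> q) B x = q x"
      proof (cases "x \<in> B")
        case True
        then have "q x \<in> B" using permutes_in_image[OF pq(3)] by simp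
        then have "p (q x) = q x" using AB permutes_not_in[OF pq(2)] by blast
        then show ?thesis using True by (simp add: restrict_id_def)
      next
        case False then show ?thesis using permutes_not_in[OF pq(3)] by (simp add: restrict_id_def)
      qed
    qed
    ultimately show "(restrict_id ((\<lambda>(p, q). p \<circ> q) pq) A, restrict_id ((\<lambda>(p, q). p \<circ> q) pq) B) = pq"
      by (simp add: pq)
  qed
  also have "\<dots> = alt_sum A f * alt_sum B g"
    unfolding alt_sum_def sum_product sum.cartesian_product by simp
  finally show ?thesis .
qed

text \<open>Block \<open>k\<close> has 4k + 1 coordinates: the phase of the reflection and 2k pairs
  of an angle and a phase. In total \<open>off n\<close> is n(2n - 1), the dimension of the
  orbit.\<close>

primrec off :: "nat \<Rightarrow> nat" where
  "off 0 = 0"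
| "off (Suc k) = off k + 2 * (2 * k) + 1"

definition block_list :: "nat \<Rightarrow> nat list" where "block_list k = [off k..<off (Suc k)]"

lemma off_mono: "j \<le> k \<Longrightarrow> off j \<le> off k"
  by (rule lift_Suc_mono_le) simp_all

lemma set_block_list: "set (block_list k) = {off k..<off (Suc k)}"
  by (simp only: block_list_def set_upt)

lemma Union_block_list: "(\<Union>i<n. set (block_list i)) = {..<off n}"
proof (induction n)
  case (Suc n)
  then show ?case using off_mono[of n "Suc n"]
    by (auto simp: lessThan_Suc set_block_list)
qed simp

lemma disjoint_block_list: "i \<noteq> j \<Longrightarrow> set (block_list i) \<inter> set (block_list j) = {}"
proof (induction i j rule: linorder_wlog)
  case (le i j)
  then have "off (Suc i) \<le> off j" by (intro off_mono) simp
  then show ?case unfolding set_block_list by auto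
next
  case (sym i j) then show ?case by (simp only: Int_commute) 
qed

lemma form_blocks_block_list: "form_blocks n (off n) block_list"
proof
  show "distinct (block_list i)" "odd (length (block_list i))" for i
    by (simp_all only: block_list_def distinct_upt length_upt) simp
qed (rule disjoint_block_list Union_block_list, assumption?)+

lemma alt_sum_blocks:
  assumes Om: "\<And>k \<sigma> \<tau>. (\<And>x. x \<in> set (block_list k) \<Longrightarrow> \<sigma> x = \<tau> x) \<Longrightarrow> Om k \<sigma> = Om k \<tau>"
  shows "alt_sum {..<off n} (\<lambda>\<sigma>. if \<forall>k<n. \<sigma> ` set (block_list k) = set (block_list k) then \<Prod>k<n. Om k \<sigma> else (0::complex)) =
    (\<Prod>k<n. alt_sum (set (block_list k)) (Om k))"
proof (induction n)
  case 0 then show ?case by (simp add: alt_sum_def)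
next
  case (Suc n)
  let ?A = "{..<off n}" and ?B = "set (block_list n)"
  let ?pres = "\<lambda>n \<sigma>. \<forall>k<n. \<sigma> ` set (block_list k) = set (block_list k)"
  let ?f = "\<lambda>\<sigma>. if ?pres n \<sigma> then \<Prod>k<n. Om k \<sigma> else 0"
  have AB: "?A \<union> ?B = {..<off (Suc n)}" "?A \<inter> ?B = {}"
    using Union_block_list[of "Suc n"] Union_block_list[of n]
    by (auto simp: lessThan_Suc set_block_list)
  have "alt_sum {..<off (Suc n)} (\<lambda>\<sigma>. if ?pres (Suc n) \<sigma> then \<Prod>k<Suc n. Om k \<sigma> else 0) =
      alt_sum (?A \<union> ?B) (\<lambda>\<sigma>. if \<sigma> ` ?A = ?A then ?f \<sigma> * Om n \<sigma> else 0)"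
    unfolding AB(1)
  proof (rule alt_sum_cong)
    fix \<sigma> assume \<sigma>: "\<sigma> permutes {..<off (Suc n)}"
    have "?pres (Suc n) \<sigma> \<longleftrightarrow> \<sigma> ` ?A = ?A \<and> ?pres n \<sigma>"
    proof
      assume *: "?pres (Suc n) \<sigma>"
      then have "\<sigma> ` (\<Union>i<n. set (block_list i)) = (\<Union>i<n. set (block_list i))"
        unfolding image_UN by (intro SUP_cong) auto
      then show "\<sigma> ` ?A = ?A \<and> ?pres n \<sigma>" using * unfolding Union_block_list by simp
    next
      assume *: "\<sigma> ` ?A = ?A \<and> ?pres n \<sigma>"
      have B: "?B = {..<off (Suc n)} - ?A" using AB by blast
      have "\<sigma> ` ?B = \<sigma> ` {..<off (Suc n)} - \<sigma> ` ?A"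
        unfolding B by (rule image_set_diff[OF permutes_inj[OF \<sigma>]])
      then have "\<sigma> ` ?B = ?B" using * permutes_image[OF \<sigma>] B by simp
      then show "?pres (Suc n) \<sigma>" using * by (auto simp: less_Suc_eq)
    qed
    then show "(if ?pres (Suc n) \<sigma> then \<Prod>k<Suc n. Om k \<sigma> else 0) = (if \<sigma> ` ?A = ?A then ?f \<sigma> * Om n \<sigma> else 0)"
      by auto
  qed
  also have "\<dots> = alt_sum ?A ?f * alt_sum ?B (Om n)"
  proof (rule alt_sum_factor[OF _ _ AB(2)])
    fix \<sigma> \<tau> :: "nat \<Rightarrow> nat" assume e: "\<And>x. x \<in> ?A \<Longrightarrow> \<sigma> x = \<tau> x"
    have e': "\<sigma> x = \<tau> x" if "k < n" "x \<in> set (block_list k)" for k x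
      using e Union_block_list[of n] that by blast
    have "\<sigma> ` set (block_list k) = \<tau> ` set (block_list k)" if "k < n" for k
      using e'[OF that] by (rule image_cong[OF refl])
    moreover have "Om k \<sigma> = Om k \<tau>" if "k < n" for k by (rule Om[OF e'[OF that]])
    ultimately have "?pres n \<sigma> = ?pres n \<tau>" "(\<Prod>k<n. Om k \<sigma>) = (\<Prod>k<n. Om k \<tau>)"
      by (auto intro: prod.cong)
    then show "?f \<sigma> = ?f \<tau>" by (simp only:)
  qed (auto intro: Om)
  finally show ?case using Suc by simp
qed

text \<open>The blocks have pairwise different sizes, and each can only be mapped into a block at
  least as large. As every block is hit, comparing the sums of the indices leaves no room for
  growth.\<close>

lemma blocks_preserved:
  assumes \<sigma>: "\<sigma> permutes {..<off n}"
    and sub: "\<And>k. k < n \<Longrightarrow> \<exists>j<n. \<sigma> ` set (block_list k) \<subseteq> set (block_list j)" and k: "k < n"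
  shows "\<sigma> ` set (block_list k) = set (block_list k)"
proof -
  have "\<forall>k. \<exists>j. k < n \<longrightarrow> j < n \<and> \<sigma> ` set (block_list k) \<subseteq> set (block_list j)" using sub by blast
  from choice[OF this] obtain J where J: "\<forall>k. k < n \<longrightarrow> J k < n \<and> \<sigma> ` set (block_list k) \<subseteq> set (block_list (J k))"
    by blast
  have inj: "inj \<sigma>" by (rule permutes_inj[OF \<sigma>])
  have card: "card (set (block_list k)) = 4 * k + 1" for k by (simp add: set_block_list)
  have le: "k \<le> J k" if "k < n" for k
  proof -
    have "card (set (block_list k)) = card (\<sigma> ` set (block_list k))"
      by (rule card_image[symmetric, OF inj_on_subset[OF inj]]) simp
    also have "\<dots> \<le> card (set (block_list (J k)))" using J that by (intro card_mono) auto
    finally show ?thesis by (simp add: card)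
  qed
  have "{..<n} \<subseteq> J ` {..<n}"
  proof
    fix b assume b: "b \<in> {..<n}"
    have "off b \<in> set (block_list b)" by (simp add: set_block_list)
    then have "off b \<in> {..<off n}" using Union_block_list[of n] b by blast
    then have "off b \<in> \<sigma> ` {..<off n}" using permutes_image[OF \<sigma>] by simp
    then obtain i x where i: "i < n" "x \<in> set (block_list i)" "off b = \<sigma> x"
      unfolding Union_block_list[symmetric] by blast
    then have "off b \<in> set (block_list (J i))" using J by blast
    then have "J i = b" using disjoint_block_list[of "J i" b] \<open>off b \<in> set (block_list b)\<close> by blast
    then show "b \<in> J ` {..<n}" using i by blast
  qed
  moreover have "J ` {..<n} \<subseteq> {..<n}" using J by auto
  ultimately have im: "J ` {..<n} = {..<n}" by blast
  then have "inj_on J {..<n}" by (intro eq_card_imp_inj_on) simp_all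
  then have "(\<Sum>k<n. J k) = (\<Sum>k<n. k)" using sum.reindex[of J "{..<n}" id] im by simp
  then have "J k = k" using sum_mono_inv[of "\<lambda>k. k" "{..<n}" J k] le k by simp
  then have "\<sigma> ` set (block_list k) \<subseteq> set (block_list k)" using J k by metis
  then show ?thesis
    by (intro card_subset_eq) (simp_all add: card_image[OF inj_on_subset[OF inj]])
qed

lemma trace_form_cong:
  "(\<And>x. x \<in> set xs \<Longrightarrow> \<sigma> x = \<tau> x) \<Longrightarrow> trace_form g \<sigma> xs t = trace_form g \<tau> xs t"
  unfolding trace_form_def
  by (intro arg_cong[where f = trace] arg_cong[where f = mprod] map_cong) simp_all

lemma trace_form_eq_0:
  fixes g :: "point \<Rightarrow> complex ^ 'm ^ 'm"
  assumes "x \<in> set xs" "\<And>t s. g (t(\<sigma> x := s)) = g t" shows "trace_form g \<sigma> xs t = 0"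
proof -
  interpret mm: bounded_bilinear "(**) :: complex ^ 'm ^ 'm \<Rightarrow> complex ^ 'm ^ 'm \<Rightarrow> complex ^ 'm ^ 'm"
    by (rule bounded_bilinear_matrix_mult)
  obtain ys zs where xs: "xs = ys @ x # zs" using split_list[OF assms(1)] by blast
  have "log_pd g (\<sigma> x) t = 0"
    using pd_indep[of g "\<sigma> x"] assms(2) by (simp add: log_pd_def mm.zero_right)
  then have "mprod (map (\<lambda>x. log_pd g (\<sigma> x) t) xs) = 0"
    by (simp add: xs mprod_append mm.zero_left mm.zero_right)
  then show ?thesis by (simp add: trace_form_def trace_def)
qed

lemma sum_UNIV_option_sum:
  "(\<Sum>b\<in>(UNIV :: ('c::finite + 'd::finite) option set). f b) =
    f None + (\<Sum>a\<in>UNIV. f (Some (Inl a))) + (\<Sum>a\<in>UNIV. f (Some (Inr a)))"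
proof -
  have "(\<Sum>b\<in>(UNIV :: ('c + 'd) option set). f b) = f None + (\<Sum>b\<in>UNIV. f (Some b))"
    unfolding UNIV_option_conv by (simp add: sum.reindex)
  also have "(\<Sum>b\<in>UNIV. f (Some b)) = (\<Sum>a\<in>UNIV. f (Some (Inl a))) + (\<Sum>a\<in>UNIV. f (Some (Inr a)))"
    unfolding UNIV_Plus_UNIV[symmetric] by (subst sum.Plus) (simp_all add: o_def)
  finally show ?thesis by (simp add: add.assoc)
qed

section \<open>The cycle as a product of reflections\<close>

definition block_reflect :: "('m::finite \<Rightarrow> nat) \<Rightarrow> real \<Rightarrow> nat \<Rightarrow> point \<Rightarrow> complex ^ 'm ^ 'm" where
  "block_reflect idx eps k = reflection_map.reflect (polar_coordinates.vec (off k) (2 * k) eps idx) (off k)"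

definition block_density :: "nat \<Rightarrow> point \<Rightarrow> real" where
  "block_density k = polar_coordinates.total_density (off k) (2 * k)"

definition block_const :: "nat \<Rightarrow> complex" where
  "block_const k = polar_coordinates.const (off k) (2 * k)"

text \<open>The axis of the \<open>k\<close>-th reflection lies in 2k + 1 dimensions; the bound on
  \<open>n\<close> leaves room for all \<open>k < n\<close>.\<close>

locale block_setting =
  fixes idx :: "'m::finite \<Rightarrow> nat" and n :: nat
  assumes idx: "bij_betw idx UNIV {..<CARD('m)}" and n: "2 * n \<le> CARD('m)"
begin

lemma polar: "k < n \<Longrightarrow> \<bar>eps\<bar> = 1 \<Longrightarrow> polar_coordinates (2 * k) eps idx"
  using idx n by unfold_locales auto

lemma block_reflect_facts:
  assumes k: "k < n" and eps: "\<bar>eps\<bar> = 1"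
  shows "GL_map (block_reflect idx eps k)"
    "j \<notin> set (block_list k) \<Longrightarrow> block_reflect idx eps k (t(j := s)) = block_reflect idx eps k t"
    "alt_sum (set (block_list k)) (\<lambda>\<sigma>. trace_form (block_reflect idx eps k) \<sigma> (block_list k) t) =
      block_const k * of_real (block_density k t)"
proof -
  interpret polar_coordinates "off k" "2 * k" eps idx by (rule polar[OF k eps])
  show "GL_map (block_reflect idx eps k)"
    unfolding block_reflect_def by (rule GL_map_reflect)
  show "block_reflect idx eps k (t(j := s)) = block_reflect idx eps k t" if "j \<notin> set (block_list k)"
    unfolding block_reflect_def using that by (intro reflect_indep) (simp add: set_block_list)
  show "alt_sum (set (block_list k)) (\<lambda>\<sigma>. trace_form (block_reflect idx eps k) \<sigma> (block_list k) t) =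
      block_const k * of_real (block_density k t)"
    using alt_sum_trace_form_reflect[of t]
    unfolding block_reflect_def block_const_def block_density_def block_list_def set_upt off.simps
    by simp
qed

text \<open>Transposing the projection onto a vector gives the projection onto its conjugate, which
  is the axis with all phases reversed.\<close>

lemma block_reflect_transpose:
  assumes k: "k < n" shows "transpose (block_reflect idx 1 k t) = block_reflect idx (- 1) k t"
proof -
  interpret p: polar_coordinates "off k" "2 * k" 1 idx by (rule polar[OF k]) simp
  interpret q: polar_coordinates "off k" "2 * k" "- 1" idx by (rule polar[OF k]) simp
  have "q.comp j t = cnj (p.comp j t)" for j
    by (simp add: p.comp_def q.comp_def p.ph_def q.ph_def cis_cnj)
  then have "q.vec t $ i = cnj (p.vec t $ i)" for i by (simp add: p.vec_def q.vec_def)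
  then show ?thesis
    unfolding block_reflect_def p.reflect_def q.reflect_def p.proj_def q.proj_def p.phase_def q.phase_def
    by (simp add: vec_eq_iff transpose_def cscale_def outer_def mat_def mult.commute)
qed

lemma block_reflect_unitary:
  assumes k: "k < n" shows "block_reflect idx 1 k t ** adjoint_matrix (block_reflect idx 1 k t) = mat 1"
proof -
  interpret p: polar_coordinates "off k" "2 * k" 1 idx by (rule polar[OF k]) simp
  have "adjoint_matrix (block_reflect idx 1 k t) = mat 1 + cscale (cnj (p.phase t) - 1) (p.proj t)"
    unfolding block_reflect_def p.reflect_def p.proj_def
    by (auto simp: vec_eq_iff adjoint_matrix_def cscale_def outer_def mat_def)
  then show ?thesis using p.reflect_inverse(1) unfolding block_reflect_def by simp
qed

text \<open>One choice of \<open>k\<close>, \<open>l\<close> and \<open>u\<close> has to serve all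
  reflections and both signs at once. The reflections of other blocks do not depend on the
  coordinates \<open>k\<close> and \<open>l\<close>, so a relation found within the block of
  \<open>j\<close> holds for all of them.\<close>

lemma block_reflect_boundary:
  assumes j: "j < off n"
  shows "(\<forall>eps k t. \<bar>eps\<bar> = 1 \<and> k < n \<longrightarrow> block_reflect idx eps k (t(j := 1)) = block_reflect idx eps k (t(j := 0))) \<or>
    (\<forall>t. t j \<in> {0, 1} \<longrightarrow> (\<exists>k l u. k \<noteq> l \<and> k \<noteq> j \<and> l \<noteq> j \<and> k < off n \<and> l < off n \<and>
        (\<forall>eps i. \<bar>eps\<bar> = 1 \<and> i < n \<longrightarrow> proportional_at k l u t (block_reflect idx eps i))))"
proof -
  from j obtain b where b: "b < n" "j \<in> set (block_list b)" using Union_block_list[of n] by blast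
  have other: "block_reflect idx eps i (t(l := s)) = block_reflect idx eps i t"
    if "\<bar>eps\<bar> = 1" "i < n" "i \<noteq> b" "l \<in> set (block_list b)" for eps i t l s
    by (rule block_reflect_facts(2)) (use that disjoint_block_list[of i b] in auto)
  interpret p: polar_coordinates "off b" "2 * b" 1 idx by (rule polar[OF b(1)]) simp
  interpret q: polar_coordinates "off b" "2 * b" "- 1" idx by (rule polar[OF b(1)]) simp
  have blk: "set (block_list b) = {off b..<off b + 2 * (2 * b) + 1}" by (simp add: set_block_list)
  have pm: "eps = 1 \<or> eps = - 1" if "\<bar>eps\<bar> = 1" for eps :: real using that by linarith
  show ?thesis
  proof (cases "j = off b \<or> j \<in> p.alpha ` UNIV")
    case True
    have "block_reflect idx eps k (t(j := 1)) = block_reflect idx eps k (t(j := 0))"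
      if "\<bar>eps\<bar> = 1" "k < n" for eps k t
    proof (cases "k = b")
      case True
      then show ?thesis
        using pm[OF that(1)] p.reflect_periodic q.reflect_periodic \<open>j = off b \<or> j \<in> p.alpha ` UNIV\<close>
        unfolding block_reflect_def by blast
    next
      case False
      then show ?thesis using other[OF that False b(2)] by simp
    qed
    then show ?thesis by blast
  next
    case False
    have "\<exists>a. a < 2 * b \<and> j = p.theta a"
    proof -
      have "Suc (off b) \<le> j" "j < off b + 2 * (2 * b) + 1" using b(2) False unfolding blk by auto
      then obtain d where d: "j = Suc (off b) + d" "d < 2 * (2 * b)"
        using le_Suc_ex[of "Suc (off b)" j] by auto
      have "odd d \<Longrightarrow> j = p.alpha (d div 2)" using d by (simp add: p.alpha_def)
      then have "even d" using False by blast
      then show ?thesis using d by (intro exI[of _ "d div 2"]) (auto simp: p.theta_def)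
    qed
    then obtain a where a: "a < 2 * b" "j = p.theta a" by blast
    have "\<exists>k l u. k \<noteq> l \<and> k \<noteq> j \<and> l \<noteq> j \<and> k < off n \<and> l < off n \<and>
        (\<forall>eps i. \<bar>eps\<bar> = 1 \<and> i < n \<longrightarrow> proportional_at k l u t (block_reflect idx eps i))" if t: "t j \<in> {0, 1}" for t
    proof -
      have lift: ?thesis if kl: "k \<noteq> l" "k \<in> set (block_list b) - {j}" "l \<in> set (block_list b) - {j}"
        and "proportional_at k l u t (block_reflect idx 1 b)" "proportional_at k l u t (block_reflect idx (- 1) b)"
      for k l u
      proof (intro exI conjI allI impI)
        show "k < off n" "l < off n" using kl Union_block_list[of n] b(1) by blast+
        fix eps :: real and i assume e: "\<bar>eps\<bar> = 1 \<and> i < n"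
        show "proportional_at k l u t (block_reflect idx eps i)"
        proof (cases "i = b")
          case True then show ?thesis using pm[of eps] e that(4,5) by blast
        next
          case False
          then have "pd x (block_reflect idx eps i) = (\<lambda>_. 0)" if "x \<in> set (block_list b)" for x
            using e that by (intro pd_indep other) auto
          then show ?thesis using kl by (simp add: proportional_at_def)
        qed
      qed (use kl in auto)
      have al: "p.alpha i \<in> set (block_list b) - {j}" if "i < 2 * b" for i
        using that unfolding blk a(2) by (auto simp: p.alpha_def p.theta_def) presburger
      have zl: "off b \<in> set (block_list b) - {j}" unfolding blk a(2) by (auto simp: p.theta_def)
      consider "t (p.theta a) = 0" | "t (p.theta 0) = 1" "a = 0" | "t (p.theta a) = 1" "0 < a"
        using t a(2) by fastforce
      then show ?thesis
      proof cases
        case 1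
        \<comment> \<open>A vanishing derivative is recorded with \<open>u = 0\<close>; the phase
          coordinate \<open>off b\<close> serves as the second direction because it is neither the
          angle \<open>j\<close> nor one of the \<open>alpha\<close>.\<close>
        show ?thesis
          by (rule lift[of "p.alpha a" "off b" 0]; (rule al[OF a(1)] zl)?)
            (simp_all add: proportional_at_def block_reflect_def p.reflect_degenerate(1)[where t = t and j = a, OF 1] q.reflect_degenerate(1)[where t = t and j = a, OF 1])
      next
        case 2
        have 0: "0 < 2 * b" using a(1) by simp
        show ?thesis
          by (rule lift[of "p.alpha 0" "off b" 0]; (rule al[OF 0] zl)?)
            (simp_all add: proportional_at_def block_reflect_def p.reflect_degenerate(2)[where t = t, OF 2(1) 0] q.reflect_degenerate(2)[where t = t, OF 2(1) 0])
      next
        case 3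
        have a': "a - 1 < 2 * b" using a(1) by simp
        show ?thesis
          by (rule lift[of "p.alpha (a - 1)" "p.alpha a" 1]; (rule al[OF a(1)] al[OF a'])?)
            (use 3 p.reflect_degenerate(3)[where t = t and j = a, OF 3 a(1)]
              q.reflect_degenerate(3)[where t = t and j = a, OF 3 a(1)] in
              \<open>simp_all add: proportional_at_def block_reflect_def\<close>)
      qed
    qed
    then show ?thesis by blast
  qed
qed

lemma block_density_facts:
  assumes "k < n"
  shows "continuous_on UNIV (block_density k)" "block_const k \<noteq> 0"
    "(\<And>j. j < off n \<Longrightarrow> t j \<in> {0..1}) \<Longrightarrow> block_density k t \<ge> 0"
    "(\<And>j. t j = 1 / 2) \<Longrightarrow> block_density k t > 0"
proof -
  interpret p: polar_coordinates "off k" "2 * k" 1 idx by (rule polar[OF assms]) simp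
  show "continuous_on UNIV (block_density k)"
    unfolding block_density_def by (rule p.continuous_total_density)
  show "block_const k \<noteq> 0" unfolding block_const_def by (rule p.const_nonzero)
  show "block_density k t > 0" if "\<And>j. t j = 1 / 2"
    unfolding block_density_def by (rule p.total_density_pos[OF that])
  show "block_density k t \<ge> 0" if t: "\<And>j. j < off n \<Longrightarrow> t j \<in> {0..1}"
    unfolding block_density_def
  proof (rule p.total_density_nonneg)
    fix j assume j: "j < 2 * k"
    have "p.theta j < off (Suc k)" using j by (simp add: p.theta_def)
    then show "t (p.theta j) \<in> {0..1}" using off_mono[of "Suc k" n] assms by (intro t) simp
  qed
qed

text \<open>The factors of \<Phi> C \<Phi>^T: \<open>Inl\<close> for the reflections,
  \<open>None\<close> for the constant in the middle, \<open>Inr\<close> for the transposes. The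
  index type is finite because it becomes the set of blocks of \<open>block_diag\<close>.\<close>

definition block_factor :: "('c::finite \<Rightarrow> nat) \<Rightarrow> complex ^ 'm ^ 'm \<Rightarrow> ('c + 'c) option \<Rightarrow> point \<Rightarrow> complex ^ 'm ^ 'm" where
  "block_factor e C b = (case b of None \<Rightarrow> (\<lambda>_. C) | Some (Inl a) \<Rightarrow> block_reflect idx 1 (e a)
     | Some (Inr a) \<Rightarrow> block_reflect idx (- 1) (e a))"

text \<open>A reflection moves with the coordinates of its own block only, so a trace survives only
  when its slots all go into one block. Comparing sizes leaves the permutations that preserve every
  block, and the sum becomes a product. A reflection and its transpose contribute equally, whence
  the factor 2.\<close>

lemma alt_sum_block_factor:
  fixes e :: "'c::finite \<Rightarrow> nat" and C :: "complex ^ 'm ^ 'm"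
  assumes e: "bij_betw e UNIV {..<n}"
  shows "alt_sum {..<off n} (\<lambda>\<sigma>. \<Prod>i<n. \<Sum>b\<in>UNIV. trace_form (block_factor e C b) \<sigma> (block_list i) t) =
    (\<Prod>i<n. 2 * block_const i) * of_real (\<Prod>i<n. block_density i t)"
proof -
  let ?Om = "\<lambda>i \<sigma>. \<Sum>b\<in>UNIV. trace_form (block_factor e C b) \<sigma> (block_list i) t"
  have e_less: "e a < n" for a using bij_betwE[OF e] by auto
  have ne: "block_list i \<noteq> []" for i by (simp add: block_list_def)
  have Om: "?Om i \<sigma> = (\<Sum>a\<in>UNIV. trace_form (block_reflect idx 1 (e a)) \<sigma> (block_list i) t) +
      (\<Sum>a\<in>UNIV. trace_form (block_reflect idx (- 1) (e a)) \<sigma> (block_list i) t)" for i \<sigma>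
    unfolding sum_UNIV_option_sum by (simp add: block_factor_def trace_form_const_block[OF ne])
  have zero: "trace_form (block_reflect idx eps k) \<sigma> (block_list i) t = 0"
    if "\<bar>eps\<bar> = 1" "k < n" "\<not> \<sigma> ` set (block_list i) \<subseteq> set (block_list k)" for eps k \<sigma> i
  proof -
    from that(3) obtain x where x: "x \<in> set (block_list i)" "\<sigma> x \<notin> set (block_list k)" by blast
    show ?thesis
      by (rule trace_form_eq_0[where x = x]) (use x block_reflect_facts(2)[OF that(2,1)] in auto)
  qed
  have pres: "\<forall>k<n. \<sigma> ` set (block_list k) = set (block_list k)"
    if \<sigma>: "\<sigma> permutes {..<off n}" and nz: "\<And>k. k < n \<Longrightarrow> ?Om k \<sigma> \<noteq> 0" for \<sigma>
  proof (intro allI impI, rule blocks_preserved[OF \<sigma>])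
    fix k assume k: "k < n"
    show "\<exists>j<n. \<sigma> ` set (block_list k) \<subseteq> set (block_list j)"
    proof (rule ccontr)
      assume "\<not> ?thesis"
      then have "trace_form (block_reflect idx eps (e a)) \<sigma> (block_list k) t = 0" if "\<bar>eps\<bar> = 1" for eps a
        using zero[OF that e_less] e_less[of a] by blast
      then have "?Om k \<sigma> = 0" unfolding Om by simp
      then show False using nz[OF k] by simp
    qed
  qed
  have "alt_sum {..<off n} (\<lambda>\<sigma>. \<Prod>i<n. ?Om i \<sigma>) =
      alt_sum {..<off n} (\<lambda>\<sigma>. if \<forall>k<n. \<sigma> ` set (block_list k) = set (block_list k) then \<Prod>i<n. ?Om i \<sigma> else 0)"
  proof (rule alt_sum_cong)
    fix \<sigma> assume \<sigma>: "\<sigma> permutes {..<off n}"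
    show "(\<Prod>i<n. ?Om i \<sigma>) = (if \<forall>k<n. \<sigma> ` set (block_list k) = set (block_list k) then \<Prod>i<n. ?Om i \<sigma> else 0)"
    proof (cases "\<forall>k<n. ?Om k \<sigma> \<noteq> 0")
      case True
      have "\<forall>k<n. \<sigma> ` set (block_list k) = set (block_list k)" by (rule pres[OF \<sigma>]) (use True in blast)
      then show ?thesis by (rule if_P[symmetric])
    next
      case False
      then have "(\<Prod>i<n. ?Om i \<sigma>) = 0" by (intro prod_zero) auto
      then show ?thesis by (simp only: if_cancel)
    qed
  qed
  also have "\<dots> = (\<Prod>i<n. alt_sum (set (block_list i)) (?Om i))"
    by (rule alt_sum_blocks, rule sum.cong[OF refl], rule trace_form_cong)
  also have "\<dots> = (\<Prod>i<n. 2 * block_const i * of_real (block_density i t))"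
  proof (rule prod.cong[OF refl])
    fix i assume "i \<in> {..<n}"
    then have i: "i < n" by simp
    have "i \<in> e ` UNIV" using e i by (simp add: bij_betw_def)
    then obtain a0 where a0: "e a0 = i" by blast
    have inj: "e a = i \<longleftrightarrow> a = a0" for a
      using inj_eq[of e a a0] e unfolding a0[symmetric] by (simp add: bij_betw_def)
    have part: "alt_sum (set (block_list i)) (\<lambda>\<sigma>. \<Sum>a\<in>UNIV. trace_form (block_reflect idx eps (e a)) \<sigma> (block_list i) t) =
        block_const i * of_real (block_density i t)" if eps: "\<bar>eps\<bar> = 1" for eps
    proof -
      have "alt_sum (set (block_list i)) (\<lambda>\<sigma>. \<Sum>a\<in>UNIV. trace_form (block_reflect idx eps (e a)) \<sigma> (block_list i) t) =
          alt_sum (set (block_list i)) (\<lambda>\<sigma>. trace_form (block_reflect idx eps i) \<sigma> (block_list i) t)"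
      proof (rule alt_sum_cong)
        fix \<sigma> assume \<sigma>: "\<sigma> permutes set (block_list i)"
        have im: "\<sigma> ` set (block_list i) = set (block_list i)" by (rule permutes_image[OF \<sigma>])
        have "trace_form (block_reflect idx eps (e a)) \<sigma> (block_list i) t =
            (if a = a0 then trace_form (block_reflect idx eps i) \<sigma> (block_list i) t else 0)" for a
        proof (cases "a = a0")
          case False
          then have "set (block_list i) \<inter> set (block_list (e a)) = {}"
            using inj[of a] by (intro disjoint_block_list) auto
          then have "\<not> \<sigma> ` set (block_list i) \<subseteq> set (block_list (e a))"
            unfolding im using ne[of i] by (simp add: inf.absorb_iff1)
          then show ?thesis using zero[OF eps e_less] False by simp
        qed (simp add: a0)
        then show "(\<Sum>a\<in>UNIV. trace_form (block_reflect idx eps (e a)) \<sigma> (block_list i) t) =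
            trace_form (block_reflect idx eps i) \<sigma> (block_list i) t" by simp
      qed
      then show ?thesis using block_reflect_facts(3)[OF i eps] by simp
    qed
    show "alt_sum (set (block_list i)) (?Om i) = 2 * block_const i * of_real (block_density i t)"
      unfolding Om alt_sum_add by (simp add: part)
  qed
  also have "\<dots> = (\<Prod>i<n. 2 * block_const i) * of_real (\<Prod>i<n. block_density i t)"
    by (simp add: prod.distrib)
  finally show ?thesis .
qed

definition psi :: "complex ^ 'm ^ 'm \<Rightarrow> point \<Rightarrow> complex ^ 'm ^ 'm" where
  "psi C t = mprod (map (\<lambda>k. block_reflect idx 1 k t) [0..<n]) ** C **
     transpose (mprod (map (\<lambda>k. block_reflect idx 1 k t) [0..<n]))"

lemma transpose_mprod: "transpose (mprod As) = mprod (rev (map transpose As))"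
  by (induction As) (simp_all add: mprod_append matrix_transpose_mul transpose_mat)

lemma psi_eq_mprod:
  fixes e :: "'c::finite \<Rightarrow> nat"
  assumes e: "bij_betw e UNIV {..<n}"
  obtains bs where "distinct bs" "set bs = UNIV"
    "\<And>C t. psi C t = mprod (map (\<lambda>b. block_factor e C b t) bs)"
proof -
  define e' where "e' = the_inv_into UNIV e"
  have inj: "inj e" and im: "e ` UNIV = {..<n}" using e by (auto simp: bij_betw_def)
  have ee': "e (e' k) = k" if "k < n" for k
    unfolding e'_def by (rule f_the_inv_into_f[OF inj]) (use im that in auto)
  have e'e: "e' (e a) = a" for a unfolding e'_def by (rule the_inv_into_f_f[OF inj]) simp
  have inj': "inj_on e' {..<n}" using ee' by (metis inj_onI lessThan_iff)
  have im': "e' ` {..<n} = UNIV"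
    using e'e im by (metis UNIV_I UNIV_eq_I imageI)
  \<comment> \<open>Transposition reverses the order of the factors, hence the reversed list of the
    \<open>Inr\<close> entries.\<close>
  define bs where "bs = map (\<lambda>k. Some (Inl (e' k))) [0..<n] @ [None] @ rev (map (\<lambda>k. Some (Inr (e' k))) [0..<n])"
  have i1: "inj_on (\<lambda>k. Some (Inl (e' k))) {0..<n}" "inj_on (\<lambda>k. Some (Inr (e' k))) {0..<n}"
    using inj' by (auto simp: inj_on_def)
  have "distinct bs"
    unfolding bs_def by (auto simp: distinct_map i1)
  moreover have "set bs = UNIV"
  proof -
    have "b \<in> set bs" for b :: "('c + 'c) option"
    proof -
      have "a \<in> e' ` {0..<n}" for a using im' by (simp add: atLeast0LessThan)
      then show ?thesis unfolding bs_def
        by (cases b rule: option.exhaust; simp) (rename_tac s, case_tac s; fastforce)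
    qed
    then show ?thesis by blast
  qed
  moreover have "psi C t = mprod (map (\<lambda>b. block_factor e C b t) bs)" for C t
  proof -
    have a: "map (\<lambda>k. block_reflect idx 1 (e (e' k)) t) [0..<n] = map (\<lambda>k. block_reflect idx 1 k t) [0..<n]"
      by (simp add: ee')
    have b: "map (\<lambda>k. block_reflect idx (- 1) (e (e' k)) t) [0..<n] = map transpose (map (\<lambda>k. block_reflect idx 1 k t) [0..<n])"
      by (simp add: ee' block_reflect_transpose)
    have "map (\<lambda>b. block_factor e C b t) bs =
        map (\<lambda>k. block_reflect idx 1 (e (e' k)) t) [0..<n] @ C # rev (map (\<lambda>k. block_reflect idx (- 1) (e (e' k)) t) [0..<n])"
      by (simp add: bs_def block_factor_def o_def rev_map)
    then show ?thesis
      unfolding psi_def a b by (simp only: mprod_append mprod_Cons transpose_mprod matrix_mul_assoc)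
  qed
  ultimately show thesis using that by blast
qed

lemma GL_map_block_factor:
  assumes "invertible C" "bij_betw e UNIV {..<n}" shows "GL_map (block_factor e C b)"
proof -
  have "e a < n" for a using bij_betwE[OF assms(2)] by auto
  then show ?thesis
    using block_reflect_facts(1)
    by (auto simp: block_factor_def GL_map_def C2_const assms(1) split: option.split sum.split)
qed

text \<open>After the rotation into blocks the integrand is a nonzero constant times a product of
  densities that are nonnegative on the box and positive at its centre.\<close>

theorem box_integral_wedge_psi:
  fixes e :: "'c::finite \<Rightarrow> nat"
  assumes C: "invertible C" and e: "bij_betw e UNIV {..<n}"
  shows "box_integral [0..<off n] (form_blocks.wedge n (off n) block_list (\<lambda>_. psi C)) (\<lambda>_. 1 / 2) \<noteq> 0"
proof -
  interpret form_blocks n "off n" block_list by (rule form_blocks_block_list)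
  have e_less: "e a < n" for a using bij_betwE[OF e] by auto
  obtain bs where bs: "distinct bs" "set bs = UNIV"
    "\<And>C t. psi C t = mprod (map (\<lambda>b. block_factor e C b t) bs)" by (rule psi_eq_mprod[OF e]) blast
  let ?t = "\<lambda>_::nat. 1 / 2 :: real"
  let ?c = "\<Prod>i<n. 2 * block_const i"
  let ?r = "\<lambda>t. \<Prod>i<n. block_density i t"
  have "box_integral [0..<off n] (wedge (\<lambda>_. psi C)) ?t =
      box_integral [0..<off n] (wedge (\<lambda>_ t. mprod (map (\<lambda>b. block_factor e C b t) bs))) ?t"
    by (simp only: bs(3)[abs_def])
  also have "\<dots> = box_integral [0..<off n] (\<lambda>t. alt_sum {..<off n}
      (\<lambda>\<sigma>. \<Prod>i<n. \<Sum>b\<in>UNIV. trace_form (block_factor e C b) \<sigma> (block_list i) t)) ?t"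
  proof (rule box_integral_wedge_mprod[OF GL_map_block_factor[OF C e] _ bs(1,2)])
    fix b t s
    have "off n \<notin> set (block_list k)" if "k < n" for k using Union_block_list[of n] that by blast
    then show "block_factor e C b (t(off n := s)) = block_factor e C b t"
      using block_reflect_facts(2)[OF e_less]
      by (auto simp: block_factor_def e_less split: option.split sum.split)
  next
    fix j assume j: "j < off n"
    from block_reflect_boundary[OF j]
    show "(\<forall>b t. block_factor e C b (t(j := 1)) = block_factor e C b (t(j := 0))) \<or>
      (\<forall>t. t j \<in> {0, 1} \<longrightarrow> (\<exists>k l u. k \<noteq> l \<and> k \<noteq> j \<and> l \<noteq> j \<and> k < off n \<and> l < off n \<and>
        (\<forall>b. proportional_at k l u t (block_factor e C b))))"
    proof
      assume *: "\<forall>eps k t. \<bar>eps\<bar> = 1 \<and> k < n \<longrightarrow> block_reflect idx eps k (t(j := 1)) = block_reflect idx eps k (t(j := 0))"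
      have "block_factor e C b (t(j := 1)) = block_factor e C b (t(j := 0))" for b t
        using *[rule_format, of 1] *[rule_format, of "- 1"] e_less
        by (auto simp: block_factor_def split: option.split sum.split)
      then show ?thesis by blast
    next
      assume *: "\<forall>t. t j \<in> {0, 1} \<longrightarrow> (\<exists>k l u. k \<noteq> l \<and> k \<noteq> j \<and> l \<noteq> j \<and> k < off n \<and> l < off n \<and>
        (\<forall>eps i. \<bar>eps\<bar> = 1 \<and> i < n \<longrightarrow> proportional_at k l u t (block_reflect idx eps i)))"
      have imp: "proportional_at k l u t (block_factor e C b)"
        if "\<forall>eps i. \<bar>eps\<bar> = 1 \<and> i < n \<longrightarrow> proportional_at k l u t (block_reflect idx eps i)" for k l u t b
        using that[rule_format, of 1] that[rule_format, of "- 1"] e_less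
        by (auto simp: block_factor_def proportional_at_const split: option.split sum.split)
      have "\<exists>k l u. k \<noteq> l \<and> k \<noteq> j \<and> l \<noteq> j \<and> k < off n \<and> l < off n \<and>
        (\<forall>b. proportional_at k l u t (block_factor e C b))" if "t j \<in> {0, 1}" for t
      proof -
        from * have "t j \<in> {0, 1} \<longrightarrow> (\<exists>k l u. k \<noteq> l \<and> k \<noteq> j \<and> l \<noteq> j \<and> k < off n \<and> l < off n \<and>
          (\<forall>eps i. \<bar>eps\<bar> = 1 \<and> i < n \<longrightarrow> proportional_at k l u t (block_reflect idx eps i)))"
          by (rule spec)
        from mp[OF this that] show ?thesis
          by (elim exE conjE) (intro exI conjI allI, assumption+, rule imp)
      qed
      then show ?thesis by blast
    qed
  qed
  also have "\<dots> = box_integral [0..<off n] (\<lambda>t. ?c * of_real (?r t)) ?t"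
    by (simp only: alt_sum_block_factor[OF e])
  also have "\<dots> = ?c * of_real (box_integral [0..<off n] ?r ?t)"
  proof -
    have r: "continuous_on UNIV ?r"
      by (intro continuous_on_prod block_density_facts(1)) simp
    have l: "bounded_linear (\<lambda>x::real. ?c * of_real x)"
      by (rule bounded_linear_const_mult[OF bounded_linear_of_real])
    show ?thesis by (simp only: box_integral_linear[OF r l])
  qed
  finally have eq: "box_integral [0..<off n] (wedge (\<lambda>_. psi C)) ?t = ?c * of_real (box_integral [0..<off n] ?r ?t)" .
  have "box_integral [0..<off n] ?r ?t > 0"
  proof (rule box_integral_pos[where B = "{t. \<forall>j<off n. t j \<in> {0..1}}"])
    show "?r t \<ge> 0" if "t \<in> {t. \<forall>j<off n. t j \<in> {0..1}}" for t
      using that by (intro prod_nonneg block_density_facts(3)) auto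
    show "?r ?t > 0" by (intro prod_pos block_density_facts(4)) auto
    show "continuous_on UNIV ?r" by (intro continuous_on_prod block_density_facts(1)) simp
  qed auto
  moreover have "?c \<noteq> 0" using block_density_facts(2) by simp
  ultimately show ?thesis unfolding eq by simp
qed

end

section \<open>The lower bound\<close>

lemma compact_unitary_group: "compact (carrier (unitary_group :: (complex ^ 'm::finite ^ 'm) monoid))"
proof -
  let ?U = "carrier (unitary_group :: (complex ^ 'm ^ 'm) monoid)"
  have "bounded_linear (adjoint_matrix :: complex ^ 'm ^ 'm \<Rightarrow> _)"
  proof -
    have "linear (adjoint_matrix :: complex ^ 'm ^ 'm \<Rightarrow> _)"
      by (intro linearI) (simp_all add: adjoint_matrix_def vec_eq_iff)
    then show ?thesis by (simp add: linear_conv_bounded_linear)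
  qed
  then have adj: "continuous_on UNIV (adjoint_matrix :: complex ^ 'm ^ 'm \<Rightarrow> _)"
    by (rule linear_continuous_on)
  have U: "?U = (\<lambda>A. (A ** adjoint_matrix A, adjoint_matrix A ** A)) -` {(mat 1, mat 1)}"
    by (auto simp: unitary_group_def)
  have "closed ?U"
    unfolding U
    by (intro closed_vimage closed_singleton continuous_on_Pair adj continuous_on_id
        bounded_bilinear.continuous_on[OF bounded_bilinear_matrix_mult])
  moreover have "norm A = sqrt (of_nat CARD('m))" if "A \<in> ?U" for A
  proof -
    have "A \<bullet> A = Re (trace (A ** adjoint_matrix A))"
      by (simp add: inner_vec_def trace_def matrix_matrix_mult_def adjoint_matrix_def Re_sum inner_complex_def)
    also have "\<dots> = of_nat CARD('m)" using that by (simp add: unitary_group_def trace_I)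
    finally show ?thesis by (simp add: norm_eq_sqrt_inner)
  qed
  then have "bounded ?U" by (intro boundedI[of _ "sqrt (of_nat CARD('m))"]) simp
  ultimately show ?thesis by (simp add: compact_eq_bounded_closed)
qed

definition J_orbit :: "(complex ^ ('n::finite + 'n) ^ ('n + 'n)) set" where
  "J_orbit = (\<lambda>U. U ** J_matrix ** transpose U) ` carrier unitary_group"

lemma bounded_linear_transpose: "bounded_linear (transpose :: complex ^ 'm::finite ^ 'k::finite \<Rightarrow> _)"
proof -
  have "linear (transpose :: complex ^ 'm ^ 'k \<Rightarrow> _)"
    by (intro linearI) (simp_all add: transpose_def vec_eq_iff)
  then show ?thesis by (simp add: linear_conv_bounded_linear)
qed

lemma continuous_on_J_orbit_map: "continuous_on S (\<lambda>U :: complex ^ ('n::finite + 'n) ^ ('n + 'n). U ** J_matrix ** transpose U)"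
  by (intro bounded_bilinear.continuous_on[OF bounded_bilinear_matrix_mult] continuous_on_id continuous_on_const
      linear_continuous_on[OF bounded_linear_transpose])

lemma compact_J_orbit: "compact (J_orbit :: (complex ^ ('n::finite + 'n) ^ ('n + 'n)) set)"
  unfolding J_orbit_def by (rule compact_continuous_image[OF continuous_on_J_orbit_map compact_unitary_group])

lemma sum_UNIV_sum: "(\<Sum>b\<in>(UNIV :: ('c::finite + 'd::finite) set). f b) = (\<Sum>a\<in>UNIV. f (Inl a)) + (\<Sum>a\<in>UNIV. f (Inr a))"
  unfolding UNIV_Plus_UNIV[symmetric] by (subst sum.Plus) (simp_all add: o_def)

lemma J_matrix_square: "J_matrix ** J_matrix = (- mat 1 :: complex ^ ('n::finite + 'n) ^ ('n + 'n))"
proof -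
  have "(J_matrix ** J_matrix) $ p $ q = (- mat 1 :: complex ^ ('n + 'n) ^ ('n + 'n)) $ p $ q" for p q :: "'n + 'n"
    by (cases p; cases q) (simp_all add: matrix_matrix_mult_def J_matrix_def sum_UNIV_sum mat_def if_distrib[of "\<lambda>x. x * _"] cong: if_cong)
  then show ?thesis by (simp add: vec_eq_iff)
qed

lemma invertible_J_matrix: "invertible (J_matrix :: complex ^ ('n::finite + 'n) ^ ('n + 'n))"
proof (rule matrix_inv_eqI(1))
  show "J_matrix ** (- J_matrix) = (mat 1 :: complex ^ ('n + 'n) ^ ('n + 'n))"
    using bounded_bilinear.minus_right[OF bounded_bilinear_matrix_mult, of J_matrix J_matrix]
    by (simp add: J_matrix_square)
qed

lemma invertible_J_orbit: "A \<in> J_orbit \<Longrightarrow> invertible A"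
proof -
  assume "A \<in> J_orbit"
  then obtain U where U: "U \<in> carrier unitary_group" "A = U ** J_matrix ** transpose U"
    by (auto simp: J_orbit_def)
  have "invertible U" using U(1) matrix_inv_eqI(1)[of U "adjoint_matrix U"] by (simp add: unitary_group_def)
  then show ?thesis unfolding U(2) by (intro invertible_mult invertible_J_matrix) (simp_all add: invertible_det_nz det_transpose)
qed

lemma open_invertible: "open {A :: complex ^ 'm::finite ^ 'm. invertible A}"
proof -
  have "continuous_on UNIV (\<lambda>A :: complex ^ 'm ^ 'm. A $ i $ j)" for i j
    by (rule linear_continuous_on[OF bounded_linear_compose[OF bounded_linear_vec_nth bounded_linear_vec_nth]])
  then have "continuous_on UNIV (\<lambda>A :: complex ^ 'm ^ 'm. det A)"
    unfolding det_def by (intro continuous_on_sum continuous_on_mult continuous_on_const continuous_on_prod)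
  then have "open ((\<lambda>A :: complex ^ 'm ^ 'm. det A) -` (- {0}))"
    by (intro open_vimage) auto
  then show ?thesis by (simp add: invertible_det_nz vimage_def)
qed

lemma J_orbit_nonempty: "J_matrix \<in> J_orbit"
proof -
  have "mat 1 \<in> carrier unitary_group" by (simp add: unitary_group_def)
  then have "mat 1 ** J_matrix ** transpose (mat 1) \<in> J_orbit" unfolding J_orbit_def by (rule imageI)
  then show ?thesis by (simp add: transpose_mat)
qed

text \<open>Leaves room for approximation: maps uniformly close to maps into the orbit still have
  invertible values, and invertibility is all that closedness of the forms asks for.\<close>

lemma J_orbit_neighbourhood:
  obtains \<eta> where "\<eta> > 0"
    "\<And>A M :: complex ^ ('n::finite + 'n) ^ ('n + 'n). A \<in> J_orbit \<Longrightarrow> norm (M - A) < \<eta> \<Longrightarrow> invertible M"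
proof -
  obtain \<eta> where \<eta>: "\<eta> > 0" "{x :: complex ^ ('n + 'n) ^ ('n + 'n). infdist x J_orbit \<le> \<eta>} \<subseteq> {A. invertible A}"
    using compact_in_open_separated[OF _ compact_J_orbit open_invertible] J_orbit_nonempty invertible_J_orbit
    by (metis (mono_tags) empty_iff mem_Collect_eq subsetI)
  have "invertible M" if "A \<in> J_orbit" "norm (M - A) < \<eta>" for A M :: "complex ^ ('n + 'n) ^ ('n + 'n)"
  proof -
    have "infdist M J_orbit \<le> dist M A" by (rule infdist_le[OF that(1)])
    then have "infdist M J_orbit \<le> \<eta>" using that(2) by (simp add: dist_norm)
    then show ?thesis using \<eta>(2) by blast
  qed
  then show thesis using that \<eta>(1) by blast
qed

lemma prod_top_of_set: "prod_topology (top_of_set S) (top_of_set T) = top_of_set (S \<times> T)"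
  for S :: "'a::topological_space set" and T :: "'b::topological_space set"
  unfolding subtopology_Times[symmetric] by (simp add: euclidean_product_topology)

text \<open>The sets of the cover are shrunk, which is possible by compactness; the deformation slows down
  to rest outside of a smaller set.\<close>

lemma global_deformation:
  fixes S :: "'a::metric_space set"
  assumes S: "compact S" "S \<noteq> {}"
    and U: "\<And>i. i < n \<Longrightarrow> categorical_in (top_of_set S) (U i)" "(\<Union>i<n. U i) = S"
  obtains h :: "nat \<Rightarrow> real \<times> 'a \<Rightarrow> 'a" and c where
    "\<And>i. i < n \<Longrightarrow> continuous_on ({0..1} \<times> S) (h i)"
    "\<And>i s x. i < n \<Longrightarrow> s \<in> {0..1} \<Longrightarrow> x \<in> S \<Longrightarrow> h i (s, x) \<in> S"
    "\<And>i x. i < n \<Longrightarrow> x \<in> S \<Longrightarrow> h i (0, x) = x"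
    "\<And>x. x \<in> S \<Longrightarrow> \<exists>i<n. h i (1, x) = c i"
proof -
  have "\<exists>c H. c \<in> S \<and> continuous_on ({0..1} \<times> U i) H \<and> H ` ({0..1} \<times> U i) \<subseteq> S \<and>
      (\<forall>x. H (0 :: real, x) = x) \<and> (\<forall>x. H (1, x) = c)" if i: "i < n" for i
  proof -
    obtain c where c: "c \<in> S"
      "homotopic_with (\<lambda>_. True) (subtopology (top_of_set S) (U i)) (top_of_set S) (\<lambda>x. x) (\<lambda>_. c)"
      using U(1)[OF i] by (auto simp: categorical_in_def)
    have "U i \<subseteq> S" using U(2) i by blast
    then have "subtopology (top_of_set S) (U i) = top_of_set (U i)"
      by (simp add: subtopology_subtopology inf_absorb2)
    with c(2) obtain H where H: "continuous_map (prod_topology (top_of_set {0..1::real}) (top_of_set (U i))) (top_of_set S) H"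
      "\<forall>x. H (0, x) = x" "\<forall>x. H (1, x) = c"
      by (auto simp: homotopic_with_def)
    have "continuous_on ({0..1} \<times> U i) H" "H ` ({0..1} \<times> U i) \<subseteq> S"
      using H(1) unfolding prod_top_of_set
      by (simp_all add: continuous_map_in_subtopology image_subset_iff_funcset)
    with c(1) H(2,3) show ?thesis by (intro exI conjI)
  qed
  then obtain c H where cH: "\<And>i. i < n \<Longrightarrow> c i \<in> S \<and> continuous_on ({0..1} \<times> U i) (H i) \<and>
      H i ` ({0..1} \<times> U i) \<subseteq> S \<and> (\<forall>x. H i (0 :: real, x) = x) \<and> (\<forall>x. H i (1, x) = c i)"
    by metis
  have H: "c i \<in> S" "continuous_on ({0..1} \<times> U i) (H i)" "H i ` ({0..1} \<times> U i) \<subseteq> S"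
      "\<And>x. x \<in> U i \<Longrightarrow> H i (0, x) = x" "\<And>x. x \<in> U i \<Longrightarrow> H i (1, x) = c i" if "i < n" for i
    using cH[OF that] by simp_all
  \<comment> \<open>The distance to the empty set is 0 by convention, hence the separate value 1
    when \<open>U i\<close> is all of \<open>S\<close>.\<close>
  define \<delta> where "\<delta> i x = (if S - U i = {} then 1 else infdist x (S - U i))" for i x
  have \<delta>_cont: "continuous_on S (\<delta> i)" for i
    by (cases "S - U i = {}") (simp_all add: \<delta>_def[abs_def] continuous_on_infdist continuous_on_id)
  have \<delta>_nonneg: "\<delta> i x \<ge> 0" for i x by (simp add: \<delta>_def infdist_nonneg)
  have \<delta>_in: "x \<in> U i" if "x \<in> S" "\<delta> i x > 0" for i x
  proof (rule ccontr)
    assume "x \<notin> U i"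
    then have "x \<in> S - U i" using that by blast
    then have "\<delta> i x = 0" unfolding \<delta>_def by (auto simp: infdist_zero)
    then show False using that(2) by simp
  qed
  have \<delta>_pos: "\<delta> i x > 0" if "i < n" "x \<in> U i" for i x
  proof -
    have "openin (top_of_set S) (U i)" using U(1)[OF that(1)] by (simp add: categorical_in_def)
    then have "closedin (top_of_set S) (S - U i)" by (rule closedin_diff[OF closedin_self])
    then have "closed (S - U i)" by (rule compact_imp_closed[OF closedin_compact[OF S(1)]])
    then show ?thesis using that infdist_pos_not_in_closed[of "S - U i" x] by (auto simp: \<delta>_def)
  qed
  have n: "n > 0" using U(2) S(2) by (cases n) auto
  obtain x0 where x0: "x0 \<in> S" "\<And>x. x \<in> S \<Longrightarrow> (\<Sum>i<n. \<delta> i x0) \<le> (\<Sum>i<n. \<delta> i x)"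
    using continuous_attains_inf[OF S, of "\<lambda>x. \<Sum>i<n. \<delta> i x"] continuous_on_sum[of "{..<n}" S \<delta>] \<delta>_cont by auto
  \<comment> \<open>The minimum over \<open>S\<close> of the average of the
    \<open>\<delta> i\<close>; at every point at least one of them reaches this value.\<close>
  define e where "e = (\<Sum>i<n. \<delta> i x0) / n"
  have e: "e > 0"
  proof -
    obtain i where "i < n" "x0 \<in> U i" using x0(1) U(2) by blast
    then have "(\<Sum>i<n. \<delta> i x0) > 0"
      using \<delta>_pos \<delta>_nonneg by (intro sum_pos2[of _ i]) auto
    then show ?thesis using n by (simp add: e_def)
  qed
  have large: "\<exists>i<n. \<delta> i x \<ge> e" if "x \<in> S" for x
  proof (rule ccontr)
    assume "\<not> ?thesis"
    then have "(\<Sum>i<n. \<delta> i x) < (\<Sum>i<n. e)" using n by (intro sum_strict_mono) auto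
    also have "\<dots> = (\<Sum>i<n. \<delta> i x0)" using n by (simp add: e_def)
    finally show False using x0(2)[OF that] by simp
  qed
  \<comment> \<open>Rises from 0 at \<open>\<delta> i x = e / 2\<close> to 1 at
    \<open>\<delta> i x = e\<close>. The homotopy \<open>H i\<close> is thus used only on a
    relatively closed part of \<open>U i\<close>, and on the border of that part it rests, so it
    glues with the identity.\<close>
  define \<phi> where "\<phi> i x = max 0 (min 1 ((2 * \<delta> i x - e) / e))" for i x
  have \<phi>: "\<phi> i x \<in> {0..1}" "\<delta> i x \<le> e / 2 \<Longrightarrow> \<phi> i x = 0" "\<delta> i x \<ge> e \<Longrightarrow> \<phi> i x = 1" for i x
    using e by (auto simp: \<phi>_def max_def min_def field_simps)
  define h where "h i p = (if \<delta> i (snd p) \<le> e / 2 then snd p else H i (fst p * \<phi> i (snd p), snd p))" for i and p :: "real \<times> 'a"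
  have sphi: "s * \<phi> i x \<in> {0..1}" if "s \<in> {0..1}" for s i x
    using that \<phi>(1)[of i x] by (auto intro: mult_le_one)
  show thesis
  proof (rule that[of h c])
    fix i assume i: "i < n"
    show "continuous_on ({0..1} \<times> S) (h i)"
      unfolding h_def[abs_def]
    proof (rule continuous_on_cases_le)
      have ds: "continuous_on ({0..1} \<times> S) (\<lambda>p::real \<times> 'a. \<delta> i (snd p))"
        by (rule continuous_on_compose2[OF \<delta>_cont continuous_on_snd[OF continuous_on_id]]) auto
      then show "continuous_on ({0..1} \<times> S) (\<lambda>p::real \<times> 'a. \<delta> i (snd p))" .
      show "continuous_on {p \<in> {0..1} \<times> S. \<delta> i (snd p) \<le> e / 2} (\<lambda>p. snd p)"
        by (intro continuous_on_snd continuous_on_id)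
      have "continuous_on ({0..1} \<times> S) (\<lambda>p. (fst p * \<phi> i (snd p), snd p))"
        unfolding \<phi>_def
        using ds e by (intro continuous_intros) auto
      then have c: "continuous_on {p \<in> {0..1} \<times> S. e / 2 \<le> \<delta> i (snd p)} (\<lambda>p. (fst p * \<phi> i (snd p), snd p))"
        by (rule continuous_on_subset) auto
      show "continuous_on {p \<in> {0..1} \<times> S. e / 2 \<le> \<delta> i (snd p)} (\<lambda>p. H i (fst p * \<phi> i (snd p), snd p))"
        by (rule continuous_on_compose2[OF H(2)[OF i] c]) (use sphi \<delta>_in e in force)
      fix p :: "real \<times> 'a" assume "p \<in> {0..1} \<times> S" "\<delta> i (snd p) = e / 2"
      then show "snd p = H i (fst p * \<phi> i (snd p), snd p)"
        using H(4)[OF i, of "snd p"] \<delta>_in[of "snd p" i] e \<phi>(2)[of i "snd p"] by auto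
    qed
    fix x assume x: "x \<in> S"
    have in_U: "x \<in> U i" if "\<not> \<delta> i x \<le> e / 2" using \<delta>_in[OF x, of i] that e by auto
    show "h i (0, x) = x" using H(4)[OF i] in_U by (simp add: h_def)
    fix s :: real assume "s \<in> {0..1}"
    then show "h i (s, x) \<in> S"
      using H(3)[OF i] in_U sphi[of s i x] x unfolding h_def by auto
  next
    fix x assume x: "x \<in> S"
    obtain i where i: "i < n" "\<delta> i x \<ge> e" using large[OF x] by blast
    then have "h i (1, x) = c i" using \<phi>(3)[of i x] H(5)[OF i(1)] \<delta>_in[OF x, of i] e by (simp add: h_def)
    then show "\<exists>i<n. h i (1, x) = c i" using i by blast
  qed
qed

section \<open>Flattening a map near a point\<close>

definition bump :: "real \<Rightarrow> real \<Rightarrow> real" where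
  "bump a s = max 0 (s - a) ^ 3 * inverse (max 0 (s - a) ^ 3 + max 0 (2 * a - s) ^ 3)"

text \<open>Equal to \<open>c\<close> where the squared distance to \<open>c\<close> is at most
  \<open>a\<close>, and the identity where it is at least \<open>2 * a\<close>. Composition with it
  turns a map that is nearly \<open>c\<close> around a point into one that is constant
  there.\<close>

definition retract_near :: "real \<Rightarrow> 'a::real_inner \<Rightarrow> 'a \<Rightarrow> 'a" where
  "retract_near a c x = c + bump a ((x - c) \<bullet> (x - c)) *\<^sub>R (x - c)"

lemma bump_denominator: "a > 0 \<Longrightarrow> max 0 (s - a) ^ 3 + max 0 (2 * a - s) ^ 3 > (0::real)"
proof (cases "s > a")
  case True
  then show ?thesis by (intro add_pos_nonneg) auto
next
  case False
  assume "a > 0"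
  then show ?thesis using False by (intro add_nonneg_pos) auto
qed

lemma bump_range: "a > 0 \<Longrightarrow> bump a s \<in> {0..1}" "a > 0 \<Longrightarrow> s \<ge> 2 * a \<Longrightarrow> bump a s = 1" "s \<le> a \<Longrightarrow> bump a s = 0"
  using bump_denominator[of a s] by (auto simp: bump_def field_simps)

lemma smooth_op_retract_near:
  fixes c :: "'a::euclidean_space"
  assumes "a > 0" shows "smooth_op (retract_near a c)"
proof -
  have sq: "smooth_op (\<lambda>x. (x - c) \<bullet> (x - c))"
    by (intro smooth_op_inner smooth_op_diff smooth_op_ident smooth_op_const)
  have "max 0 ((x - c) \<bullet> (x - c) - a) ^ 3 + max 0 (2 * a - (x - c) \<bullet> (x - c)) ^ 3 \<noteq> 0" for x
    using bump_denominator[OF assms] by (metis less_irrefl)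
  then have "smooth_op (\<lambda>x. bump a ((x - c) \<bullet> (x - c)))"
    unfolding bump_def
    by (intro smooth_op_mult smooth_op_inverse smooth_op_add smooth_op_pos_part_cube smooth_op_diff
        smooth_op_const sq)
  then show ?thesis
    unfolding retract_near_def[abs_def]
    by (intro smooth_op_add smooth_op_scaleR smooth_op_diff smooth_op_ident smooth_op_const)
qed

lemma retract_near_dist:
  assumes "a > 0" shows "norm (retract_near a c x - x) \<le> sqrt (2 * a)"
proof -
  let ?s = "(x - c) \<bullet> (x - c)"
  have "retract_near a c x - x = (bump a ?s - 1) *\<^sub>R (x - c)"
    by (simp add: retract_near_def algebra_simps)
  then have n: "norm (retract_near a c x - x) = (1 - bump a ?s) * norm (x - c)"
    using bump_range(1)[OF assms, of ?s] by (simp add: abs_if)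
  show ?thesis
  proof (cases "?s \<ge> 2 * a")
    case True then show ?thesis using n bump_range(2)[OF assms, of ?s] assms by simp
  next
    case False
    then have "norm (x - c) \<le> sqrt (2 * a)" unfolding norm_eq_sqrt_inner by (intro real_sqrt_le_mono) simp
    moreover have "(1 - bump a ?s) * norm (x - c) \<le> 1 * norm (x - c)"
      using bump_range(1)[OF assms, of ?s] by (intro mult_right_mono) auto
    ultimately show ?thesis using n by simp
  qed
qed

lemma retract_near_eq: "norm (x - c) ^ 2 \<le> a \<Longrightarrow> retract_near a c x = c"
  by (simp add: retract_near_def bump_range(3) power2_norm_eq_inner)

section \<open>The cycle in the orbit\<close>

lemma (in block_setting) GL_map_psi:
  fixes e :: "'c::finite \<Rightarrow> nat"
  assumes C: "invertible C" and e: "bij_betw e UNIV {..<n}" shows "GL_map (psi C)"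
proof -
  obtain bs where bs: "distinct bs" "set bs = UNIV"
    "\<And>C t. psi C t = mprod (map (\<lambda>b. block_factor e C b t) bs)" by (rule psi_eq_mprod[OF e]) blast
  show ?thesis
    unfolding bs(3)[abs_def] by (rule GL_map_mprod[OF GL_map_block_factor[OF C e]])
qed

lemma (in block_setting) psi_indep_time: "psi C (t(off n := s)) = psi C t"
proof -
  have "block_reflect idx 1 k (t(off n := s)) = block_reflect idx 1 k t" if "k < n" for k
  proof (rule block_reflect_facts(2)[OF that])
    show "off n \<notin> set (block_list k)" using Union_block_list[of n] that by blast
  qed simp
  then have "map (\<lambda>k. block_reflect idx 1 k (t(off n := s))) [0..<n] = map (\<lambda>k. block_reflect idx 1 k t) [0..<n]"
    by simp
  then show ?thesis unfolding psi_def by (simp only:)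
qed

lemma (in block_setting) psi_boundary:
  fixes e :: "'c::finite \<Rightarrow> nat"
  assumes C: "invertible C" and e: "bij_betw e UNIV {..<n}" and j: "j < off n"
  shows "(\<forall>t. psi C (t(j := 1)) = psi C (t(j := 0))) \<or>
    (\<forall>t. t j \<in> {0, 1} \<longrightarrow> (\<exists>k l u. k \<noteq> l \<and> k \<noteq> j \<and> l \<noteq> j \<and> k < off n \<and> l < off n \<and>
        proportional_at k l u t (psi C)))"
proof -
  have e_less: "e a < n" for a using bij_betwE[OF e] by auto
  obtain bs where bs: "distinct bs" "set bs = UNIV"
    "\<And>C t. psi C t = mprod (map (\<lambda>b. block_factor e C b t) bs)" by (rule psi_eq_mprod[OF e]) blast
  from block_reflect_boundary[OF j] show ?thesis
  proof
    assume *: "\<forall>eps k t. \<bar>eps\<bar> = 1 \<and> k < n \<longrightarrow> block_reflect idx eps k (t(j := 1)) = block_reflect idx eps k (t(j := 0))"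
    have "map (\<lambda>k. block_reflect idx 1 k (t(j := 1))) [0..<n] = map (\<lambda>k. block_reflect idx 1 k (t(j := 0))) [0..<n]" for t
      using *[rule_format, of 1] by simp
    then show ?thesis unfolding psi_def by (simp only:) blast
  next
    assume *: "\<forall>t. t j \<in> {0, 1} \<longrightarrow> (\<exists>k l u. k \<noteq> l \<and> k \<noteq> j \<and> l \<noteq> j \<and> k < off n \<and> l < off n \<and>
        (\<forall>eps i. \<bar>eps\<bar> = 1 \<and> i < n \<longrightarrow> proportional_at k l u t (block_reflect idx eps i)))"
    have imp: "proportional_at k l u t (psi C)"
      if "\<forall>eps i. \<bar>eps\<bar> = 1 \<and> i < n \<longrightarrow> proportional_at k l u t (block_reflect idx eps i)" for k l u t
      unfolding bs(3)[abs_def]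
    proof (rule proportional_at_mprod[OF GL_map_block_factor[OF C e]])
      show "proportional_at k l u t (block_factor e C b)" for b
        using that[rule_format, of 1] that[rule_format, of "- 1"] e_less
        by (auto simp: block_factor_def proportional_at_const split: option.split sum.split)
    qed
    have "\<exists>k l u. k \<noteq> l \<and> k \<noteq> j \<and> l \<noteq> j \<and> k < off n \<and> l < off n \<and> proportional_at k l u t (psi C)"
      if "t j \<in> {0, 1}" for t
    proof -
      from * have "t j \<in> {0, 1} \<longrightarrow> (\<exists>k l u. k \<noteq> l \<and> k \<noteq> j \<and> l \<noteq> j \<and> k < off n \<and> l < off n \<and>
        (\<forall>eps i. \<bar>eps\<bar> = 1 \<and> i < n \<longrightarrow> proportional_at k l u t (block_reflect idx eps i)))" by (rule spec)
      from mp[OF this that] show ?thesis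
        by (elim exE conjE) (intro exI conjI, assumption+, rule imp)
    qed
    then show ?thesis by blast
  qed
qed

lemma unitary_mult:
  assumes "A ** adjoint_matrix A = mat 1" "B ** adjoint_matrix B = mat 1"
  shows "(A ** B) ** adjoint_matrix (A ** B) = mat 1"
proof -
  have "(A ** B) ** adjoint_matrix (A ** B) = A ** (B ** adjoint_matrix B) ** adjoint_matrix A"
    by (simp add: adjoint_matrix_mult matrix_mul_assoc)
  then show ?thesis by (simp add: assms)
qed

lemma psi_in_J_orbit:
  fixes idx :: "'n::finite + 'n \<Rightarrow> nat"
  assumes "block_setting idx n"
  shows "block_setting.psi idx n J_matrix t \<in> J_orbit"
proof -
  interpret block_setting idx n by (rule assms)
  let ?P = "mprod (map (\<lambda>k. block_reflect idx 1 k t) [0..<n])"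
  have "mprod (map (\<lambda>k. block_reflect idx 1 k t) ks) ** adjoint_matrix (mprod (map (\<lambda>k. block_reflect idx 1 k t) ks)) = mat 1"
    if "set ks \<subseteq> {..<n}" for ks
    using that by (induction ks) (simp_all add: unitary_mult block_reflect_unitary)
  from this[of "[0..<n]"] have 1: "?P ** adjoint_matrix ?P = mat 1" by (simp add: atLeast0LessThan)
  then have "adjoint_matrix ?P ** ?P = mat 1" by (simp add: matrix_left_right_inverse)
  with 1 have "?P \<in> carrier unitary_group" by (simp add: unitary_group_def)
  then show ?thesis unfolding psi_def J_orbit_def by blast
qed

text \<open>The maps \<open>h i\<close> are only continuous, so polynomials replace them, which
  spoils their values at the end times. Corrections restore the identity at time 0, where the
  integral is nonzero, and make the \<open>i\<close>-th map stationary at time 1 around every point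
  that \<open>h i\<close> sends to \<open>c i\<close>, so that the product vanishes.\<close>

theorem no_small_deformation:
  fixes h :: "nat \<Rightarrow> real \<times> (complex ^ ('n::finite + 'n) ^ ('n + 'n)) \<Rightarrow> complex ^ ('n + 'n) ^ ('n + 'n)"
  assumes n: "n = CARD('n)"
    and cont: "\<And>i. i < n \<Longrightarrow> continuous_on ({0..1} \<times> J_orbit) (h i)"
    and h_in: "\<And>i s x. i < n \<Longrightarrow> s \<in> {0..1} \<Longrightarrow> x \<in> J_orbit \<Longrightarrow> h i (s, x) \<in> J_orbit"
    and h0: "\<And>i x. i < n \<Longrightarrow> x \<in> J_orbit \<Longrightarrow> h i (0, x) = x"
    and h1: "\<And>x. x \<in> J_orbit \<Longrightarrow> \<exists>i<n. h i (1, x) = c i"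
  shows False
proof -
  have card: "CARD('n + 'n) = 2 * n" by (simp add: n)
  obtain idx :: "'n + 'n \<Rightarrow> nat" where idx: "bij_betw idx UNIV {..<CARD('n + 'n)}"
    using ex_bij_betw_finite_nat[of "UNIV :: ('n + 'n) set"] by (auto simp: atLeast0LessThan)
  obtain e :: "'n \<Rightarrow> nat" where e: "bij_betw e UNIV {..<n}"
    using ex_bij_betw_finite_nat[of "UNIV :: 'n set"] by (auto simp: atLeast0LessThan n)
  interpret block_setting idx n by standard (use idx card in auto)
  interpret form_blocks n "off n" block_list by (rule form_blocks_block_list)
  let ?\<psi> = "psi J_matrix"
  have \<psi>: "GL_map ?\<psi>" by (rule GL_map_psi[OF invertible_J_matrix e])
  have \<psi>2: "C2 ?\<psi>" using \<psi> by (simp add: GL_map_def)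
  have \<psi>X: "?\<psi> t \<in> J_orbit" for t by (rule psi_in_J_orbit) unfold_locales
  obtain \<eta> where \<eta>: "\<eta> > 0" "\<And>A M :: complex ^ ('n + 'n) ^ ('n + 'n). A \<in> J_orbit \<Longrightarrow> norm (M - A) < \<eta> \<Longrightarrow> invertible M"
    using J_orbit_neighbourhood by blast
  \<comment> \<open>Here \<open>sqrt (2 * a)\<close> is \<eta> / 4 and \<open>d\<close> is \<eta> /
    8, so the total error \<open>2 * d + sqrt (2 * a)\<close> is \<eta> / 2. Moreover
    \<open>d ^ 2 \<le> a\<close> puts every point within \<open>d\<close> of \<open>c i\<close> into
    the flat region of \<open>rt i\<close>.\<close>
  define a where "a = (\<eta> / 4) ^ 2 / 2"
  define d where "d = \<eta> / 8"
  have "2 * a = (\<eta> / 4)\<^sup>2" by (simp add: a_def)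
  then have sqrt_a: "sqrt (2 * a) = \<eta> / 4" using real_sqrt_abs[of "\<eta> / 4"] \<eta>(1) by simp
  have a: "a > 0" and d: "d > 0" "d ^ 2 \<le> a" "2 * d + sqrt (2 * a) < \<eta>"
    unfolding sqrt_a using \<eta>(1) by (simp_all add: a_def d_def power2_eq_square)
  have "compact ({0..1::real} \<times> (J_orbit :: (complex ^ ('n + 'n) ^ ('n + 'n)) set))"
    by (intro compact_Times compact_Icc compact_J_orbit)
  then have "\<forall>i. \<exists>p. i < n \<longrightarrow> polynomial_function p \<and> (\<forall>x\<in>{0..1} \<times> J_orbit. norm (h i x - p x) < d)"
    using Stone_Weierstrass_polynomial_function[OF _ cont d(1)] by blast
  from choice[OF this] obtain p where p: "\<And>i. i < n \<Longrightarrow> polynomial_function (p i)"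
    "\<And>i x. i < n \<Longrightarrow> x \<in> {0..1} \<times> J_orbit \<Longrightarrow> norm (h i x - p i x) < d" by blast
  define rt where "rt i = retract_near a (c i)" for i
  \<comment> \<open>The corrections for the two end times, weighted linearly in time:
    \<open>q i (0, A)\<close> is \<open>A\<close>, and \<open>q i (1, A)\<close> is
    \<open>rt i (p i (1, A))\<close>.\<close>
  define q where "q i sA = p i sA + (1 - fst sA) *\<^sub>R (snd sA - p i (0, snd sA)) +
      fst sA *\<^sub>R (rt i (p i (1, snd sA)) - p i (1, snd sA))" for i and sA :: "real \<times> (complex ^ ('n + 'n) ^ ('n + 'n))"
  have q_smooth: "smooth_op (q i)" if i: "i < n" for i
  proof -
    have P: "smooth_op (p i)" by (rule smooth_op_polynomial_function[OF p(1)[OF i]])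
    have fs: "smooth_op (fst :: real \<times> (complex ^ ('n + 'n) ^ ('n + 'n)) \<Rightarrow> _)"
      "smooth_op (snd :: real \<times> (complex ^ ('n + 'n) ^ ('n + 'n)) \<Rightarrow> _)"
      by (rule bounded_linear.smooth_op[OF bounded_linear_fst] bounded_linear.smooth_op[OF bounded_linear_snd])+
    have P': "smooth_op (\<lambda>sA :: real \<times> (complex ^ ('n + 'n) ^ ('n + 'n)). p i (r, snd sA))" for r :: real
      by (rule smooth_op_compose[OF P smooth_op_Pair[OF smooth_op_const fs(2)]])
    have X: "smooth_op (\<lambda>sA :: real \<times> (complex ^ ('n + 'n) ^ ('n + 'n)). rt i (p i (1, snd sA)))"
      unfolding rt_def by (rule smooth_op_compose[OF smooth_op_retract_near[OF a] P'])
    show ?thesis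
      unfolding q_def[abs_def]
      by (rule smooth_op_add[OF smooth_op_add[OF P smooth_op_scaleR[OF smooth_op_diff[OF smooth_op_const fs(1)] smooth_op_diff[OF fs(2) P']]]
            smooth_op_scaleR[OF fs(1) smooth_op_diff[OF X P']]])
  qed
  have q_inv: "invertible (q i (s, A))" if i: "i < n" and s: "s \<in> {0..1}" and A: "A \<in> J_orbit" for i s A
  proof (rule \<eta>(2)[OF h_in[OF i s A]])
    have 1: "norm (p i (s, A) - h i (s, A)) < d" "norm (A - p i (0, A)) < d"
      using p(2)[OF i, of "(s, A)"] p(2)[OF i, of "(0, A)"] s A h0[OF i A] by (simp_all add: norm_minus_commute)
    have 2: "norm (rt i (p i (1, A)) - p i (1, A)) \<le> sqrt (2 * a)"
      unfolding rt_def by (rule retract_near_dist[OF a])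
    have "q i (s, A) - h i (s, A) = (p i (s, A) - h i (s, A)) + (1 - s) *\<^sub>R (A - p i (0, A)) +
        s *\<^sub>R (rt i (p i (1, A)) - p i (1, A))" by (simp add: q_def)
    then have "norm (q i (s, A) - h i (s, A)) \<le> norm (p i (s, A) - h i (s, A)) + \<bar>1 - s\<bar> * norm (A - p i (0, A)) +
        \<bar>s\<bar> * norm (rt i (p i (1, A)) - p i (1, A))"
      by (metis norm_scaleR norm_triangle_le norm_triangle_mono norm_triangle_ineq order_refl)
    also have "\<dots> \<le> d + 1 * d + 1 * sqrt (2 * a)"
      using 1 2 s d(1) by (intro add_mono mult_mono) auto
    also have "\<dots> < \<eta>" using d(3) by simp
    finally show "norm (q i (s, A) - h i (s, A)) < \<eta>" .
  qed
  \<comment> \<open>Coordinates range over the whole line, but invertibility is known for times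
    between 0 and 1 only. The squared sine stays in this range and takes the values 0 and 1 at times
    0 and 1.\<close>
  define tm where "tm t = (sin (pi / 2 * t (off n)))\<^sup>2" for t :: point
  have tm: "tm t \<in> {0..1}" for t
    unfolding tm_def using abs_sin_le_one[of "pi / 2 * t (off n)"] by (simp add: abs_square_le_1)
  have tm2: "C2 tm"
    unfolding tm_def[abs_def] power2_eq_square by (intro C2_mult C2_sin_coord)
  define g where "g i t = q i (tm t, ?\<psi> t)" for i t
  have F2: "C2 (\<lambda>t. (tm t, ?\<psi> t))" by (rule C2_Pair[OF tm2 \<psi>2])
  have g: "GL_map (g i)" if "i < n" for i
    unfolding GL_map_def g_def[abs_def]
    using smooth_op_C2[OF q_smooth[OF that] F2] q_inv[OF that tm \<psi>X] by blast
  let ?t = "\<lambda>_::nat. 1 / 2 :: real"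
  have hom: "box_integral [0..<off n] (\<lambda>t. wedge g (t(off n := 1))) ?t = box_integral [0..<off n] (\<lambda>t. wedge g (t(off n := 0))) ?t"
  proof (rule box_integral_wedge_homotopy[OF g])
    fix j assume j: "j < off n"
    from psi_boundary[OF invertible_J_matrix e j]
    show "(\<forall>i<n. \<forall>t. g i (t(j := 1)) = g i (t(j := 0))) \<or>
      (\<forall>t. t j \<in> {0, 1} \<longrightarrow> (\<exists>k l u. k \<noteq> l \<and> k \<noteq> j \<and> l \<noteq> j \<and> k \<le> off n \<and> l \<le> off n \<and>
        (\<forall>i<n. proportional_at k l u t (g i))))"
    proof
      assume *: "\<forall>t. ?\<psi> (t(j := 1)) = ?\<psi> (t(j := 0))"
      have "tm (t(j := 1)) = tm (t(j := 0))" for t using j by (simp add: tm_def)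
      then show ?thesis unfolding g_def *[rule_format] by simp
    next
      assume *: "\<forall>t. t j \<in> {0, 1} \<longrightarrow> (\<exists>k l u. k \<noteq> l \<and> k \<noteq> j \<and> l \<noteq> j \<and> k < off n \<and> l < off n \<and>
        proportional_at k l u t ?\<psi>)"
      have "\<exists>k l u. k \<noteq> l \<and> k \<noteq> j \<and> l \<noteq> j \<and> k \<le> off n \<and> l \<le> off n \<and>
        (\<forall>i<n. proportional_at k l u t (g i))" if "t j \<in> {0, 1}" for t
      proof -
        from * have "t j \<in> {0, 1} \<longrightarrow> (\<exists>k l u. k \<noteq> l \<and> k \<noteq> j \<and> l \<noteq> j \<and> k < off n \<and> l < off n \<and>
          proportional_at k l u t ?\<psi>)" by (rule spec)
        from mp[OF this that] obtain k l u where kl: "k \<noteq> l" "k \<noteq> j" "l \<noteq> j" "k < off n" "l < off n"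
          "proportional_at k l u t ?\<psi>" by (elim exE conjE)
        have "pd x tm = (\<lambda>_. 0)" if "x < off n" for x
          by (rule pd_indep) (use that in \<open>simp add: tm_def\<close>)
        then have "proportional_at k l u t tm" using kl by (simp add: proportional_at_def)
        then have "proportional_at k l u t (\<lambda>t. (tm t, ?\<psi> t))"
          by (rule proportional_at_Pair[OF C2_C1[OF tm2] C2_C1[OF \<psi>2] _ kl(6)])
        then have "proportional_at k l u t (g i)" if "i < n" for i
          unfolding g_def[abs_def] by (rule smooth_op_proportional[OF q_smooth[OF that] F2])
        then show ?thesis using kl less_imp_le by blast
      qed
      then show ?thesis by blast
    qed
  qed
  have start: "wedge g (t(off n := 0)) = wedge (\<lambda>_. ?\<psi>) t" for t
  proof -
    have "g i (t(off n := 0)) = ?\<psi> t" for i t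
      by (simp add: g_def q_def tm_def psi_indep_time)
    then show ?thesis unfolding wedge_slice by (simp only:)
  qed
  have stop: "wedge g (t(off n := 1)) = 0" for t
  proof -
    define G where "G i t = rt i (p i (1, ?\<psi> t))" for i t
    have "g i (t(off n := 1)) = G i t" for i t
      by (simp add: g_def q_def tm_def psi_indep_time G_def)
    then have "wedge g (t(off n := 1)) = wedge G t" unfolding wedge_slice by (simp only:)
    also have "\<dots> = 0"
    proof -
      \<comment> \<open>The index may change from point to point; at each point it singles out a
        factor of the product that vanishes.\<close>
      obtain i where i: "i < n" "h i (1, ?\<psi> t) = c i" using h1[OF \<psi>X] by blast
      \<comment> \<open>\<open>h i\<close> takes the value \<open>c i\<close> at this one point,
        perhaps not around it. The polynomial, however, stays within \<open>d\<close> of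
        \<open>c i\<close> nearby, and \<open>rt i\<close> makes it constant.\<close>
      have pdG: "pd k (G i) t = 0" for k
      proof (rule pd_eqI)
        let ?f = "\<lambda>s. norm (p i (1, ?\<psi> (t(k := s))) - c i)"
        have "C2 (\<lambda>t. p i (1, ?\<psi> t))"
          by (rule smooth_op_C2[OF smooth_op_polynomial_function[OF p(1)[OF i(1)]] C2_Pair[OF C2_const \<psi>2]])
        then have "continuous_on UNIV (\<lambda>s. p i (1, ?\<psi> (t(k := s))))"
          by (intro continuous_on_line C2_continuous)
        then have f: "continuous_on UNIV ?f" by (intro continuous_intros)
        have "norm (p i (1, ?\<psi> t) - c i) < d"
          using p(2)[OF i(1), of "(1, ?\<psi> t)"] \<psi>X i(2) by (simp add: norm_minus_commute)
        then have "t k \<in> ?f -` {..<d}" by simp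
        moreover have "open (?f -` {..<d})" by (rule open_vimage[OF open_lessThan f])
        moreover have "G i (t(k := s)) = c i" if "s \<in> ?f -` {..<d}" for s
        proof -
          have "?f s ^ 2 \<le> d ^ 2" using that by (intro power_mono) auto
          then show ?thesis unfolding G_def rt_def using d(2) by (intro retract_near_eq) simp
        qed
        ultimately show "((\<lambda>s. G i (t(k := s))) has_vector_derivative 0) (at (t k))"
          by (intro has_vector_derivative_transform_within_open[OF has_vector_derivative_const[of "c i"]]) auto
      qed
      interpret mm: bounded_bilinear "(**) :: complex ^ ('n + 'n) ^ ('n + 'n) \<Rightarrow> complex ^ ('n + 'n) ^ ('n + 'n) \<Rightarrow> complex ^ ('n + 'n) ^ ('n + 'n)"
        by (rule bounded_bilinear_matrix_mult)
      obtain x xs where xs: "block_list i = x # xs" using blk_nonempty[OF i(1)] by (cases "block_list i") auto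
      have "trace_form (G i) \<sigma> (block_list i) t = 0" for \<sigma>
        by (simp add: xs trace_form_def log_pd_def pdG mm.zero_left mm.zero_right trace_def)
      then have "form_prod G \<sigma> t = 0" for \<sigma>
        unfolding form_prod_def using i(1) by (intro prod_zero) auto
      then show ?thesis by (simp add: wedge_def)
    qed
    finally show ?thesis .
  qed
  have "box_integral [0..<off n] (wedge (\<lambda>_. ?\<psi>)) ?t = 0"
    using hom unfolding start stop by (simp add: box_integral_zero)
  then show False using box_integral_wedge_psi[OF invertible_J_matrix e] by simp
qed

section \<open>The homogeneous space as an orbit\<close>

lemma categorical_in_homeomorphic_image:
  assumes fg: "homeomorphic_maps X Y f g" and U: "categorical_in X U"
  shows "categorical_in Y (f ` U)"
proof -
  have f: "continuous_map X Y f" and g: "continuous_map Y X g"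
    and gf: "\<And>x. x \<in> topspace X \<Longrightarrow> g (f x) = x" and fg': "\<And>y. y \<in> topspace Y \<Longrightarrow> f (g y) = y"
    using fg by (auto simp: homeomorphic_maps_def)
  from U obtain c where U': "openin X U" and c: "c \<in> topspace X"
    and h: "homotopic_with (\<lambda>_. True) (subtopology X U) X (\<lambda>x. x) (\<lambda>_. c)"
    by (auto simp: categorical_in_def)
  have sub: "U \<subseteq> topspace X" using U' by (rule openin_subset)
  have "open_map X Y f"
    using fg homeomorphic_map_maps homeomorphic_imp_open_map by blast
  then have o: "openin Y (f ` U)" using U' by (simp add: open_map_def)
  have "g \<in> f ` U \<rightarrow> U" using gf sub by auto
  then have g': "continuous_map (subtopology Y (f ` U)) (subtopology X U) g"
    using g by (auto simp: continuous_map_in_subtopology continuous_map_from_subtopology)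
  have "homotopic_with (\<lambda>_. True) (subtopology Y (f ` U)) X ((\<lambda>x. x) \<circ> g) ((\<lambda>_. c) \<circ> g)"
    by (rule homotopic_with_compose_continuous_map_right[OF h g']) simp
  then have "homotopic_with (\<lambda>_. True) (subtopology Y (f ` U)) Y (f \<circ> ((\<lambda>x. x) \<circ> g)) (f \<circ> ((\<lambda>_. c) \<circ> g))"
    by (rule homotopic_with_compose_continuous_map_left[OF _ f]) simp
  then have "homotopic_with (\<lambda>_. True) (subtopology Y (f ` U)) Y (\<lambda>x. x) (\<lambda>_. f c)"
    by (rule homotopic_with_eq) (auto simp: fg')
  moreover have "f c \<in> topspace Y" using f c by (auto simp: continuous_map_def)
  ultimately show ?thesis using o by (auto simp: categorical_in_def)
qed

lemma LS_cat_le_homeomorphic: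
  assumes fg: "homeomorphic_maps X Y f g"
  shows "LS_cat Y \<le> LS_cat X"
proof -
  have *: "\<exists>\<V>. finite \<V> \<and> (\<forall>U\<in>\<V>. categorical_in Y U) \<and> \<Union>\<V> = topspace Y \<and> card \<V> \<le> card \<U>"
    if \<U>: "finite \<U>" "\<forall>U\<in>\<U>. categorical_in X U" "\<Union>\<U> = topspace X" for \<U>
  proof (intro exI conjI)
    show "finite ((`) f ` \<U>)" "card ((`) f ` \<U>) \<le> card \<U>"
      using \<U>(1) by (auto intro: card_image_le)
    show "\<forall>U\<in>(`) f ` \<U>. categorical_in Y U"
      using \<U>(2) categorical_in_homeomorphic_image[OF fg] by blast
    have "\<Union>((`) f ` \<U>) = f ` topspace X" unfolding \<U>(3)[symmetric] by blast
    also have "\<dots> = topspace Y"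
      using fg homeomorphic_imp_surjective_map homeomorphic_maps_map by blast
    finally show "\<Union>((`) f ` \<U>) = topspace Y" .
  qed
  have "(INF \<V> \<in> {\<V>. finite \<V> \<and> (\<forall>U\<in>\<V>. categorical_in Y U) \<and> \<Union>\<V> = topspace Y}. enat (card \<V>)) \<le>
      (INF \<U> \<in> {\<U>. finite \<U> \<and> (\<forall>U\<in>\<U>. categorical_in X U) \<and> \<Union>\<U> = topspace X}. enat (card \<U>))"
  proof (rule INF_mono)
    fix \<U> assume "\<U> \<in> {\<U>. finite \<U> \<and> (\<forall>U\<in>\<U>. categorical_in X U) \<and> \<Union>\<U> = topspace X}"
    then have "finite \<U>" "\<forall>U\<in>\<U>. categorical_in X U" "\<Union>\<U> = topspace X" by simp_all
    from *[OF this] obtain \<V> where "finite \<V>" "\<forall>U\<in>\<V>. categorical_in Y U" "\<Union>\<V> = topspace Y" "card \<V> \<le> card \<U>"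
      by (elim exE conjE)
    then show "\<exists>\<V>\<in>{\<V>. finite \<V> \<and> (\<forall>U\<in>\<V>. categorical_in Y U) \<and> \<Union>\<V> = topspace Y}. enat (card \<V>) \<le> enat (card \<U>)"
      by (intro bexI[of _ \<V>]) simp_all
  qed
  moreover have "a - 1 \<le> b - 1" if "a \<le> b" for a b :: enat
    using that by (cases a; cases b) (auto simp: one_enat_def)
  ultimately show ?thesis unfolding LS_cat_def by blast
qed

lemma LS_cat_homeomorphic: "X homeomorphic_space Y \<Longrightarrow> LS_cat X = LS_cat Y"
  by (metis LS_cat_le_homeomorphic homeomorphic_maps_sym homeomorphic_space_def order_antisym)

text \<open>Both spaces carry the quotient topology of the same equivalence relation on
  \<open>X\<close>.\<close>

lemma quotient_maps_homeomorphic_space: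
  assumes f: "quotient_map X Y f" and g: "quotient_map X Z g"
    and eq: "\<And>x y. x \<in> topspace X \<Longrightarrow> y \<in> topspace X \<Longrightarrow> f x = f y \<longleftrightarrow> g x = g y"
  shows "Y homeomorphic_space Z"
proof -
  obtain k where k: "continuous_map Y Z k" "\<And>x. x \<in> topspace X \<Longrightarrow> k (f x) = g x"
    by (rule quotient_map_lift_exists[OF f quotient_imp_continuous_map[OF g]]) (simp_all add: eq)
  obtain l where l: "continuous_map Z Y l" "\<And>x. x \<in> topspace X \<Longrightarrow> l (g x) = f x"
    by (rule quotient_map_lift_exists[OF g quotient_imp_continuous_map[OF f]]) (simp_all add: eq)
  have "f ` topspace X = topspace Y" "g ` topspace X = topspace Z"
    using f g quotient_imp_surjective_map by blast+
  then have "homeomorphic_maps Y Z k l"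
    using k l unfolding homeomorphic_maps_def by (metis imageE)
  then show ?thesis by (auto simp: homeomorphic_space_def)
qed

text \<open>The unitary group acts on matrices by M \<mapsto> U M U^T, and
  \<open>symplectic_group\<close> is the stabilizer of \<open>J_matrix\<close>; the cosets are the
  fibres of the orbit map.\<close>

lemma symplectic_coset_eq_iff:
  fixes A B :: "complex ^ ('n::finite + 'n) ^ ('n + 'n)"
  assumes A: "A \<in> carrier unitary_group" and B: "B \<in> carrier unitary_group"
  shows "A <#\<^bsub>unitary_group\<^esub> symplectic_group = B <#\<^bsub>unitary_group\<^esub> symplectic_group \<longleftrightarrow>
    A ** J_matrix ** transpose A = B ** J_matrix ** transpose B"
proof -
  let ?G = "unitary_group :: (complex ^ ('n + 'n) ^ ('n + 'n)) monoid"
  interpret group ?G by (rule group_unitary_group)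
  interpret subgroup symplectic_group ?G by (rule subgroup_symplectic_group)
  have mult: "mult ?G = (**)" by (simp add: unitary_group_def)
  have AA: "A ** adjoint_matrix A = mat 1" "adjoint_matrix A ** A = mat 1"
    "B ** adjoint_matrix B = mat 1" "adjoint_matrix B ** B = mat 1"
    using A B by (auto simp: unitary_group_def)
  let ?C = "adjoint_matrix B ** A"
  have C: "?C \<in> carrier ?G"
  proof -
    have "adjoint_matrix B \<in> carrier ?G" using AA by (simp add: unitary_group_def)
    from monoid.m_closed[OF is_monoid this A] show ?thesis by (simp add: mult)
  qed
  have BC: "B ** ?C = A" by (simp add: matrix_mul_assoc AA)
  have conj: "A ** J_matrix ** transpose A = B ** (?C ** J_matrix ** transpose ?C) ** transpose B"
  proof -
    have "A ** J_matrix ** transpose A = (B ** ?C) ** J_matrix ** transpose (B ** ?C)" by (simp only: BC)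
    then show ?thesis by (simp add: matrix_transpose_mul matrix_mul_assoc)
  qed
  have "invertible B" "invertible (transpose B)"
    using matrix_inv_eqI(1)[OF AA(3)] by (simp_all add: invertible_det_nz)
  then have "matrix_inv B ** (B ** M ** transpose B) ** matrix_inv (transpose B) = M" for M
    by (simp add: matrix_mul_assoc[symmetric] matrix_inv_invertible) (simp add: matrix_mul_assoc matrix_inv_invertible)
  then have cancel: "B ** M ** transpose B = B ** N ** transpose B \<longleftrightarrow> M = N" for M N
    by (rule inj_on_eq_iff[OF inj_on_inverseI]) auto
  have "A <#\<^bsub>?G\<^esub> symplectic_group = B <#\<^bsub>?G\<^esub> symplectic_group \<longleftrightarrow> ?C \<in> symplectic_group"
  proof
    assume "A <#\<^bsub>?G\<^esub> symplectic_group = B <#\<^bsub>?G\<^esub> symplectic_group"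
    moreover have "A \<in> A <#\<^bsub>?G\<^esub> symplectic_group"
      using one_closed A r_one[OF A] by (force simp: l_coset_def)
    ultimately obtain S where S: "S \<in> symplectic_group" "A = B ** S"
      by (auto simp: l_coset_def mult)
    then have "?C = S" by (simp add: matrix_mul_assoc AA)
    then show "?C \<in> symplectic_group" using S(1) by simp
  next
    assume "?C \<in> symplectic_group"
    then have "B ** ?C \<in> B <#\<^bsub>?G\<^esub> symplectic_group" unfolding l_coset_def mult by blast
    then have "A \<in> B <#\<^bsub>?G\<^esub> symplectic_group" unfolding BC .
    then show "A <#\<^bsub>?G\<^esub> symplectic_group = B <#\<^bsub>?G\<^esub> symplectic_group"
      by (rule l_repr_independence[OF _ B subgroup_symplectic_group, symmetric])
  qed
  also have "\<dots> \<longleftrightarrow> ?C ** J_matrix ** transpose ?C = J_matrix"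
    using C unfolding symplectic_group_def by blast
  also have "\<dots> \<longleftrightarrow> A ** J_matrix ** transpose A = B ** J_matrix ** transpose B"
    unfolding conj by (rule cancel[symmetric])
  finally show ?thesis .
qed

text \<open>The orbit map is a continuous surjection from a compact space to a Hausdorff space,
  hence a quotient map, and it has the same fibres as the coset map.\<close>

lemma homogeneous_space_homeomorphic:
  "homogeneous_space (unitary_group :: (complex ^ ('n::finite + 'n) ^ ('n + 'n)) monoid) symplectic_group
    homeomorphic_space top_of_set (J_orbit :: (complex ^ ('n + 'n) ^ ('n + 'n)) set)"
  unfolding homogeneous_space_def
proof (rule quotient_maps_homeomorphic_space[OF quotient_map_quotient_topology])
  let ?U = "carrier (unitary_group :: (complex ^ ('n + 'n) ^ ('n + 'n)) monoid)"
  show "quotient_map (top_of_set ?U) (top_of_set J_orbit) (\<lambda>U. U ** J_matrix ** transpose U)"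
    by (rule T1_Spaces.continuous_imp_quotient_map)
      (auto simp: J_orbit_def continuous_on_J_orbit_map compact_unitary_group compact_space_subtopology
        Hausdorff_space_subtopology)
  show "A <#\<^bsub>unitary_group\<^esub> symplectic_group = B <#\<^bsub>unitary_group\<^esub> symplectic_group \<longleftrightarrow>
    A ** J_matrix ** transpose A = B ** J_matrix ** transpose B"
    if "A \<in> topspace (top_of_set ?U)" "B \<in> topspace (top_of_set ?U)" for A B
    using that by (intro symplectic_coset_eq_iff) simp_all
qed

lemma categorical_cover_card:
  fixes \<U> :: "(complex ^ ('n::finite + 'n) ^ ('n + 'n)) set set"
  assumes fin: "finite \<U>" and cat: "\<forall>U\<in>\<U>. categorical_in (top_of_set J_orbit) U" and cover: "\<Union>\<U> = J_orbit"
  shows "card \<U> > CARD('n)"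
proof (rule ccontr)
  assume "\<not> ?thesis"
  then have le: "card \<U> \<le> CARD('n)" by simp
  let ?n = "CARD('n)"
  have ne: "(J_orbit :: (complex ^ ('n + 'n) ^ ('n + 'n)) set) \<noteq> {}" using J_orbit_nonempty by blast
  then obtain U0 where U0: "U0 \<in> \<U>" using cover by blast
  obtain f where f: "bij_betw f {0..<card \<U>} \<U>" using ex_bij_betw_nat_finite[OF fin] by blast
  \<comment> \<open>A smaller cover is padded by repetition, because each of the n forms has to be
    assigned a set of its own.\<close>
  define V where "V i = (if i < card \<U> then f i else U0)" for i
  have V: "V ` {..<?n} = \<U>"
  proof
    show "V ` {..<?n} \<subseteq> \<U>" using f U0 by (auto simp: V_def bij_betw_def)
    have "\<U> = f ` {0..<card \<U>}" using f by (simp add: bij_betw_def)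
    also have "\<dots> = V ` {0..<card \<U>}" by (rule image_cong) (auto simp: V_def)
    also have "\<dots> \<subseteq> V ` {..<?n}" using le by (intro image_mono) auto
    finally show "\<U> \<subseteq> V ` {..<?n}" .
  qed
  have V': "categorical_in (top_of_set J_orbit) (V i)" if "i < ?n" for i using V cat that by blast
  have Vc: "(\<Union>i<?n. V i) = J_orbit" unfolding V cover ..
  show False
  proof (rule global_deformation[OF compact_J_orbit ne V' Vc], goal_cases)
    case (1 i)
    then show ?case .
  next
    case (2 h c)
    show False by (rule no_small_deformation[OF HOL.refl 2(1-4)])
  qed
qed

section \<open>The upper bound\<close>

definition skew_unitary :: "(complex ^ 'm ^ 'm) set" where
  "skew_unitary = {A. adjoint_matrix A ** A = mat 1 \<and> transpose A = - A}"

definition quat :: "complex ^ 'm ^ 'm \<Rightarrow> complex ^ 'm \<Rightarrow> complex ^ 'm" where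
  "quat A v = A *v (\<chi> i. cnj (v $ i))"

lemma herm_commute: "cnj (herm a b) = herm b a"
  by (simp add: herm_def mult.commute)

lemma herm_self: "herm a a = of_real ((norm a)\<^sup>2)"
proof -
  have "herm a a = of_real (a \<bullet> a)"
    by (simp add: herm_def inner_vec_def complex_eq_iff Re_sum Im_sum inner_complex_def)
  then show ?thesis by (simp add: power2_norm_eq_inner)
qed

lemma herm_smult [simp]: "herm a (c *s b) = c * herm a b" "herm (c *s a) b = cnj c * herm a b"
  by (simp_all add: herm_def sum_distrib_left mult_ac)

lemma herm_matrix_vector: "herm a (A *v b) = herm (adjoint_matrix A *v a) b"
  unfolding herm_def matrix_vector_mult_def adjoint_matrix_def
  by (simp add: sum_distrib_left sum_distrib_right mult_ac) (rule sum.swap)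

lemma quat_smult: "quat A (c *s v) = cnj c *s quat A v"
  by (simp add: quat_def vec_eq_iff matrix_vector_mult_def sum_distrib_left mult_ac)

context
  fixes A :: "complex ^ 'm::finite ^ 'm"
  assumes A: "A \<in> skew_unitary"
begin

text \<open>For a skew matrix the entrywise conjugate is minus the adjoint, and unitarity does the
  rest.\<close>

lemma quat_quat: "quat A (quat A v) = - v"
proof -
  have "adjoint_matrix A $ i $ j = - cnj (A $ i $ j)" for i j
  proof -
    have "transpose A $ i $ j = - A $ i $ j" using A by (simp add: skew_unitary_def)
    then show ?thesis by (simp add: transpose_def adjoint_matrix_def)
  qed
  then have *: "cnj (A $ i $ j) = - adjoint_matrix A $ i $ j" for i j by simp
  have "(\<chi> i. cnj (quat A v $ i)) = - (adjoint_matrix A *v v)"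
    by (simp add: quat_def matrix_vector_mult_def vec_eq_iff * sum_negf)
  then have "quat A (quat A v) = A *v (- (adjoint_matrix A *v v))" by (simp only: quat_def[of A "quat A v"])
  also have "\<dots> = - ((A ** adjoint_matrix A) *v v)"
    by (simp add: matrix_vector_mul_assoc linear_neg[OF matrix_vector_mul_linear])
  also have "A ** adjoint_matrix A = mat 1"
    using A by (simp add: skew_unitary_def matrix_left_right_inverse)
  finally show ?thesis by simp
qed

lemma herm_quat_quat: "herm (quat A u) (quat A v) = herm v u"
proof -
  have "herm (quat A u) (quat A v) = herm ((adjoint_matrix A ** A) *v (\<chi> i. cnj (u $ i))) (\<chi> i. cnj (v $ i))"
    unfolding quat_def herm_matrix_vector by (simp add: matrix_vector_mul_assoc)
  also have "\<dots> = herm v u"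
    using A by (simp add: skew_unitary_def) (simp add: herm_def mult.commute)
  finally show ?thesis .
qed

lemma herm_quat_left: "herm (quat A u) v = - herm (quat A v) u"
proof -
  have "herm v (quat A u) = - herm u (quat A v)"
  proof -
    have sk: "A $ i $ j = - A $ j $ i" for i j
    proof -
      have "transpose A $ j $ i = - A $ j $ i" using A by (simp add: skew_unitary_def)
      then show ?thesis by (simp add: transpose_def)
    qed
    have "herm v (quat A u) = (\<Sum>i\<in>UNIV. \<Sum>j\<in>UNIV. cnj (v $ i) * (A $ i $ j * cnj (u $ j)))"
      unfolding herm_def quat_def matrix_vector_mult_def by (simp add: sum_distrib_left)
    also have "\<dots> = (\<Sum>i\<in>UNIV. \<Sum>j\<in>UNIV. cnj (v $ i) * (- A $ j $ i * cnj (u $ j)))"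
      by (intro sum.cong HOL.refl arg_cong2[where f = "(*)"] sk)
    also have "\<dots> = (\<Sum>j\<in>UNIV. \<Sum>i\<in>UNIV. cnj (v $ i) * (- A $ j $ i * cnj (u $ j)))" by (rule sum.swap)
    also have "\<dots> = - herm u (quat A v)"
      unfolding herm_def quat_def matrix_vector_mult_def by (simp add: sum_distrib_left sum_negf mult_ac)
    finally show ?thesis .
  qed
  then have "cnj (herm v (quat A u)) = - cnj (herm u (quat A v))" by simp
  then show ?thesis by (simp add: herm_commute)
qed

lemma herm_quat_self [simp]: "herm (quat A u) u = 0" "herm u (quat A u) = 0"
proof -
  show "herm (quat A u) u = 0" using herm_quat_left[of u u] by simp
  then have "cnj (herm (quat A u) u) = 0" by simp
  then show "herm u (quat A u) = 0" by (simp add: herm_commute)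
qed

end

definition quat_orthonormal :: "complex ^ 'm ^ 'm \<Rightarrow> 'i set \<Rightarrow> ('i \<Rightarrow> complex ^ 'm) \<Rightarrow> bool" where
  "quat_orthonormal A S u \<longleftrightarrow> (\<forall>a\<in>S. \<forall>b\<in>S. herm (u a) (u b) = of_bool (a = b) \<and> herm (u a) (quat A (u b)) = 0)"

text \<open>Columns outside \<open>S\<close> are zero, so the frame of a proper subset is singular
  and the kernel of its adjoint supplies the next vector of a quaternionic Gram-Schmidt
  process.\<close>

definition quat_frame :: "complex ^ ('n::finite + 'n) ^ ('n + 'n) \<Rightarrow> 'n set \<Rightarrow> ('n \<Rightarrow> complex ^ ('n + 'n)) \<Rightarrow> complex ^ ('n + 'n) ^ ('n + 'n)" where
  "quat_frame A S u = (\<chi> i p. case p of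
      Inl a \<Rightarrow> of_bool (a \<in> S) * u a $ i | Inr a \<Rightarrow> of_bool (a \<in> S) * quat A (u a) $ i)"

lemma quat_frame_orthonormal:
  assumes A: "A \<in> skew_unitary" and u: "quat_orthonormal A S u"
  shows "adjoint_matrix (quat_frame A S u) ** quat_frame A S u =
    (\<chi> p q. of_bool (p = q \<and> (case p of Inl a \<Rightarrow> a \<in> S | Inr a \<Rightarrow> a \<in> S)))"
proof -
  have u1: "herm (u a) (u b) = of_bool (a = b)" "herm (u a) (quat A (u b)) = 0"
    "herm (quat A (u a)) (u b) = 0" if "a \<in> S" "b \<in> S" for a b
  proof -
    show "herm (u a) (u b) = of_bool (a = b)" "herm (u a) (quat A (u b)) = 0"
      using u that by (auto simp: quat_orthonormal_def)
    have "herm (u b) (quat A (u a)) = 0" using u that by (auto simp: quat_orthonormal_def)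
    then have "cnj (herm (u b) (quat A (u a))) = 0" by simp
    then show "herm (quat A (u a)) (u b) = 0" by (simp add: herm_commute)
  qed
  have e: "(adjoint_matrix M ** M) $ p $ q = herm (\<chi> i. M $ i $ p) (\<chi> i. M $ i $ q)"
    for M :: "complex ^ ('n::finite + 'n) ^ ('n + 'n)" and p q
    by (simp add: matrix_matrix_mult_def adjoint_matrix_def herm_def)
  have c: "(\<chi> i. quat_frame A S u $ i $ Inl a) = of_bool (a \<in> S) *s u a"
    "(\<chi> i. quat_frame A S u $ i $ Inr a) = of_bool (a \<in> S) *s quat A (u a)" for a
    by (simp_all add: quat_frame_def vec_eq_iff)
  have "(adjoint_matrix (quat_frame A S u) ** quat_frame A S u) $ p $ q =
    of_bool (p = q \<and> (case p of Inl a \<Rightarrow> a \<in> S | Inr a \<Rightarrow> a \<in> S))" for p q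
    unfolding e by (cases p; cases q) (auto simp: c u1 herm_quat_quat[OF A])
  then show ?thesis by (simp add: vec_eq_iff)
qed

lemma quat_frame_unitary:
  assumes "A \<in> skew_unitary" "quat_orthonormal A UNIV u"
  shows "adjoint_matrix (quat_frame A UNIV u) ** quat_frame A UNIV u = mat 1"
  unfolding quat_frame_orthonormal[OF assms]
  by (auto simp: vec_eq_iff mat_def split: sum.split)

lemma quat_frame_ker:
  "adjoint_matrix (quat_frame A S u) *v v = 0 \<longleftrightarrow> (\<forall>a\<in>S. herm (u a) v = 0 \<and> herm (quat A (u a)) v = 0)"
proof -
  have "(adjoint_matrix (quat_frame A S u) *v v) $ Inl a = of_bool (a \<in> S) * herm (u a) v"
    "(adjoint_matrix (quat_frame A S u) *v v) $ Inr a = of_bool (a \<in> S) * herm (quat A (u a)) v" for a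
    by (simp_all add: matrix_vector_mult_def adjoint_matrix_def quat_frame_def herm_def)
  moreover have "(\<forall>p :: 'a + 'a. f p = 0) \<longleftrightarrow> (\<forall>a. f (Inl a) = 0 \<and> f (Inr a) = 0)" for f :: "'a + 'a \<Rightarrow> complex"
    by (metis sum.exhaust)
  ultimately show ?thesis by (auto simp: vec_eq_iff)
qed

lemma quat_orthonormal_insert:
  assumes A: "A \<in> skew_unitary" and u: "quat_orthonormal A S u" and x: "x \<notin> S"
    and v: "\<And>a. a \<in> S \<Longrightarrow> herm (u a) v = 0" "\<And>a. a \<in> S \<Longrightarrow> herm (quat A (u a)) v = 0" "v \<noteq> 0"
  shows "\<exists>u. quat_orthonormal A (insert x S) u"
proof -
  define w where "w = complex_of_real (1 / norm v) *s v"
  have w1: "herm w w = 1" using v(3) by (simp add: w_def herm_self[of v] power2_eq_square)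
  have w0: "herm (u a) w = 0" "herm (quat A (u a)) w = 0" if "a \<in> S" for a
    using v that by (simp_all add: w_def)
  have w0': "herm w (u a) = 0" "herm (u a) (quat A w) = 0" "herm w (quat A (u a)) = 0" if "a \<in> S" for a
  proof -
    show "herm w (u a) = 0" using herm_commute[of "u a" w] w0(1)[OF that] by simp
    show "herm w (quat A (u a)) = 0" using herm_commute[of "quat A (u a)" w] w0(2)[OF that] by simp
    have "herm (quat A w) (u a) = 0" using herm_quat_left[OF A, of w "u a"] w0(2)[OF that] by simp
    then show "herm (u a) (quat A w) = 0" using herm_commute[of "quat A w" "u a"] by simp
  qed
  have "quat_orthonormal A (insert x S) (u(x := w))"
    using u x by (auto simp: quat_orthonormal_def w1 w0 w0' herm_quat_self[OF A])
  then show ?thesis by blast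
qed

lemma quat_orthonormal_exists:
  fixes A :: "complex ^ ('n::finite + 'n) ^ ('n + 'n)" and S :: "'n set"
  assumes A: "A \<in> skew_unitary"
  shows "\<exists>u. quat_orthonormal A S u"
proof (induction S rule: finite_induct[OF finite])
  case 1
  show ?case by (simp add: quat_orthonormal_def)
next
  case (2 x S)
  then obtain u where u: "quat_orthonormal A S u" by blast
  have "\<not> invertible (adjoint_matrix (quat_frame A S u))"
  proof
    assume "invertible (adjoint_matrix (quat_frame A S u))"
    then obtain B where "adjoint_matrix (quat_frame A S u) ** B = mat 1" by (auto simp: invertible_def)
    then have "(adjoint_matrix (quat_frame A S u) ** B) $ Inl x $ Inl x = 1" by (simp add: mat_def)
    then show False using 2(2) by (simp add: matrix_matrix_mult_def adjoint_matrix_def quat_frame_def)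
  qed
  then obtain v where v: "adjoint_matrix (quat_frame A S u) *v v = 0" "v \<noteq> 0"
    unfolding invertible_left_inverse matrix_left_invertible_ker by blast
  show ?case
    using quat_orthonormal_insert[OF A u 2(2)] v unfolding quat_frame_ker by blast
qed

text \<open>\<open>J_matrix\<close> exchanges the columns \<open>u a\<close> and
  \<open>quat A (u a)\<close>, up to sign, exactly as the structure of \<open>A\<close>
  does.\<close>

lemma quat_frame_J:
  fixes A :: "complex ^ ('n::finite + 'n) ^ ('n + 'n)"
  assumes A: "A \<in> skew_unitary"
  shows "quat_frame A UNIV u ** J_matrix = A ** (\<chi> i j. cnj (quat_frame A UNIV u $ i $ j))"
proof -
  have c: "(A ** (\<chi> i j. cnj (M $ i $ j))) $ i $ p = quat A (\<chi> i. M $ i $ p) $ i"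
    for M :: "complex ^ ('n + 'n) ^ ('n + 'n)" and i p
    by (simp add: quat_def matrix_matrix_mult_def matrix_vector_mult_def)
  have f: "(\<chi> i. quat_frame A UNIV u $ i $ Inl a) = u a" "(\<chi> i. quat_frame A UNIV u $ i $ Inr a) = quat A (u a)" for a
    by (simp_all add: quat_frame_def vec_eq_iff)
  have "(quat_frame A UNIV u ** J_matrix) $ i $ p = (A ** (\<chi> i j. cnj (quat_frame A UNIV u $ i $ j))) $ i $ p" for i p
    unfolding c by (cases p) (simp_all add: f quat_quat[OF A] matrix_matrix_mult_def J_matrix_def sum_UNIV_sum quat_frame_def
        if_distrib[of "\<lambda>x. _ * x"] cong: if_cong)
  then show ?thesis by (simp add: vec_eq_iff)
qed

lemma J_skew_unitary: "(J_matrix :: complex ^ ('n::finite + 'n) ^ ('n + 'n)) \<in> skew_unitary"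
proof -
  have t: "transpose J_matrix = (- J_matrix :: complex ^ ('n + 'n) ^ ('n + 'n))"
    "adjoint_matrix J_matrix = (- J_matrix :: complex ^ ('n + 'n) ^ ('n + 'n))"
    by (auto simp: vec_eq_iff transpose_def adjoint_matrix_def J_matrix_def split: sum.split)
  moreover have "(- J_matrix) ** J_matrix = (mat 1 :: complex ^ ('n + 'n) ^ ('n + 'n))"
    using bounded_bilinear.minus_left[OF bounded_bilinear_matrix_mult, of J_matrix J_matrix] by (simp add: J_matrix_square)
  ultimately show ?thesis unfolding skew_unitary_def by simp
qed

text \<open>Transitivity of the action: a unitary quaternionic frame for \<open>A\<close> carries
  \<open>J_matrix\<close> to \<open>A\<close>.\<close>

lemma J_orbit_eq: "J_orbit = (skew_unitary :: (complex ^ ('n::finite + 'n) ^ ('n + 'n)) set)"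
proof (intro equalityI subsetI)
  fix A :: "complex ^ ('n + 'n) ^ ('n + 'n)"
  assume "A \<in> J_orbit"
  then obtain U where U: "U \<in> carrier unitary_group" "A = U ** J_matrix ** transpose U"
    by (auto simp: J_orbit_def)
  have UU: "adjoint_matrix U ** U = mat 1" "U ** adjoint_matrix U = mat 1" using U(1) by (auto simp: unitary_group_def)
  have UT: "transpose (adjoint_matrix U) = adjoint_matrix (transpose U)"
    by (simp add: transpose_def adjoint_matrix_def vec_eq_iff)
  have "adjoint_matrix (transpose U) ** transpose U = transpose (U ** adjoint_matrix U)"
    by (simp add: UT matrix_transpose_mul)
  then have UTU: "adjoint_matrix (transpose U) ** transpose U = mat 1" by (simp add: UU transpose_mat)
  have J: "adjoint_matrix J_matrix ** J_matrix = (mat 1 :: complex ^ ('n + 'n) ^ ('n + 'n))"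
    "transpose J_matrix = (- J_matrix :: complex ^ ('n + 'n) ^ ('n + 'n))"
    using J_skew_unitary[where 'n = 'n] by (auto simp: skew_unitary_def)
  have "adjoint_matrix A ** A = adjoint_matrix (transpose U) ** (adjoint_matrix J_matrix ** (adjoint_matrix U ** U) ** J_matrix) ** transpose U"
    by (simp add: U(2) adjoint_matrix_mult matrix_mul_assoc)
  also have "\<dots> = mat 1" by (simp add: UU J UTU)
  finally have 1: "adjoint_matrix A ** A = mat 1" .
  have "transpose A = U ** (transpose J_matrix ** transpose U)"
    by (simp add: U(2) matrix_transpose_mul)
  also have "\<dots> = - A"
    by (simp add: J(2) U(2) bounded_bilinear.minus_left[OF bounded_bilinear_matrix_mult]
        bounded_bilinear.minus_right[OF bounded_bilinear_matrix_mult] matrix_mul_assoc)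
  finally show "A \<in> skew_unitary" using 1 by (simp add: skew_unitary_def)
next
  fix A :: "complex ^ ('n + 'n) ^ ('n + 'n)"
  assume A: "A \<in> skew_unitary"
  obtain u :: "'n \<Rightarrow> _" where u: "quat_orthonormal A UNIV u" using quat_orthonormal_exists[OF A] by blast
  let ?U = "quat_frame A UNIV u"
  have U: "adjoint_matrix ?U ** ?U = mat 1" by (rule quat_frame_unitary[OF A u])
  then have U': "?U ** adjoint_matrix ?U = mat 1" by (simp add: matrix_left_right_inverse)
  have "transpose (?U ** adjoint_matrix ?U) = mat 1" unfolding U' by (rule transpose_mat)
  moreover have "transpose (adjoint_matrix ?U) = (\<chi> i j. cnj (?U $ i $ j))"
    by (simp add: transpose_def adjoint_matrix_def vec_eq_iff)
  ultimately have "(\<chi> i j. cnj (?U $ i $ j)) ** transpose ?U = mat 1" by (simp add: matrix_transpose_mul)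
  then have *: "A = ?U ** J_matrix ** transpose ?U"
    by (simp add: quat_frame_J[OF A] matrix_mul_assoc[symmetric])
  show "A \<in> J_orbit" unfolding J_orbit_def
    by (rule image_eqI[of _ _ ?U], rule *) (simp add: unitary_group_def U U')
qed

text \<open>Both structures are antiunitary, so \<open>herm w v\<close> equals itself times
  \<open>cnj z * y\<close>, a factor different from 1.\<close>

lemma eigenvectors_orthogonal:
  assumes A: "A \<in> skew_unitary" and B: "B \<in> skew_unitary"
    and v: "quat A v = z *s quat B v" and w: "quat A w = y *s quat B w"
    and zy: "norm z = 1" "z \<noteq> y"
  shows "herm v w = 0"
proof -
  have "herm w v = herm (quat A v) (quat A w)" by (rule herm_quat_quat[OF A, symmetric])
  also have "\<dots> = cnj z * y * herm w v"
    unfolding v w by (simp add: herm_quat_quat[OF B])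
  finally have "(cnj z * y - 1) * herm w v = 0" by (simp add: algebra_simps)
  moreover have "cnj z * y \<noteq> 1"
  proof
    assume "cnj z * y = 1"
    then have "z * cnj z * y = z" by (simp add: mult.assoc)
    then show False using zy by (simp add: complex_norm_square[symmetric])
  qed
  ultimately have "cnj (herm w v) = 0" by simp
  then show ?thesis by (simp only: herm_commute)
qed

text \<open>Apply \<open>quat A\<close> to the eigenvalue equation; both structures square to
  -1.\<close>

lemma quat_eigenvector:
  assumes A: "A \<in> skew_unitary" and B: "B \<in> skew_unitary" and z: "norm z = 1"
    and v: "quat A v = z *s quat B v"
  shows "quat A (quat B v) = z *s quat B (quat B v)"
proof -
  have "- v = cnj z *s quat A (quat B v)"
    using quat_quat[OF A, of v] unfolding v quat_smult by simp
  then have "z *s (- v) = (z * cnj z) *s quat A (quat B v)" by (simp add: vector_smult_assoc)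
  then show ?thesis using z by (simp add: quat_quat[OF B] complex_norm_square[symmetric])
qed

text \<open>Otherwise there would be n + 1 vectors that are orthonormal over the quaternions. Any n
  of them give a unitary frame, so the remaining one would be orthogonal to the whole space.\<close>

lemma some_resolvent_invertible:
  fixes A B :: "complex ^ ('n::finite + 'n) ^ ('n + 'n)" and z :: "nat \<Rightarrow> complex"
  assumes A: "A \<in> skew_unitary" and B: "B \<in> skew_unitary"
    and z: "inj_on z {..CARD('n)}" "\<And>k. norm (z k) = 1"
  shows "\<exists>k\<le>CARD('n). invertible (cscale (z k) B - A)"
proof (rule ccontr)
  assume none: "\<not> ?thesis"
  have "\<exists>u. herm u u = 1 \<and> quat A u = z k *s quat B u" if k: "k \<le> CARD('n)" for k
  proof -
    have "\<not> invertible (cscale (z k) B - A)" using none k by blast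
    then obtain v where v: "(cscale (z k) B - A) *v v = 0" "v \<noteq> 0"
      unfolding invertible_left_inverse matrix_left_invertible_ker by blast
    have "(cscale (z k) B - A) *v v = z k *s (B *v v) - A *v v"
      by (simp add: vec_eq_iff matrix_vector_mult_def cscale_def sum_subtractf sum_distrib_left algebra_simps)
    with v(1) have Av: "A *v v = z k *s (B *v v)" by simp
    \<comment> \<open>\<open>quat\<close> conjugates its argument, so a kernel vector has to be
      conjugated to become an eigenvector of the antilinear structures.\<close>
    define w where "w = (\<chi> i. cnj (v $ i))"
    have w: "quat A w = z k *s quat B w" using Av by (simp add: w_def quat_def)
    have w0: "w \<noteq> 0" using v(2) by (auto simp: w_def vec_eq_iff)
    define u where "u = complex_of_real (1 / norm w) *s w"
    have "herm u u = 1" using w0 by (simp add: u_def herm_self[of w] power2_eq_square)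
    moreover have "quat A u = z k *s quat B u"
      by (simp add: u_def quat_smult w vector_smult_assoc mult.commute)
    ultimately show ?thesis by blast
  qed
  then have "\<forall>k. \<exists>u. k \<le> CARD('n) \<longrightarrow> herm u u = 1 \<and> quat A u = z k *s quat B u" by blast
  from choice[OF this] obtain u where u: "\<And>k. k \<le> CARD('n) \<Longrightarrow> herm (u k) (u k) = 1"
    "\<And>k. k \<le> CARD('n) \<Longrightarrow> quat A (u k) = z k *s quat B (u k)" by blast
  have orth: "herm (u k) (u l) = 0" "herm (quat A (u k)) (u l) = 0" "herm (u k) (quat A (u l)) = 0"
    if kl: "k \<le> CARD('n)" "l \<le> CARD('n)" "k \<noteq> l" for k l
  proof -
    have ne: "z k \<noteq> z l" using z(1) kl by (auto simp: inj_on_def)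
    show "herm (u k) (u l) = 0"
      by (rule eigenvectors_orthogonal[OF A B u(2)[OF kl(1)] u(2)[OF kl(2)] z(2) ne])
    have "herm (quat B (u k)) (u l) = 0"
      by (rule eigenvectors_orthogonal[OF A B quat_eigenvector[OF A B z(2) u(2)[OF kl(1)]] u(2)[OF kl(2)] z(2) ne])
    then show "herm (quat A (u k)) (u l) = 0" by (simp add: u(2)[OF kl(1)])
    have "herm (u k) (quat B (u l)) = 0"
      by (rule eigenvectors_orthogonal[OF A B u(2)[OF kl(1)] quat_eigenvector[OF A B z(2) u(2)[OF kl(2)]] z(2) ne])
    then show "herm (u k) (quat A (u l)) = 0" by (simp add: u(2)[OF kl(2)])
  qed
  obtain e :: "'n \<Rightarrow> nat" where e: "bij_betw e UNIV {0..<CARD('n)}"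
    using ex_bij_betw_finite_nat[of "UNIV :: 'n set"] by auto
  have e_less: "e a < CARD('n)" for a using bij_betwE[OF e] by auto
  have e_inj: "e a = e b \<longleftrightarrow> a = b" for a b using e by (auto simp: bij_betw_def inj_on_def)
  have q: "quat_orthonormal A UNIV (u \<circ> e)"
  proof -
    have "herm (u (e a)) (u (e b)) = of_bool (a = b) \<and> herm (u (e a)) (quat A (u (e b))) = 0" for a b
      using orth(1,3)[of "e a" "e b"] u(1)[of "e a"] e_less[of a] e_less[of b] herm_quat_self[OF A]
      by (cases "a = b") (auto simp: e_inj)
    then show ?thesis by (simp add: quat_orthonormal_def)
  qed
  let ?U = "quat_frame A UNIV (u \<circ> e)" and ?v = "u CARD('n)"
  have "adjoint_matrix ?U *v ?v = 0"
    unfolding quat_frame_ker using orth(1,2)[of "e _" "CARD('n)"] e_less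
    by (metis comp_apply less_imp_le less_irrefl order_refl)
  then have "?U *v (adjoint_matrix ?U *v ?v) = 0" by simp
  moreover have "?U ** adjoint_matrix ?U = mat 1"
    using quat_frame_unitary[OF A q] by (simp add: matrix_left_right_inverse)
  ultimately have "?v = 0" by (simp add: matrix_vector_mul_assoc)
  then show False using u(1)[of "CARD('n)"] by (simp add: herm_def)
qed

lemma cscale_skew_unitary:
  assumes A: "A \<in> skew_unitary" and z: "norm z = 1"
  shows "cscale z A \<in> skew_unitary"
proof -
  have "adjoint_matrix (cscale z A) = cscale (cnj z) (adjoint_matrix A)"
    "transpose (cscale z A) = cscale z (transpose A)" "cscale z (- A) = - cscale z A"
    by (simp_all add: vec_eq_iff adjoint_matrix_def transpose_def cscale_def)
  moreover have "cnj z * z = 1" "z * cnj z = 1" using z complex_norm_square[of z] by (simp_all add: mult.commute)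
  ultimately show ?thesis using A
    by (simp add: skew_unitary_def cscale_matrix_mult cscale_cscale)
qed

section \<open>Contraction by the Cayley flow\<close>

definition pencil :: "complex ^ 'm ^ 'm \<Rightarrow> complex ^ 'm ^ 'm \<Rightarrow> real \<Rightarrow> complex ^ 'm ^ 'm" where
  "pencil K A t = (t + 1) *\<^sub>R K + (t - 1) *\<^sub>R A"

text \<open>A Cayley transform in the eigenvalues of \<open>A K\<inverse>\<close> conjugates multiplication by \<open>t\<close> on the line
  to a flow on the circle that moves every point except \<open>1\<close> to \<open>-1\<close> as \<open>t\<close> tends to 0.\<close>

definition cayley_flow :: "complex ^ 'm ^ 'm \<Rightarrow> complex ^ 'm ^ 'm \<Rightarrow> real \<Rightarrow> complex ^ 'm ^ 'm" where
  "cayley_flow K A t = pencil A K t ** matrix_inv (pencil K A t) ** K"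

context
  fixes K A :: "complex ^ 'm::finite ^ 'm"
  assumes K: "K \<in> skew_unitary" and A: "A \<in> skew_unitary" and KA: "invertible (K - A)"
begin

interpretation mm: bounded_bilinear "(**) :: complex ^ 'm ^ 'm \<Rightarrow> complex ^ 'm ^ 'm \<Rightarrow> complex ^ 'm ^ 'm"
  by (rule bounded_bilinear_matrix_mult)

text \<open>Exchanging \<open>K\<close> and \<open>A\<close> preserves the Gram matrix: both are
  unitary, and the mixed terms carry the common factor (t + 1)(t - 1).\<close>

lemma adjoint_pencil: "adjoint_matrix (pencil K A t) ** pencil K A t = adjoint_matrix (pencil A K t) ** pencil A K t"
proof -
  have "adjoint_matrix (r *\<^sub>R M + s *\<^sub>R N) = r *\<^sub>R adjoint_matrix M + s *\<^sub>R adjoint_matrix N"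
    for r s and M :: "complex ^ 'm ^ 'm" and N :: "complex ^ 'm ^ 'm"
    by (simp add: adjoint_matrix_def vec_eq_iff)
  moreover have "adjoint_matrix K ** K = mat 1" "adjoint_matrix A ** A = mat 1"
    using K A by (auto simp: skew_unitary_def)
  ultimately show ?thesis
    unfolding pencil_def by (simp add: mm.add_left mm.add_right mm.scaleR_left mm.scaleR_right) (simp add: algebra_simps)
qed

lemma pencil_combination: "(4 * t) *\<^sub>R K = (t + 1) *\<^sub>R pencil K A t - (t - 1) *\<^sub>R pencil A K t"
proof -
  have "(t + 1) *\<^sub>R pencil K A t - (t - 1) *\<^sub>R pencil A K t = ((t + 1) * (t + 1) - (t - 1) * (t - 1)) *\<^sub>R K"
    by (simp add: pencil_def vec_eq_iff scaleR_conv_of_real algebra_simps)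
  also have "(t + 1) * (t + 1) - (t - 1) * (t - 1) = 4 * t" by (simp add: algebra_simps)
  finally show ?thesis by (rule sym)
qed

text \<open>Equal Gram matrices give the two pencils the same kernel, and there
  \<open>pencil_combination\<close> makes 4 t K vanish. At t = 0 the pencil is K - A, which is
  invertible by \<open>KA\<close>.\<close>

lemma invertible_pencil:
  assumes t: "t \<in> {0..1}" shows "invertible (pencil K A t)"
proof (cases "t = 0")
  case True
  then show ?thesis using KA by (simp add: pencil_def)
next
  case False
  have sc: "(r *\<^sub>R M) *v v = r *\<^sub>R (M *v v)" for r and M :: "complex ^ 'm ^ 'm" and v
    by (simp add: vec_eq_iff matrix_vector_mult_def scaleR_sum_right)
  have "v = 0" if v: "pencil K A t *v v = 0" for v
  proof -
    have "herm (pencil A K t *v v) (pencil A K t *v v) = herm ((adjoint_matrix (pencil K A t) ** pencil K A t) *v v) v"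
      unfolding adjoint_pencil by (simp add: herm_matrix_vector matrix_vector_mul_assoc)
    also have "\<dots> = 0" by (simp add: matrix_vector_mul_assoc[symmetric] v herm_def)
    finally have "pencil A K t *v v = 0" by (simp add: herm_self)
    then have "((t + 1) *\<^sub>R pencil K A t - (t - 1) *\<^sub>R pencil A K t) *v v = 0"
      by (simp add: matrix_vector_mult_diff_rdistrib sc v)
    then have "(4 * t) *\<^sub>R (K *v v) = 0" unfolding pencil_combination[symmetric] by (simp only: sc)
    then have "K *v v = 0" using False by simp
    then have "(adjoint_matrix K ** K) *v v = 0" by (simp add: matrix_vector_mul_assoc[symmetric])
    then show "v = 0" using K by (simp add: skew_unitary_def)
  qed
  then show ?thesis unfolding invertible_left_inverse matrix_left_invertible_ker by blast
qed

text \<open>Unitarity is the equality of the Gram matrices. With P, Q for the two pencils and R for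
  the inverse of Q, skewness amounts to K R P = P R K. This holds because 4 t K is a combination of
  P and Q, and at t = 0 because P = - Q.\<close>

lemma cayley_flow_skew_unitary:
  assumes t: "t \<in> {0..1}" shows "cayley_flow K A t \<in> skew_unitary"
proof -
  let ?Q = "pencil K A t" and ?P = "pencil A K t"
  define R where "R = matrix_inv ?Q"
  have R: "?Q ** R = mat 1" "R ** ?Q = mat 1"
    using matrix_inv_invertible[OF invertible_pencil[OF t]] by (simp_all add: R_def)
  have KK: "adjoint_matrix K ** K = mat 1" "transpose K = - K" and AA: "transpose A = - A"
    using K A by (auto simp: skew_unitary_def)
  have "adjoint_matrix (?P ** R ** K) ** (?P ** R ** K) =
      adjoint_matrix K ** (adjoint_matrix R ** (adjoint_matrix ?P ** ?P) ** R) ** K"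
    by (simp add: adjoint_matrix_mult matrix_mul_assoc)
  also have "adjoint_matrix R ** (adjoint_matrix ?P ** ?P) ** R = adjoint_matrix (?Q ** R) ** (?Q ** R)"
    unfolding adjoint_pencil[symmetric] by (simp add: adjoint_matrix_mult matrix_mul_assoc)
  finally have 1: "adjoint_matrix (?P ** R ** K) ** (?P ** R ** K) = mat 1" by (simp add: R KK)
  have T: "transpose (r *\<^sub>R M + s *\<^sub>R N) = r *\<^sub>R transpose M + s *\<^sub>R transpose N"
    for r s and M :: "complex ^ 'm ^ 'm" and N :: "complex ^ 'm ^ 'm"
    by (simp add: transpose_def vec_eq_iff)
  have PT: "transpose ?P = - ?P" "transpose ?Q = - ?Q" unfolding pencil_def T KK AA by simp_all
  have RT: "transpose R = - R"
  proof -
    have "transpose (?Q ** R) = mat 1" unfolding R by (rule transpose_mat)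
    then have "(- transpose R) ** ?Q = mat 1" by (simp add: matrix_transpose_mul PT mm.minus_left mm.minus_right)
    then have "(- transpose R) ** (?Q ** R) = R" by (simp add: matrix_mul_assoc)
    then have "- transpose R = R" by (simp add: R)
    then show ?thesis by (metis minus_minus)
  qed
  have "K ** R ** ?P = ?P ** R ** K"
  proof (cases "t = 0")
    case True
    then have "?P = - ?Q" by (simp add: pencil_def)
    then show ?thesis by (simp add: mm.minus_left mm.minus_right R matrix_mul_assoc[symmetric])
  next
    case False
    have "(4 * t) *\<^sub>R (K ** R ** ?P) = ((4 * t) *\<^sub>R K) ** R ** ?P" by (simp only: mm.scaleR_left)
    also have "\<dots> = (t + 1) *\<^sub>R ?P - (t - 1) *\<^sub>R (?P ** R ** ?P)"
      unfolding pencil_combination by (simp add: mm.diff_left mm.scaleR_left R)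
    also have "\<dots> = ?P ** R ** ((4 * t) *\<^sub>R K)"
      unfolding pencil_combination by (simp add: mm.diff_right mm.scaleR_right R matrix_mul_assoc[symmetric])
    also have "\<dots> = (4 * t) *\<^sub>R (?P ** R ** K)" by (simp only: mm.scaleR_right)
    finally show ?thesis using False by simp
  qed
  then have "transpose (?P ** R ** K) = - (?P ** R ** K)"
    by (simp add: matrix_transpose_mul PT RT KK mm.minus_left mm.minus_right matrix_mul_assoc)
  with 1 show ?thesis by (simp add: skew_unitary_def cayley_flow_def R_def)
qed

lemma cayley_flow_ends: "cayley_flow K A 1 = A" "cayley_flow K A 0 = - K"
proof -
  have "K ** adjoint_matrix K = mat 1" using K by (simp add: skew_unitary_def matrix_left_right_inverse)
  then have "(2 *\<^sub>R K) ** ((1 / 2) *\<^sub>R adjoint_matrix K) = mat 1" by (simp add: mm.scaleR_left mm.scaleR_right)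
  from matrix_inv_eqI(2)[OF this] have "matrix_inv (2 *\<^sub>R K) ** K = (1 / 2) *\<^sub>R mat 1"
    using K by (simp add: skew_unitary_def mm.scaleR_left)
  then show "cayley_flow K A 1 = A"
    by (simp add: cayley_flow_def pencil_def matrix_mul_assoc[symmetric] mm.scaleR_left mm.scaleR_right)
  have "pencil K A 0 = K - A" "pencil A K 0 = - (K - A)" by (simp_all add: pencil_def)
  then have "cayley_flow K A 0 = (- (K - A)) ** matrix_inv (K - A) ** K" by (simp only: cayley_flow_def)
  also have "\<dots> = - K" by (simp only: mm.minus_left matrix_inv_invertible[OF KA] matrix_mul_lid)
  finally show "cayley_flow K A 0 = - K" .
qed

end

lemma categorical_resolvent_set:
  fixes K :: "complex ^ 'm::finite ^ 'm"
  assumes K: "K \<in> skew_unitary"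
  shows "categorical_in (top_of_set skew_unitary) {A \<in> skew_unitary. invertible (K - A)}" (is "categorical_in ?X ?U")
proof -
  have "continuous_on skew_unitary (\<lambda>A. K - A)" by (intro continuous_on_diff continuous_on_const continuous_on_id)
  then have "openin ?X (skew_unitary \<inter> (\<lambda>A. K - A) -` {M. invertible M})"
    by (rule continuous_openin_preimage_gen[OF _ open_invertible])
  moreover have "skew_unitary \<inter> (\<lambda>A. K - A) -` {M. invertible M} = ?U" by auto
  ultimately have o: "openin ?X ?U" by simp
  \<comment> \<open>The flow starts at \<open>A\<close> for parameter 1 and collapses to
    \<open>- K\<close> at parameter 0, so the homotopy runs through it backwards.\<close>
  define h where "h p = cayley_flow K (snd p) (1 - fst p)" for p :: "real \<times> (complex ^ 'm ^ 'm)"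
  have cp: "continuous_on ({0..1} \<times> ?U) (\<lambda>p. pencil K (snd p) (1 - fst p))"
    "continuous_on ({0..1} \<times> ?U) (\<lambda>p. pencil (snd p) K (1 - fst p))"
    unfolding pencil_def by (intro continuous_intros)+
  have "continuous_on ({0..1} \<times> ?U) (\<lambda>p. matrix_inv (pencil K (snd p) (1 - fst p)))"
    by (rule continuous_matrix_inv[OF cp(1)]) (auto intro!: invertible_pencil[OF K])
  then have "continuous_on ({0..1} \<times> ?U) h"
    unfolding h_def[abs_def] cayley_flow_def
    by (intro bounded_bilinear.continuous_on[OF bounded_bilinear_matrix_mult] cp continuous_on_const)
  moreover have "h \<in> ({0..1} \<times> ?U) \<rightarrow> skew_unitary"
    by (auto simp: h_def intro!: cayley_flow_skew_unitary[OF K])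
  ultimately have "continuous_map (top_of_set ({0..1} \<times> ?U)) ?X h"
    by (simp add: continuous_map_in_subtopology image_subset_iff_funcset)
  moreover have "subtopology ?X ?U = top_of_set ?U"
    by (simp add: subtopology_subtopology inf_absorb2)
  moreover have "- K \<in> skew_unitary"
  proof -
    have "cscale (- 1) K = - K" by (simp add: cscale_def vec_eq_iff)
    then show ?thesis using cscale_skew_unitary[OF K, of "- 1"] by simp
  qed
  ultimately show ?thesis
    unfolding categorical_in_def using o
    by (intro conjI bexI[of _ "- K"] homotopic_with[THEN iffD2])
      (auto simp: prod_top_of_set h_def cayley_flow_ends[OF K] intro!: exI[of _ h])
qed

lemma categorical_cover_exists:
  obtains \<U> :: "(complex ^ ('n::finite + 'n) ^ ('n + 'n)) set set" where "finite \<U>" "card \<U> \<le> CARD('n) + 1"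
    "\<forall>U\<in>\<U>. categorical_in (top_of_set J_orbit) U" "\<Union>\<U> = J_orbit"
proof -
  let ?J = "J_matrix :: complex ^ ('n + 'n) ^ ('n + 'n)"
  \<comment> \<open>Roots of unity are a convenient supply of n + 1 distinct points on the
    circle.\<close>
  let ?z = "\<lambda>k. cis (2 * pi * real k / real (CARD('n) + 1))"
  define U where "U k = {A \<in> skew_unitary. invertible (cscale (?z k) ?J - A)}" for k
  have cat: "categorical_in (top_of_set skew_unitary) (U k)" for k
    unfolding U_def by (intro categorical_resolvent_set cscale_skew_unitary J_skew_unitary) simp
  have "inj_on ?z {..<CARD('n) + 1}" by (rule bij_betw_imp_inj_on[OF Complex.bij_betw_roots_unity]) simp
  then have inj: "inj_on ?z {..CARD('n)}" by (simp add: lessThan_Suc_atMost)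
  have "(\<Union>k\<le>CARD('n). U k) = skew_unitary"
    using some_resolvent_invertible[OF _ J_skew_unitary inj] by (auto simp: U_def)
  then show thesis
    using that[of "U ` {..CARD('n)}"] card_image_le[of "{..CARD('n)}" U] cat by (auto simp: J_orbit_eq)
qed

theorem theorem5:
  shows "LS_cat (homogeneous_space
           (unitary_group :: (complex ^ ('n::finite + 'n) ^ ('n + 'n)) monoid)
           symplectic_group) = enat CARD('n)"
proof -
  let ?X = "top_of_set (J_orbit :: (complex ^ ('n + 'n) ^ ('n + 'n)) set)"
  let ?S = "{\<U>. finite \<U> \<and> (\<forall>U\<in>\<U>. categorical_in ?X U) \<and> \<Union>\<U> = topspace ?X}"
  obtain \<U> where \<U>: "\<U> \<in> ?S" "card \<U> \<le> CARD('n) + 1"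
    by (rule categorical_cover_exists) auto
  have "(INF \<U>\<in>?S. enat (card \<U>)) = enat (CARD('n) + 1)"
  proof (rule antisym)
    have "(INF \<U>\<in>?S. enat (card \<U>)) \<le> enat (card \<U>)" by (rule INF_lower[OF \<U>(1)])
    then show "(INF \<U>\<in>?S. enat (card \<U>)) \<le> enat (CARD('n) + 1)"
      using \<U>(2) by (meson enat_ord_simps(1) order_trans)
    show "enat (CARD('n) + 1) \<le> (INF \<U>\<in>?S. enat (card \<U>))"
      by (rule INF_greatest) (auto simp: Suc_le_eq intro: categorical_cover_card)
  qed
  then have "LS_cat ?X = enat CARD('n)" unfolding LS_cat_def by (simp add: one_enat_def)
  then show ?thesis by (simp only: LS_cat_homeomorphic[OF homogeneous_space_homeomorphic])
qed

end
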